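(* Let $n\ge 2$. The category of Ł$_n^c$-algebras and Ł$_n^c$-homomorphisms is dually equivalent to the category $\mathbf{FBS_n}$ of $\bar n$-fuzzy Boolean spaces and continuous functions.
   Context: MV-algebra: an algebra $(A,\oplus,*,{}^{\bot},0,1)$ of type $(2,2,1,0,0)$ with $(A,\oplus,0)$ a commutative monoid and, for all $x,y$: $x\oplus1=1$, $(x^\bot)^\bot=x$, $0^\bot=1$, $(x^\bot\oplus y)^\bot\oplus y=(y^\bot\oplus x)^\bot\oplus x$, $x*y=(x^\bot\oplus y^\bot)^\bot$. Put $0x=0$, $(m+1)x=mx\oplus x$, $x^0=1$, $x^{m+1}=x^m*x$. Derived operations: $x\vee y=(x*y^\bot)\oplus y$, $x\wedge y=(x\oplus y^\bot)*y$, $x\to y=x^\bot\oplus y$. MV$_n$-algebra ($n\ge2$): an MV-algebra satisfying $(n-1)x\oplus x=(n-1)x$, $x^{n-1}*x=x^{n-1}$ and, if $n\ge4$, for every $j$ with $1<j<n-1$ and $j\nmid n-1$: $[(jx)*(x^\bot\oplus[(j-1)x]^\bot)]^{n-1}=0$ and $(n-1)[x^j\oplus(x^\bot*[x^{j-1}]^\bot)]=1$. $\bar n=\{0,\frac1{n-1},\dots,\frac{n-2}{n-1},1\}$ with $x\wedge y=\min(x,y)$, $x\vee y=\max(x,y)$, $x*y=\max(0,x+y-1)$, $x\oplus y=\min(1,x+y)$, $x\to y=\min(1,1-(x-y))$, $x^\bot=1-x$ and every $r\in\bar n$ as a constant. An Ł$_n^c$-algebra is an MV$_n$-algebra enriched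 by $n$ constants, i.e. an MV$_n$-algebra in which the algebra $\bar n$ is embedded (the elements $r\in\bar n$ name constants of the algebra). An Ł$_n^c$-homomorphism preserves all operations $\wedge,\vee,*,\oplus,\to,{}^\bot$ and all constants $r\in\bar n$. $\bar n$-fuzzy topological space: $(X,\tau)$ with $X$ a non-empty set and $\tau\subseteq\bar n^X$ containing all constant functions $r\in\bar n$ and closed under binary pointwise minima and arbitrary pointwise suprema; members of $\tau$ are open. A function $f:(X,\tau_1)\to(Y,\tau_2)$ is continuous if $\tilde B\circ f\in\tau_1$ for all $\tilde B\in\tau_2$. $\bar n$ is given the discrete $\bar n$-fuzzy topology $\bar n^{\bar n}$, and $Cont(X,\tau)$ is the set of continuous functions $X\to\bar n$. An open basis of $(X,\tau)$ is a subset of $\tau$ closed under finite meets such that every member of $\tau$ is a supremum of members of it. $(X,\tau)$ is zero-dimensional if $Cont(X,\tau)$ is an open basis of it; Kolmogorov if for $x_1\ne x_2$ in $X$ there is $\tilde A\in\tau$ with $\tilde A(x_1)\ne\tilde A(x_2)$; compact if whenever $\mathbf 1=\bigvee_{i\in I}\tilde A_i$ with $\tilde A_i\in\tau$ (where $\mathbf 1$ is the constant function $1$) there is a finite $J\subseteq I$ with $\mathbf 1=\bigvee_{i\in J}\tilde A_i$. An $\bar n$-fuzzy Boolean space is an $\bar n$-fuzzy topological space that is zero-dimensional, compact and Kolmogorov. *)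

theory Defs
  imports Complex_Main "HOL-Library.FuncSet" "HOL-Library.Equipollence"
begin

section \<open>Categories and dual equivalence\<close>

text \<open>Hom-sets need not be disjoint, so composition and the arrow part of a functor
  are indexed by the objects involved: \<open>Comp C x y z g f\<close> is
  \<open>g\<close> after \<open>f\<close> for \<open>f\<close> from \<open>x\<close> to \<open>y\<close>
  and \<open>g\<close> from \<open>y\<close> to \<open>z\<close>.\<close>

record ('o, 'm) category =
  Obj :: "'o set"
  Hom :: "'o \<Rightarrow> 'o \<Rightarrow> 'm set"
  Ident :: "'o \<Rightarrow> 'm"
  Comp :: "'o \<Rightarrow> 'o \<Rightarrow> 'o \<Rightarrow> 'm \<Rightarrow> 'm \<Rightarrow> 'm"

definition is_category :: "('o, 'm) category \<Rightarrow> bool" where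
  "is_category C \<longleftrightarrow>
     (\<forall>x\<in>Obj C. Ident C x \<in> Hom C x x) \<and>
     (\<forall>x\<in>Obj C. \<forall>y\<in>Obj C. \<forall>z\<in>Obj C. \<forall>f\<in>Hom C x y. \<forall>g\<in>Hom C y z.
        Comp C x y z g f \<in> Hom C x z) \<and>
     (\<forall>x\<in>Obj C. \<forall>y\<in>Obj C. \<forall>f\<in>Hom C x y.
        Comp C x x y f (Ident C x) = f \<and> Comp C x y y (Ident C y) f = f) \<and>
     (\<forall>w\<in>Obj C. \<forall>x\<in>Obj C. \<forall>y\<in>Obj C. \<forall>z\<in>Obj C.
        \<forall>f\<in>Hom C w x. \<forall>g\<in>Hom C x y. \<forall>h\<in>Hom C y z.
        Comp C w y z h (Comp C w x y g f) = Comp C w x z (Comp C x y z h g) f)"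

definition opposite :: "('o, 'm) category \<Rightarrow> ('o, 'm) category" where
  "opposite C = \<lparr>Obj = Obj C, Hom = (\<lambda>x y. Hom C y x), Ident = Ident C,
                 Comp = (\<lambda>x y z g f. Comp C z y x f g)\<rparr>"

definition full_subcategory :: "('o, 'm) category \<Rightarrow> ('o \<Rightarrow> bool) \<Rightarrow> ('o, 'm) category" where
  "full_subcategory C P = C\<lparr>Obj := {x \<in> Obj C. P x}\<rparr>"

definition is_functor ::
  "('o, 'm) category \<Rightarrow> ('p, 'k) category \<Rightarrow> ('o \<Rightarrow> 'p) \<Rightarrow> ('o \<Rightarrow> 'o \<Rightarrow> 'm \<Rightarrow> 'k) \<Rightarrow> bool" where
  "is_functor C D Fo Fm \<longleftrightarrow>
     (\<forall>x\<in>Obj C. Fo x \<in> Obj D) \<and>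
     (\<forall>x\<in>Obj C. \<forall>y\<in>Obj C. \<forall>f\<in>Hom C x y. Fm x y f \<in> Hom D (Fo x) (Fo y)) \<and>
     (\<forall>x\<in>Obj C. Fm x x (Ident C x) = Ident D (Fo x)) \<and>
     (\<forall>x\<in>Obj C. \<forall>y\<in>Obj C. \<forall>z\<in>Obj C. \<forall>f\<in>Hom C x y. \<forall>g\<in>Hom C y z.
        Fm x z (Comp C x y z g f) = Comp D (Fo x) (Fo y) (Fo z) (Fm y z g) (Fm x y f))"

definition is_iso :: "('o, 'm) category \<Rightarrow> 'o \<Rightarrow> 'o \<Rightarrow> 'm \<Rightarrow> bool" where
  "is_iso C x y f \<longleftrightarrow> f \<in> Hom C x y \<and>
     (\<exists>g\<in>Hom C y x. Comp C x y x g f = Ident C x \<and> Comp C y x y f g = Ident C y)"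

definition natural_iso ::
  "('o, 'm) category \<Rightarrow> ('p, 'k) category \<Rightarrow>
   ('o \<Rightarrow> 'p) \<Rightarrow> ('o \<Rightarrow> 'o \<Rightarrow> 'm \<Rightarrow> 'k) \<Rightarrow> ('o \<Rightarrow> 'p) \<Rightarrow> ('o \<Rightarrow> 'o \<Rightarrow> 'm \<Rightarrow> 'k) \<Rightarrow> ('o \<Rightarrow> 'k) \<Rightarrow> bool" where
  "natural_iso C D Fo Fm Go Gm \<eta> \<longleftrightarrow>
     (\<forall>x\<in>Obj C. is_iso D (Fo x) (Go x) (\<eta> x)) \<and>
     (\<forall>x\<in>Obj C. \<forall>y\<in>Obj C. \<forall>f\<in>Hom C x y.
        Comp D (Fo x) (Fo y) (Go y) (\<eta> y) (Fm x y f) =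
        Comp D (Fo x) (Go x) (Go y) (Gm x y f) (\<eta> x))"

definition equivalent_categories :: "('o, 'm) category \<Rightarrow> ('p, 'k) category \<Rightarrow> bool" where
  "equivalent_categories C D \<longleftrightarrow> is_category C \<and> is_category D \<and>
     (\<exists>Fo Fm Go Gm \<eta> \<epsilon>.
        is_functor C D Fo Fm \<and> is_functor D C Go Gm \<and>
        natural_iso C C (\<lambda>x. x) (\<lambda>x y f. f)
          (\<lambda>x. Go (Fo x)) (\<lambda>x y f. Gm (Fo x) (Fo y) (Fm x y f)) \<eta> \<and>
        natural_iso D D (\<lambda>x. Fo (Go x)) (\<lambda>x y f. Fm (Go x) (Go y) (Gm x y f))
          (\<lambda>x. x) (\<lambda>x y f. f) \<epsilon>)"

definition dually_equivalent :: "('o, 'm) category \<Rightarrow> ('p, 'k) category \<Rightarrow> bool" where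
  "dually_equivalent C D \<longleftrightarrow> equivalent_categories C (opposite D)"


section \<open>MV-algebras\<close>

record 'a mv =
  carrier :: "'a set"
  mvplus :: "'a \<Rightarrow> 'a \<Rightarrow> 'a"  (infixl "\<oplus>\<index>" 65)
  mvtimes :: "'a \<Rightarrow> 'a \<Rightarrow> 'a"  (infixl "\<odot>\<index>" 70)
  mvneg :: "'a \<Rightarrow> 'a"  ("neg\<index> _" [81] 80)
  mvzero :: 'a  ("\<zero>\<index>")
  mvone :: 'a  ("\<one>\<index>")

definition mvjoin :: "('a, 'b) mv_scheme \<Rightarrow> 'a \<Rightarrow> 'a \<Rightarrow> 'a" where
  "mvjoin A x y = mvplus A (mvtimes A x (mvneg A y)) y"

definition mvmeet :: "('a, 'b) mv_scheme \<Rightarrow> 'a \<Rightarrow> 'a \<Rightarrow> 'a" where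
  "mvmeet A x y = mvtimes A (mvplus A x (mvneg A y)) y"

definition mvimp :: "('a, 'b) mv_scheme \<Rightarrow> 'a \<Rightarrow> 'a \<Rightarrow> 'a" where
  "mvimp A x y = mvplus A (mvneg A x) y"

primrec mvmult :: "('a, 'b) mv_scheme \<Rightarrow> nat \<Rightarrow> 'a \<Rightarrow> 'a" where
  "mvmult A 0 x = mvzero A"
| "mvmult A (Suc m) x = mvplus A (mvmult A m x) x"

primrec mvpow :: "('a, 'b) mv_scheme \<Rightarrow> 'a \<Rightarrow> nat \<Rightarrow> 'a" where
  "mvpow A x 0 = mvone A"
| "mvpow A x (Suc m) = mvtimes A (mvpow A x m) x"

locale mv_algebra =
  fixes A :: "('a, 'b) mv_scheme" (structure)
  assumes plus_closed: "\<lbrakk>x \<in> carrier A; y \<in> carrier A\<rbrakk> \<Longrightarrow> x \<oplus> y \<in> carrier A"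
    and times_closed: "\<lbrakk>x \<in> carrier A; y \<in> carrier A\<rbrakk> \<Longrightarrow> x \<odot> y \<in> carrier A"
    and neg_closed: "x \<in> carrier A \<Longrightarrow> neg x \<in> carrier A"
    and zero_closed: "\<zero> \<in> carrier A"
    and one_closed: "\<one> \<in> carrier A"
    and plus_assoc: "\<lbrakk>x \<in> carrier A; y \<in> carrier A; z \<in> carrier A\<rbrakk> \<Longrightarrow>
                       (x \<oplus> y) \<oplus> z = x \<oplus> (y \<oplus> z)"
    and plus_comm: "\<lbrakk>x \<in> carrier A; y \<in> carrier A\<rbrakk> \<Longrightarrow> x \<oplus> y = y \<oplus> x"
    and plus_zero: "x \<in> carrier A \<Longrightarrow> x \<oplus> \<zero> = x"
    and plus_one: "x \<in> carrier A \<Longrightarrow> x \<oplus> \<one> = \<one>"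
    and neg_neg: "x \<in> carrier A \<Longrightarrow> neg (neg x) = x"
    and neg_zero: "neg \<zero> = \<one>"
    and lukasiewicz: "\<lbrakk>x \<in> carrier A; y \<in> carrier A\<rbrakk> \<Longrightarrow>
                       neg (neg x \<oplus> y) \<oplus> y = neg (neg y \<oplus> x) \<oplus> x"
    and times_eq: "\<lbrakk>x \<in> carrier A; y \<in> carrier A\<rbrakk> \<Longrightarrow> x \<odot> y = neg (neg x \<oplus> neg y)"

locale mv_n_algebra = mv_algebra A
  for n :: nat and A :: "('a, 'b) mv_scheme" (structure) +
  assumes n_ge_2: "n \<ge> 2"
    and mult_stable: "x \<in> carrier A \<Longrightarrow> mvmult A (n - 1) x \<oplus> x = mvmult A (n - 1) x"
    and pow_stable: "x \<in> carrier A \<Longrightarrow> mvpow A x (n - 1) \<odot> x = mvpow A x (n - 1)"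
    and mult_nondiv: "\<lbrakk>n \<ge> 4; 1 < j; j < n - 1; \<not> j dvd n - 1; x \<in> carrier A\<rbrakk> \<Longrightarrow>
          mvpow A (mvmult A j x \<odot> (neg x \<oplus> neg (mvmult A (j - 1) x))) (n - 1) = \<zero>"
    and pow_nondiv: "\<lbrakk>n \<ge> 4; 1 < j; j < n - 1; \<not> j dvd n - 1; x \<in> carrier A\<rbrakk> \<Longrightarrow>
          mvmult A (n - 1) (mvpow A x j \<oplus> (neg x \<odot> neg (mvpow A x (j - 1)))) = \<one>"


section \<open>MV\<open>\<^sub>n\<close>-algebras with constants\<close>

definition nbar :: "nat \<Rightarrow> real set" where
  "nbar n = {real i / real (n - 1) | i. i \<le> n - 1}"

record 'a lnc = "'a mv" +
  cst :: "real \<Rightarrow> 'a"  \<comment> \<open>only its values on \<open>nbar n\<close> matter\<close>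

locale lnc_algebra = mv_n_algebra n A
  for n :: nat and A :: "('a, 'b) lnc_scheme" (structure) +
  assumes cst_closed: "r \<in> nbar n \<Longrightarrow> cst A r \<in> carrier A"
    and cst_inj: "inj_on (cst A) (nbar n)"
    and cst_meet: "\<lbrakk>r \<in> nbar n; s \<in> nbar n\<rbrakk> \<Longrightarrow> cst A (min r s) = mvmeet A (cst A r) (cst A s)"
    and cst_join: "\<lbrakk>r \<in> nbar n; s \<in> nbar n\<rbrakk> \<Longrightarrow> cst A (max r s) = mvjoin A (cst A r) (cst A s)"
    and cst_times: "\<lbrakk>r \<in> nbar n; s \<in> nbar n\<rbrakk> \<Longrightarrow> cst A (max 0 (r + s - 1)) = cst A r \<odot> cst A s"
    and cst_plus: "\<lbrakk>r \<in> nbar n; s \<in> nbar n\<rbrakk> \<Longrightarrow> cst A (min 1 (r + s)) = cst A r \<oplus> cst A s"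
    and cst_imp: "\<lbrakk>r \<in> nbar n; s \<in> nbar n\<rbrakk> \<Longrightarrow>
                    cst A (min 1 (1 - (r - s))) = mvimp A (cst A r) (cst A s)"
    and cst_neg: "r \<in> nbar n \<Longrightarrow> cst A (1 - r) = neg (cst A r)"
    and cst_zero: "cst A 0 = \<zero>"
    and cst_one: "cst A 1 = \<one>"

definition nbar_alg :: "nat \<Rightarrow> real lnc" where
  "nbar_alg n = \<lparr>carrier = nbar n, mvplus = (\<lambda>x y. min 1 (x + y)),
     mvtimes = (\<lambda>x y. max 0 (x + y - 1)), mvneg = (\<lambda>x. 1 - x),
     mvzero = 0, mvone = 1, cst = (\<lambda>r. r)\<rparr>"

lemma nbar_bounds: "x \<in> nbar n \<Longrightarrow> 0 \<le> x \<and> x \<le> 1"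
  by (auto simp: nbar_def divide_le_eq)

text \<open>The derived operations of \<open>nbar_alg n\<close> are the intended ones.\<close>

lemma nbar_alg_derived:
  assumes "x \<in> nbar n" "y \<in> nbar n"
  shows "mvmeet (nbar_alg n) x y = min x y"
    and "mvjoin (nbar_alg n) x y = max x y"
    and "mvimp (nbar_alg n) x y = min 1 (1 - (x - y))"
  using nbar_bounds[OF assms(1)] nbar_bounds[OF assms(2)]
  by (auto simp: mvmeet_def mvjoin_def mvimp_def nbar_alg_def)

text \<open>Homomorphisms are taken extensional (\<open>undefined\<close> off the carrier), so that equality
  of arrows is equality on the carrier. The two algebras may live over different types.\<close>

definition lnc_hom :: "nat \<Rightarrow> 'a lnc \<Rightarrow> 'b lnc \<Rightarrow> ('a \<Rightarrow> 'b) set" where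
  "lnc_hom n A B = {f \<in> carrier A \<rightarrow>\<^sub>E carrier B.
     (\<forall>x\<in>carrier A. \<forall>y\<in>carrier A.
        f (mvmeet A x y) = mvmeet B (f x) (f y) \<and>
        f (mvjoin A x y) = mvjoin B (f x) (f y) \<and>
        f (mvtimes A x y) = mvtimes B (f x) (f y) \<and>
        f (mvplus A x y) = mvplus B (f x) (f y) \<and>
        f (mvimp A x y) = mvimp B (f x) (f y)) \<and>
     (\<forall>x\<in>carrier A. f (mvneg A x) = mvneg B (f x)) \<and>
     (\<forall>r\<in>nbar n. f (cst A r) = cst B r)}"

definition lnc_iso :: "nat \<Rightarrow> 'a lnc \<Rightarrow> 'b lnc \<Rightarrow> ('a \<Rightarrow> 'b) \<Rightarrow> bool" where
  "lnc_iso n A B f \<longleftrightarrow> f \<in> lnc_hom n A B \<and>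
     (\<exists>g\<in>lnc_hom n B A. (\<forall>x\<in>carrier A. g (f x) = x) \<and> (\<forall>y\<in>carrier B. f (g y) = y))"

definition Lnc_cat :: "nat \<Rightarrow> ('a lnc, 'a \<Rightarrow> 'a) category" where
  "Lnc_cat n = \<lparr>Obj = {A. lnc_algebra n A}, Hom = lnc_hom n,
     Ident = (\<lambda>A. restrict (\<lambda>x. x) (carrier A)),
     Comp = (\<lambda>A B C g f. compose (carrier A) g f)\<rparr>"


section \<open>Fuzzy Boolean spaces\<close>

text \<open>Fuzzy sets on \<open>points S\<close> are extensional functions into \<open>nbar n\<close>.\<close>

record 'x fspace =
  points :: "'x set"
  opens :: "('x \<Rightarrow> real) set"

text \<open>Pointwise supremum in \<open>nbar n\<close>; inserting \<open>0\<close>, the least element, makes the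
  supremum of the empty family the constant \<open>0\<close>.\<close>

definition fsup :: "'x set \<Rightarrow> ('x \<Rightarrow> real) set \<Rightarrow> ('x \<Rightarrow> real)" where
  "fsup X F = (\<lambda>x\<in>X. Sup (insert 0 ((\<lambda>U. U x) ` F)))"

definition fmin :: "'x set \<Rightarrow> ('x \<Rightarrow> real) \<Rightarrow> ('x \<Rightarrow> real) \<Rightarrow> ('x \<Rightarrow> real)" where
  "fmin X U V = (\<lambda>x\<in>X. min (U x) (V x))"

definition fuzzy_space :: "nat \<Rightarrow> 'x fspace \<Rightarrow> bool" where
  "fuzzy_space n S \<longleftrightarrow> points S \<noteq> {} \<and> opens S \<subseteq> points S \<rightarrow>\<^sub>E nbar n \<and>
     (\<forall>r\<in>nbar n. (\<lambda>x\<in>points S. r) \<in> opens S) \<and>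
     (\<forall>U\<in>opens S. \<forall>V\<in>opens S. fmin (points S) U V \<in> opens S) \<and>
     (\<forall>F. F \<subseteq> opens S \<longrightarrow> fsup (points S) F \<in> opens S)"

definition fcontinuous :: "'x fspace \<Rightarrow> 'y fspace \<Rightarrow> ('x \<Rightarrow> 'y) set" where
  "fcontinuous S T = {f \<in> points S \<rightarrow>\<^sub>E points T. \<forall>V\<in>opens T. compose (points S) V f \<in> opens S}"

definition nbar_discrete :: "nat \<Rightarrow> real fspace" where
  "nbar_discrete n = \<lparr>points = nbar n, opens = nbar n \<rightarrow>\<^sub>E nbar n\<rparr>"

definition Cont :: "nat \<Rightarrow> 'x fspace \<Rightarrow> ('x \<Rightarrow> real) set" where
  "Cont n S = fcontinuous S (nbar_discrete n)"

definition open_basis :: "'x fspace \<Rightarrow> ('x \<Rightarrow> real) set \<Rightarrow> bool" where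
  "open_basis S B \<longleftrightarrow> B \<subseteq> opens S \<and>
     (\<forall>U\<in>B. \<forall>V\<in>B. fmin (points S) U V \<in> B) \<and>
     (\<forall>U\<in>opens S. \<exists>F\<subseteq>B. U = fsup (points S) F)"

definition zero_dimensional :: "nat \<Rightarrow> 'x fspace \<Rightarrow> bool" where
  "zero_dimensional n S \<longleftrightarrow> open_basis S (Cont n S)"

definition kolmogorov :: "'x fspace \<Rightarrow> bool" where
  "kolmogorov S \<longleftrightarrow> (\<forall>x\<in>points S. \<forall>y\<in>points S. x \<noteq> y \<longrightarrow> (\<exists>U\<in>opens S. U x \<noteq> U y))"

definition fcompact :: "'x fspace \<Rightarrow> bool" where
  "fcompact S \<longleftrightarrow> (\<forall>F. F \<subseteq> opens S \<and> fsup (points S) F = (\<lambda>x\<in>points S. 1) \<longrightarrow>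
     (\<exists>G\<subseteq>F. finite G \<and> fsup (points S) G = (\<lambda>x\<in>points S. 1)))"

definition fuzzy_boolean_space :: "nat \<Rightarrow> 'x fspace \<Rightarrow> bool" where
  "fuzzy_boolean_space n S \<longleftrightarrow>
     fuzzy_space n S \<and> zero_dimensional n S \<and> fcompact S \<and> kolmogorov S"

definition fhomeomorphism :: "'x fspace \<Rightarrow> 'y fspace \<Rightarrow> ('x \<Rightarrow> 'y) \<Rightarrow> bool" where
  "fhomeomorphism S T f \<longleftrightarrow> f \<in> fcontinuous S T \<and>
     (\<exists>g\<in>fcontinuous T S. (\<forall>x\<in>points S. g (f x) = x) \<and> (\<forall>y\<in>points T. f (g y) = y))"

definition FBS_cat :: "nat \<Rightarrow> ('x fspace, 'x \<Rightarrow> 'x) category" where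
  "FBS_cat n = \<lparr>Obj = {S. fuzzy_boolean_space n S}, Hom = fcontinuous,
     Ident = (\<lambda>S. restrict (\<lambda>x. x) (points S)),
     Comp = (\<lambda>S T W g f. compose (points S) g f)\<rparr>"


section \<open>Size: duals inside given types\<close>

text \<open>There is no type of all sets, so \<open>Lnc_cat n\<close> and \<open>FBS_cat n\<close>
  contain the objects whose underlying set lies in the type \<open>'a\<close>, respectively
  \<open>'x\<close>. Two such categories cannot in general be dual to each other as they stand: the
  dual of an algebra over \<open>'a\<close> may have more points than \<open>'x\<close> has elements, and
  likewise for spaces. The predicates below select the objects whose dual fits into the
  other type.\<close>

definition dual_fits_alg :: "nat \<Rightarrow> 'x itself \<Rightarrow> 'a lnc \<Rightarrow> bool" where
  "dual_fits_alg n _ A \<longleftrightarrow> lnc_hom n A (nbar_alg n) \<lesssim> (UNIV :: 'x set)"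

definition dual_fits_space :: "nat \<Rightarrow> 'a itself \<Rightarrow> 'x fspace \<Rightarrow> bool" where
  "dual_fits_space n _ S \<longleftrightarrow> Cont n S \<lesssim> (UNIV :: 'a set)"

text \<open>No algebra and no space is lost: the condition is vacuous for a suitable choice of the
  other type. Moreover, with \<open>'a + ('x \<Rightarrow> real)\<close> for the algebras and
  \<open>'x + ('a \<Rightarrow> real)\<close> for the spaces, a single pair of types accommodates at
  once a copy of every algebra over \<open>'a\<close> and of every space over \<open>'x\<close>.\<close>

lemma dual_fits_alg_function_type: "dual_fits_alg n TYPE('a \<Rightarrow> real) (A :: 'a lnc)"
  unfolding dual_fits_alg_def by (simp add: subset_imp_lepoll)

lemma dual_fits_space_function_type: "dual_fits_space n TYPE('x \<Rightarrow> real) (S :: 'x fspace)"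
  unfolding dual_fits_space_def by (simp add: subset_imp_lepoll)

lemma extensional_lepoll:
  fixes i :: "'b \<Rightarrow> 'u" and j :: "('b \<Rightarrow> real) \<Rightarrow> 'v" and F :: "('u \<Rightarrow> real) set"
  assumes X: "X \<subseteq> range i" and F: "F \<subseteq> extensional X" and j: "inj j"
  shows "F \<lesssim> (UNIV :: 'v set)"
  unfolding lepoll_def
proof (intro exI conjI)
  show "inj_on (\<lambda>f. j (f \<circ> i)) F"
  proof (rule inj_onI)
    fix f g assume fg: "f \<in> F" "g \<in> F" and "j (f \<circ> i) = j (g \<circ> i)"
    then have "f \<circ> i = g \<circ> i" using j by (simp add: inj_eq)
    then have "f x = g x" if "x \<in> X" for x
      using X that by (metis comp_apply imageE subsetD)
    then show "f = g" using fg F by (meson extensionalityI subsetD)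
  qed
qed simp

lemma dual_fits_alg_sum_type:
  fixes A :: "('a + ('x \<Rightarrow> real)) lnc"
  assumes "carrier A \<subseteq> range Inl"
  shows "dual_fits_alg n TYPE('x + ('a \<Rightarrow> real)) A"
  unfolding dual_fits_alg_def
  by (rule extensional_lepoll[OF assms, where j = Inr]) (auto simp: lnc_hom_def PiE_def)

lemma dual_fits_space_sum_type:
  fixes S :: "('x + ('a \<Rightarrow> real)) fspace"
  assumes "points S \<subseteq> range Inl"
  shows "dual_fits_space n TYPE('a + ('x \<Rightarrow> real)) S"
  unfolding dual_fits_space_def
  by (rule extensional_lepoll[OF assms, where j = Inr])
    (auto simp: Cont_def fcontinuous_def PiE_def)


section \<open>The duality without size restrictions\<close>

definition Spec :: "nat \<Rightarrow> 'a lnc \<Rightarrow> ('a \<Rightarrow> real) fspace" where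
  "Spec n A = (let X = lnc_hom n A (nbar_alg n) in
     \<lparr>points = X, opens = {fsup X F | F. F \<subseteq> (\<lambda>a. \<lambda>h\<in>X. h a) ` carrier A}\<rparr>)"

definition Spec_map ::
  "nat \<Rightarrow> 'a lnc \<Rightarrow> 'b lnc \<Rightarrow> ('a \<Rightarrow> 'b) \<Rightarrow> ('b \<Rightarrow> real) \<Rightarrow> ('a \<Rightarrow> real)" where
  "Spec_map n A B f = (\<lambda>h\<in>lnc_hom n B (nbar_alg n). compose (carrier A) h f)"

definition Cont_alg :: "nat \<Rightarrow> 'x fspace \<Rightarrow> ('x \<Rightarrow> real) lnc" where
  "Cont_alg n S = (let X = points S; N = nbar_alg n in
     \<lparr>carrier = Cont n S,
      mvplus = (\<lambda>f g. \<lambda>x\<in>X. mvplus N (f x) (g x)),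
      mvtimes = (\<lambda>f g. \<lambda>x\<in>X. mvtimes N (f x) (g x)),
      mvneg = (\<lambda>f. \<lambda>x\<in>X. mvneg N (f x)),
      mvzero = (\<lambda>x\<in>X. 0), mvone = (\<lambda>x\<in>X. 1), cst = (\<lambda>r. \<lambda>x\<in>X. r)\<rparr>)"

definition Cont_map ::
  "nat \<Rightarrow> 'x fspace \<Rightarrow> 'y fspace \<Rightarrow> ('x \<Rightarrow> 'y) \<Rightarrow> ('y \<Rightarrow> real) \<Rightarrow> ('x \<Rightarrow> real)" where
  "Cont_map n S T f = (\<lambda>g\<in>Cont n T. compose (points S) g f)"

definition alg_unit :: "nat \<Rightarrow> 'a lnc \<Rightarrow> 'a \<Rightarrow> ('a \<Rightarrow> real) \<Rightarrow> real" where
  "alg_unit n A = (\<lambda>a\<in>carrier A. \<lambda>h\<in>lnc_hom n A (nbar_alg n). h a)"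

definition space_unit :: "nat \<Rightarrow> 'x fspace \<Rightarrow> 'x \<Rightarrow> ('x \<Rightarrow> real) \<Rightarrow> real" where
  "space_unit n S = (\<lambda>x\<in>points S. \<lambda>f\<in>Cont n S. f x)"

text \<open>The two functors raise the type, so the natural isomorphisms relate objects over
  different types and are written out in components.\<close>

definition hom_cont_duality :: "nat \<Rightarrow> 'a itself \<Rightarrow> 'x itself \<Rightarrow> bool" where
  "hom_cont_duality n _ _ \<longleftrightarrow>
     is_functor (Lnc_cat n :: ('a lnc, 'a \<Rightarrow> 'a) category) (opposite (FBS_cat n))
       (Spec n) (Spec_map n) \<and>
     is_functor (opposite (FBS_cat n :: ('x fspace, 'x \<Rightarrow> 'x) category)) (Lnc_cat n)
       (Cont_alg n) (\<lambda>T S. Cont_map n S T) \<and>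
     (\<forall>A :: 'a lnc. lnc_algebra n A \<longrightarrow>
        lnc_iso n A (Cont_alg n (Spec n A)) (alg_unit n A)) \<and>
     (\<forall>(A :: 'a lnc) (B :: 'a lnc). \<forall>f\<in>lnc_hom n A B. lnc_algebra n A \<and> lnc_algebra n B \<longrightarrow>
        compose (carrier A) (alg_unit n B) f =
        compose (carrier A) (Cont_map n (Spec n B) (Spec n A) (Spec_map n A B f)) (alg_unit n A)) \<and>
     (\<forall>S :: 'x fspace. fuzzy_boolean_space n S \<longrightarrow>
        fhomeomorphism S (Spec n (Cont_alg n S)) (space_unit n S)) \<and>
     (\<forall>(S :: 'x fspace) (T :: 'x fspace). \<forall>f\<in>fcontinuous S T.
        fuzzy_boolean_space n S \<and> fuzzy_boolean_space n T \<longrightarrow>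
        compose (points S) (space_unit n T) f =
        compose (points S) (Spec_map n (Cont_alg n T) (Cont_alg n S) (Cont_map n S T f))
          (space_unit n S))"

end

theory Submission
  imports Defs
begin

text \<open>
  The duality rests on the finite chain \<open>nbar n\<close> being at once an algebra and a discrete fuzzy
  space. An algebra \<open>A\<close> and a space \<open>S\<close> are dual to each other when there is a
  pairing \<open>e x a\<close> of points and elements with values in \<open>nbar n\<close> for which
  the points of \<open>S\<close> are exactly the homomorphisms \<open>A \<rightarrow> nbar n\<close>, the elements of
  \<open>A\<close> are exactly the continuous functions \<open>S \<rightarrow> nbar n\<close>, and the open
  sets are the suprema of the functions \<open>e _ a\<close> (locale \<open>dual_pair\<close>). The
  equation \<open>e (\<phi> t) a = d t (f a)\<close> then determines each of a homomorphism \<open>f\<close> and a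
  continuous map \<open>\<phi>\<close> from the other. So the category of dual pairs projects fully faithfully
  onto the algebras and onto the opposite of the spaces, and any such span of projections yields
  an equivalence (\<open>equivalence_of_span\<close>). What remains is that every algebra and every
  space belongs to a dual pair.

  For an algebra \<open>A\<close> this amounts to having enough homomorphisms into \<open>nbar n\<close>.
  They come from maximal filters \<open>F\<close>: modulo \<open>F\<close> the order is total, and
  \<open>x \<notin> F\<close> makes the multiple \<open>(n - 1) (neg x)\<close> equal to one. If an element
  were strictly between two consecutive constants modulo \<open>F\<close>, its distance \<open>d\<close> to
  the lower one would thus have \<open>(n - 1) d = 1\<close>, while \<open>d\<close> is at most
  \<open>1/(n - 1)\<close>; this forces \<open>d = 1/(n - 1)\<close>, and the element is the upper
  constant after all (\<open>step_covers\<close>). Hence each element is congruent to exactly one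
  constant and the quotient is \<open>nbar n\<close>. Zorn's lemma turns this into the existence
  statement \<open>hom_one_on\<close>: a set of elements whose finite products are nonzero is mapped to
  one by some homomorphism. It has two consequences: homomorphisms separate the elements of
  \<open>A\<close>, and a family of elements such that every homomorphism takes the value one on some
  member has a finite subfamily with this property, which is compactness of the spectrum.

  Both passages use the elements \<open>level n A a r\<close>, whose value at a point is one where
  \<open>a\<close> has the value \<open>r\<close> and zero elsewhere. On the spectrum they show that
  the functions induced by elements are continuous; compactness then glues finitely many of them
  into any given continuous function. On a Boolean space \<open>S\<close> they show that a
  homomorphism \<open>h\<close> on the continuous functions is evaluation at a point: otherwise every
  point lies in the support of some two-valued function that \<open>h\<close> sends to zero, finitely
  many of these have join one, and \<open>h\<close> would send one to zero.
\<close>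

section \<open>Equivalences of categories from a correspondence of arrows\<close>

text \<open>The objects of \<open>W\<close> with the pairs of arrows related by \<open>R\<close> form a category whose
  projections to \<open>C\<close> and \<open>D\<close> are full, faithful and surjective on objects. Choosing
  preimages \<open>s\<close> and \<open>t\<close> of objects gives functors in both directions. Two members of
  \<open>W\<close> over the same object are related by a unique arrow lying over its identity, and
  this arrow is invertible; these arrows are the components of the natural isomorphisms, and
  every functor law and naturality square follows from uniqueness of related arrows.\<close>

lemma equivalence_of_span:
  fixes C :: "('o, 'm) category" and D :: "('p, 'k) category"
    and W :: "'w set" and R :: "'w \<Rightarrow> 'w \<Rightarrow> 'm \<Rightarrow> 'k \<Rightarrow> bool"
  assumes C: "is_category C" and D: "is_category D"
    and p: "p ` W = Obj C" and q: "q ` W = Obj D"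
    and arrows: "\<And>v w f g. R v w f g \<Longrightarrow> f \<in> Hom C (p v) (p w) \<and> g \<in> Hom D (q v) (q w)"
    and left: "\<And>v w f. v \<in> W \<Longrightarrow> w \<in> W \<Longrightarrow> f \<in> Hom C (p v) (p w) \<Longrightarrow> \<exists>!g. R v w f g"
    and right: "\<And>v w g. v \<in> W \<Longrightarrow> w \<in> W \<Longrightarrow> g \<in> Hom D (q v) (q w) \<Longrightarrow> \<exists>!f. R v w f g"
    and ident: "\<And>w. w \<in> W \<Longrightarrow> R w w (Ident C (p w)) (Ident D (q w))"
    and comp: "\<And>u v w f g f' g'. u \<in> W \<Longrightarrow> v \<in> W \<Longrightarrow> w \<in> W \<Longrightarrow> R u v f g \<Longrightarrow> R v w f' g' \<Longrightarrow>
      R u w (Comp C (p u) (p v) (p w) f' f) (Comp D (q u) (q v) (q w) g' g)"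
  shows "equivalent_categories C D"
proof -
  have pO: "p w \<in> Obj C" and qO: "q w \<in> Obj D" if "w \<in> W" for w
    using p q that by auto
  have C_id: "Comp C x x y f (Ident C x) = f" "Comp C x y y (Ident C y) f = f"
    if "x \<in> Obj C" "y \<in> Obj C" "f \<in> Hom C x y" for x y f
    using C that unfolding is_category_def by blast+
  have D_id: "Comp D x x y f (Ident D x) = f" "Comp D x y y (Ident D y) f = f"
    if "x \<in> Obj D" "y \<in> Obj D" "f \<in> Hom D x y" for x y f
    using D that unfolding is_category_def by blast+
  have C_idH: "Ident C x \<in> Hom C x x" if "x \<in> Obj C" for x
    using C that unfolding is_category_def by blast
  have D_idH: "Ident D x \<in> Hom D x x" if "x \<in> Obj D" for x
    using D that unfolding is_category_def by blast
  have uniq_D: "g = g'" if "R v w f g" "R v w f g'" "v \<in> W" "w \<in> W" for v w f g g'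
    using left[OF that(3,4), of f] arrows[OF that(1)] that(1,2) by auto
  have uniq_C: "f = f'" if "R v w f g" "R v w f' g" "v \<in> W" "w \<in> W" for v w f f' g
    using right[OF that(3,4), of g] arrows[OF that(1)] that(1,2) by auto

  have iso_C: "\<exists>f. R v w f (Ident D (q v)) \<and> is_iso C (p v) (p w) f"
    if v: "v \<in> W" and w: "w \<in> W" and vw: "q v = q w" for v w
  proof -
    have i: "Ident D (q w) \<in> Hom D (q w) (q w)" by (rule D_idH[OF qO[OF w]])
    obtain f where f: "R v w f (Ident D (q w))" using right[OF v w, of "Ident D (q w)"] i vw by auto
    obtain f' where f': "R w v f' (Ident D (q w))" using right[OF w v, of "Ident D (q w)"] i vw by auto
    have "R v v (Comp C (p v) (p w) (p v) f' f) (Ident D (q v))"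
      using comp[OF v w v f f'] D_id[OF qO[OF w] qO[OF w] i] vw by simp
    then have 1: "Comp C (p v) (p w) (p v) f' f = Ident C (p v)"
      using uniq_C[OF _ ident[OF v] v v] by simp
    have "R w w (Comp C (p w) (p v) (p w) f f') (Ident D (q w))"
      using comp[OF w v w f' f] D_id[OF qO[OF w] qO[OF w] i] vw by simp
    then have 2: "Comp C (p w) (p v) (p w) f f' = Ident C (p w)"
      using uniq_C[OF _ ident[OF w] w w] by simp
    show ?thesis using f 1 2 arrows[OF f] arrows[OF f'] vw unfolding is_iso_def by auto
  qed
  have iso_D: "\<exists>g. R v w (Ident C (p v)) g \<and> is_iso D (q v) (q w) g"
    if v: "v \<in> W" and w: "w \<in> W" and vw: "p v = p w" for v w
  proof -
    have i: "Ident C (p w) \<in> Hom C (p w) (p w)" by (rule C_idH[OF pO[OF w]])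
    obtain g where g: "R v w (Ident C (p w)) g" using left[OF v w, of "Ident C (p w)"] i vw by auto
    obtain g' where g': "R w v (Ident C (p w)) g'" using left[OF w v, of "Ident C (p w)"] i vw by auto
    have "R v v (Ident C (p v)) (Comp D (q v) (q w) (q v) g' g)"
      using comp[OF v w v g g'] C_id[OF pO[OF w] pO[OF w] i] vw by simp
    then have 1: "Comp D (q v) (q w) (q v) g' g = Ident D (q v)"
      using uniq_D[OF _ ident[OF v] v v] by simp
    have "R w w (Ident C (p w)) (Comp D (q w) (q v) (q w) g g')"
      using comp[OF w v w g' g] C_id[OF pO[OF w] pO[OF w] i] vw by simp
    then have 2: "Comp D (q w) (q v) (q w) g g' = Ident D (q w)"
      using uniq_D[OF _ ident[OF w] w w] by simp
    show ?thesis using g 1 2 arrows[OF g] arrows[OF g'] vw unfolding is_iso_def by auto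
  qed

  \<comment> \<open>preimages of objects under the two projections\<close>
  define s where "s x = (SOME w. w \<in> W \<and> p w = x)" for x
  define t where "t y = (SOME w. w \<in> W \<and> q w = y)" for y
  have s: "s x \<in> W" "p (s x) = x" if "x \<in> Obj C" for x
  proof -
    have "\<exists>w. w \<in> W \<and> p w = x" using that unfolding p[symmetric] by auto
    from someI_ex[OF this] show "s x \<in> W" "p (s x) = x" unfolding s_def by auto
  qed
  have t: "t y \<in> W" "q (t y) = y" if "y \<in> Obj D" for y
  proof -
    have "\<exists>w. w \<in> W \<and> q w = y" using that unfolding q[symmetric] by auto
    from someI_ex[OF this] show "t y \<in> W" "q (t y) = y" unfolding t_def by auto
  qed
  define Fo where "Fo x = q (s x)" for x
  define Fm where "Fm x x' f = (THE g. R (s x) (s x') f g)" for x x' f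
  define Go where "Go y = p (t y)" for y
  define Gm where "Gm y y' g = (THE f. R (t y) (t y') f g)" for y y' g
  define \<eta> where "\<eta> x = (THE f. R (s x) (t (Fo x)) f (Ident D (Fo x)))" for x
  define \<epsilon> where "\<epsilon> y = (THE g. R (s (Go y)) (t y) (Ident C (Go y)) g)" for y

  have Fo: "Fo x \<in> Obj D" if "x \<in> Obj C" for x unfolding Fo_def using s that qO by blast
  have Go: "Go y \<in> Obj C" if "y \<in> Obj D" for y unfolding Go_def using t that pO by blast
  have Fm: "R (s x) (s x') f (Fm x x' f)"
    if "x \<in> Obj C" "x' \<in> Obj C" "f \<in> Hom C x x'" for x x' f
    unfolding Fm_def
    by (rule theI', rule left) (use s that in auto)
  have Gm: "R (t y) (t y') (Gm y y' g) g"
    if "y \<in> Obj D" "y' \<in> Obj D" "g \<in> Hom D y y'" for y y' g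
    unfolding Gm_def
    by (rule theI', rule right) (use t that in auto)
  have \<eta>: "R (s x) (t (Fo x)) (\<eta> x) (Ident D (Fo x)) \<and> is_iso C x (Go (Fo x)) (\<eta> x)"
    if x: "x \<in> Obj C" for x
  proof -
    obtain f where f: "R (s x) (t (Fo x)) f (Ident D (Fo x))" "is_iso C x (Go (Fo x)) f"
      using iso_C[OF s(1)[OF x] t(1)[OF Fo[OF x]]] t(2)[OF Fo[OF x]] s(2)[OF x]
      unfolding Fo_def[symmetric] Go_def[symmetric] by auto
    have "\<eta> x = f" unfolding \<eta>_def
      by (rule the_equality) (use f uniq_C s[OF x] t[OF Fo[OF x]] in auto)
    then show ?thesis using f by simp
  qed
  have \<epsilon>: "R (s (Go y)) (t y) (Ident C (Go y)) (\<epsilon> y) \<and> is_iso D (Fo (Go y)) y (\<epsilon> y)"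
    if y: "y \<in> Obj D" for y
  proof -
    obtain g where g: "R (s (Go y)) (t y) (Ident C (Go y)) g" "is_iso D (Fo (Go y)) y g"
      using iso_D[OF s(1)[OF Go[OF y]] t(1)[OF y]] s(2)[OF Go[OF y]] t(2)[OF y]
      unfolding Fo_def[symmetric] Go_def[symmetric] by auto
    have "\<epsilon> y = g" unfolding \<epsilon>_def
      by (rule the_equality) (use g uniq_D t[OF y] s[OF Go[OF y]] in auto)
    then show ?thesis using g by simp
  qed

  have FmH: "Fm x x' f \<in> Hom D (Fo x) (Fo x')"
    if "x \<in> Obj C" "x' \<in> Obj C" "f \<in> Hom C x x'" for x x' f
    using arrows[OF Fm[OF that]] unfolding Fo_def by blast
  have GmH: "Gm y y' g \<in> Hom C (Go y) (Go y')"
    if "y \<in> Obj D" "y' \<in> Obj D" "g \<in> Hom D y y'" for y y' g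
    using arrows[OF Gm[OF that]] unfolding Go_def by blast
  have CH: "Comp C x y z g f \<in> Hom C x z" if "x \<in> Obj C" "y \<in> Obj C" "z \<in> Obj C"
    "f \<in> Hom C x y" "g \<in> Hom C y z" for x y z f g
    using C that unfolding is_category_def by blast
  have DH: "Comp D x y z g f \<in> Hom D x z" if "x \<in> Obj D" "y \<in> Obj D" "z \<in> Obj D"
    "f \<in> Hom D x y" "g \<in> Hom D y z" for x y z f g
    using D that unfolding is_category_def by blast

  have "is_functor C D Fo Fm"
    unfolding is_functor_def
  proof (intro conjI ballI)
    fix x assume x: "x \<in> Obj C"
    show "Fm x x (Ident C x) = Ident D (Fo x)"
      using uniq_D[OF Fm[OF x x C_idH[OF x]] _ s(1)[OF x] s(1)[OF x]] ident[OF s(1)[OF x]] s(2)[OF x]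
      unfolding Fo_def by simp
  next
    fix x y z f g
    assume h: "x \<in> Obj C" "y \<in> Obj C" "z \<in> Obj C" "f \<in> Hom C x y" "g \<in> Hom C y z"
    show "Fm x z (Comp C x y z g f) = Comp D (Fo x) (Fo y) (Fo z) (Fm y z g) (Fm x y f)"
    proof (rule uniq_D[OF Fm _ s(1) s(1)])
      show "R (s x) (s z) (Comp C x y z g f) (Comp D (Fo x) (Fo y) (Fo z) (Fm y z g) (Fm x y f))"
        using comp[OF s(1)[OF h(1)] s(1)[OF h(2)] s(1)[OF h(3)] Fm[OF h(1,2,4)] Fm[OF h(2,3,5)]] h s(2)
        unfolding Fo_def by simp
    qed (use h CH in auto)
  qed (use Fo FmH in auto)
  moreover have "is_functor D C Go Gm"
    unfolding is_functor_def
  proof (intro conjI ballI)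
    fix y assume y: "y \<in> Obj D"
    show "Gm y y (Ident D y) = Ident C (Go y)"
      using uniq_C[OF Gm[OF y y D_idH[OF y]] _ t(1)[OF y] t(1)[OF y]] ident[OF t(1)[OF y]] t(2)[OF y]
      unfolding Go_def by simp
  next
    fix x y z f g
    assume h: "x \<in> Obj D" "y \<in> Obj D" "z \<in> Obj D" "f \<in> Hom D x y" "g \<in> Hom D y z"
    show "Gm x z (Comp D x y z g f) = Comp C (Go x) (Go y) (Go z) (Gm y z g) (Gm x y f)"
    proof (rule uniq_C[OF Gm _ t(1) t(1)])
      show "R (t x) (t z) (Comp C (Go x) (Go y) (Go z) (Gm y z g) (Gm x y f)) (Comp D x y z g f)"
        using comp[OF t(1)[OF h(1)] t(1)[OF h(2)] t(1)[OF h(3)] Gm[OF h(1,2,4)] Gm[OF h(2,3,5)]] h t(2)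
        unfolding Go_def by simp
    qed (use h DH in auto)
  qed (use Go GmH in auto)
  moreover have "natural_iso C C (\<lambda>x. x) (\<lambda>x y f. f)
      (\<lambda>x. Go (Fo x)) (\<lambda>x y f. Gm (Fo x) (Fo y) (Fm x y f)) \<eta>"
    unfolding natural_iso_def
  proof (intro conjI ballI)
    fix x y f assume h: "x \<in> Obj C" "y \<in> Obj C" "f \<in> Hom C x y"
    note sx = s[OF h(1)] and sy = s[OF h(2)] and tx = t[OF Fo[OF h(1)]] and ty = t[OF Fo[OF h(2)]]
    note F = FmH[OF h]
    have "R (s x) (t (Fo y)) (Comp C x y (Go (Fo y)) (\<eta> y) f) (Fm x y f)"
      using comp[OF sx(1) sy(1) ty(1) Fm[OF h] \<eta>[OF h(2), THEN conjunct1]] D_id(2)[OF Fo Fo F]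
        h sx sy tx ty unfolding Fo_def[symmetric] Go_def[symmetric] by simp
    moreover have "R (s x) (t (Fo y))
        (Comp C x (Go (Fo x)) (Go (Fo y)) (Gm (Fo x) (Fo y) (Fm x y f)) (\<eta> x)) (Fm x y f)"
      using comp[OF sx(1) tx(1) ty(1) \<eta>[OF h(1), THEN conjunct1] Gm[OF Fo Fo F]]
        D_id(1)[OF Fo Fo F] h sx sy tx ty unfolding Fo_def[symmetric] Go_def[symmetric] by simp
    ultimately show "Comp C x y (Go (Fo y)) (\<eta> y) f =
        Comp C x (Go (Fo x)) (Go (Fo y)) (Gm (Fo x) (Fo y) (Fm x y f)) (\<eta> x)"
      using uniq_C sx ty by blast
  qed (use \<eta> in blast)
  moreover have "natural_iso D D (\<lambda>x. Fo (Go x)) (\<lambda>x y f. Fm (Go x) (Go y) (Gm x y f))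
      (\<lambda>x. x) (\<lambda>x y f. f) \<epsilon>"
    unfolding natural_iso_def
  proof (intro conjI ballI)
    fix x y g assume h: "x \<in> Obj D" "y \<in> Obj D" "g \<in> Hom D x y"
    note tx = t[OF h(1)] and ty = t[OF h(2)] and sx = s[OF Go[OF h(1)]] and sy = s[OF Go[OF h(2)]]
    note G = GmH[OF h]
    have "R (s (Go x)) (t y) (Gm x y g) (Comp D (Fo (Go x)) (Fo (Go y)) y (\<epsilon> y)
        (Fm (Go x) (Go y) (Gm x y g)))"
      using comp[OF sx(1) sy(1) ty(1) Fm[OF Go Go G] \<epsilon>[OF h(2), THEN conjunct1]]
        C_id(2)[OF Go Go G] h sx sy tx ty unfolding Fo_def[symmetric] Go_def[symmetric] by simp
    moreover have "R (s (Go x)) (t y) (Gm x y g) (Comp D (Fo (Go x)) x y g (\<epsilon> x))"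
      using comp[OF sx(1) tx(1) ty(1) \<epsilon>[OF h(1), THEN conjunct1] Gm[OF h]]
        C_id(1)[OF Go Go G] h sx sy tx ty unfolding Fo_def[symmetric] Go_def[symmetric] by simp
    ultimately show "Comp D (Fo (Go x)) (Fo (Go y)) y (\<epsilon> y) (Fm (Go x) (Go y) (Gm x y g)) =
        Comp D (Fo (Go x)) x y g (\<epsilon> x)"
      using uniq_D sx ty by blast
  qed (use \<epsilon> in blast)
  ultimately show ?thesis
    using C D unfolding equivalent_categories_def by blast
qed

section \<open>Order and lattice structure of MV-algebras\<close>

context mv_algebra
begin

lemmas closed = plus_closed times_closed neg_closed zero_closed one_closed

lemma plus_left_comm:
  "\<lbrakk>x \<in> carrier A; y \<in> carrier A; z \<in> carrier A\<rbrakk> \<Longrightarrow> x \<oplus> (y \<oplus> z) = y \<oplus> (x \<oplus> z)"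
  by (metis plus_assoc plus_comm)

lemma neg_one: "neg \<one> = \<zero>"
  using neg_neg[OF zero_closed] neg_zero by simp

lemma zero_plus: "x \<in> carrier A \<Longrightarrow> \<zero> \<oplus> x = x"
  using plus_comm[of \<zero> x] plus_zero zero_closed by simp

lemma one_plus: "x \<in> carrier A \<Longrightarrow> \<one> \<oplus> x = \<one>"
  using plus_comm[of \<one> x] plus_one one_closed by simp

lemma neg_plus_self: "x \<in> carrier A \<Longrightarrow> neg x \<oplus> x = \<one>"
  using lukasiewicz[of x \<one>] by (simp add: closed plus_one neg_one zero_plus)

lemma neg_times: "\<lbrakk>x \<in> carrier A; y \<in> carrier A\<rbrakk> \<Longrightarrow> neg (x \<odot> y) = neg x \<oplus> neg y"
  by (simp add: times_eq neg_neg closed)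

lemma neg_plus: "\<lbrakk>x \<in> carrier A; y \<in> carrier A\<rbrakk> \<Longrightarrow> neg (x \<oplus> y) = neg x \<odot> neg y"
  by (simp add: times_eq neg_neg closed)

lemma times_comm: "\<lbrakk>x \<in> carrier A; y \<in> carrier A\<rbrakk> \<Longrightarrow> x \<odot> y = y \<odot> x"
  by (simp add: times_eq closed plus_comm)

lemma times_assoc:
  "\<lbrakk>x \<in> carrier A; y \<in> carrier A; z \<in> carrier A\<rbrakk> \<Longrightarrow> x \<odot> y \<odot> z = x \<odot> (y \<odot> z)"
  by (simp add: times_eq closed plus_assoc neg_neg)

lemma times_left_comm:
  "\<lbrakk>x \<in> carrier A; y \<in> carrier A; z \<in> carrier A\<rbrakk> \<Longrightarrow> x \<odot> (y \<odot> z) = y \<odot> (x \<odot> z)"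
  by (metis times_assoc times_comm)

lemma times_one: "x \<in> carrier A \<Longrightarrow> x \<odot> \<one> = x"
  by (simp add: times_eq closed neg_one plus_zero neg_neg)

lemma one_times: "x \<in> carrier A \<Longrightarrow> \<one> \<odot> x = x"
  by (simp add: times_eq closed neg_one zero_plus neg_neg)

lemma times_neg_self: "x \<in> carrier A \<Longrightarrow> x \<odot> neg x = \<zero>"
  by (simp add: times_eq closed neg_neg neg_plus_self neg_one)

definition le :: "'a \<Rightarrow> 'a \<Rightarrow> bool" (infix "\<sqsubseteq>" 50)
  where "x \<sqsubseteq> y \<longleftrightarrow> neg x \<oplus> y = \<one>"

lemma le_refl: "x \<in> carrier A \<Longrightarrow> x \<sqsubseteq> x"
  by (simp add: le_def neg_plus_self)

lemma le_one: "x \<in> carrier A \<Longrightarrow> x \<sqsubseteq> \<one>"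
  by (simp add: le_def plus_one closed)

lemma zero_le: "x \<in> carrier A \<Longrightarrow> \<zero> \<sqsubseteq> x"
  by (simp add: le_def neg_zero one_plus)

lemma le_antisym: "\<lbrakk>x \<sqsubseteq> y; y \<sqsubseteq> x; x \<in> carrier A; y \<in> carrier A\<rbrakk> \<Longrightarrow> x = y"
  using lukasiewicz[of x y] by (simp add: le_def neg_one zero_plus)

lemma le_plus: "\<lbrakk>x \<in> carrier A; y \<in> carrier A\<rbrakk> \<Longrightarrow> x \<sqsubseteq> x \<oplus> y"
  by (simp add: le_def plus_assoc[symmetric] closed neg_plus_self one_plus)

lemma le_iff_plus:
  assumes "x \<in> carrier A" "y \<in> carrier A"
  shows "x \<sqsubseteq> y \<longleftrightarrow> (\<exists>z\<in>carrier A. y = x \<oplus> z)"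
proof
  assume "x \<sqsubseteq> y"
  then have "y = neg (neg y \<oplus> x) \<oplus> x"
    using lukasiewicz[OF assms] assms by (simp add: le_def neg_one zero_plus)
  then have "y = x \<oplus> neg (neg y \<oplus> x)" using assms plus_comm by (simp add: closed)
  then show "\<exists>z\<in>carrier A. y = x \<oplus> z" using assms closed by blast
qed (use assms le_plus in blast)

lemma le_trans:
  assumes "x \<sqsubseteq> y" "y \<sqsubseteq> z" "x \<in> carrier A" "y \<in> carrier A" "z \<in> carrier A"
  shows "x \<sqsubseteq> z"
proof -
  obtain u v where "u \<in> carrier A" "v \<in> carrier A" "y = x \<oplus> u" "z = y \<oplus> v"
    using assms le_iff_plus by blast
  then have "z = x \<oplus> (u \<oplus> v)" using assms by (simp add: plus_assoc)
  then show ?thesis using assms le_plus \<open>u \<in> carrier A\<close> \<open>v \<in> carrier A\<close> plus_closed by blast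
qed

lemma neg_le_neg_iff: "\<lbrakk>x \<in> carrier A; y \<in> carrier A\<rbrakk> \<Longrightarrow> neg y \<sqsubseteq> neg x \<longleftrightarrow> x \<sqsubseteq> y"
  by (simp add: le_def neg_neg plus_comm closed)

lemma plus_mono:
  assumes "x \<sqsubseteq> y" "x \<in> carrier A" "y \<in> carrier A" "z \<in> carrier A"
  shows "x \<oplus> z \<sqsubseteq> y \<oplus> z"
proof -
  obtain u where u: "u \<in> carrier A" "y = x \<oplus> u" using assms le_iff_plus by blast
  then have "y \<oplus> z = (x \<oplus> z) \<oplus> u" using assms by (simp add: plus_assoc plus_comm[of u z])
  then show ?thesis using le_plus[of "x \<oplus> z" u] assms u closed by simp
qed

lemma times_mono:
  assumes "x \<sqsubseteq> y" "x \<in> carrier A" "y \<in> carrier A" "z \<in> carrier A"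
  shows "x \<odot> z \<sqsubseteq> y \<odot> z"
  using plus_mono[of "neg y" "neg x" "neg z"] assms
  by (simp add: times_eq neg_le_neg_iff closed)

lemma times_le: "\<lbrakk>x \<in> carrier A; y \<in> carrier A\<rbrakk> \<Longrightarrow> x \<odot> y \<sqsubseteq> y"
  using times_mono[OF le_one, of x y] by (simp add: closed one_times)

lemma times_mono2:
  assumes "x \<sqsubseteq> y" "z \<sqsubseteq> w" "x \<in> carrier A" "y \<in> carrier A" "z \<in> carrier A" "w \<in> carrier A"
  shows "x \<odot> z \<sqsubseteq> y \<odot> w"
proof -
  have "x \<odot> z \<sqsubseteq> y \<odot> z" by (rule times_mono) (use assms in auto)
  moreover have "y \<odot> z \<sqsubseteq> y \<odot> w"
    using times_mono[of z w y] assms by (simp add: times_comm)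
  ultimately show ?thesis by (rule le_trans) (use assms closed in auto)
qed

lemma residuation:
  "\<lbrakk>x \<in> carrier A; y \<in> carrier A; z \<in> carrier A\<rbrakk> \<Longrightarrow> x \<odot> y \<sqsubseteq> z \<longleftrightarrow> x \<sqsubseteq> neg y \<oplus> z"
  by (simp add: le_def neg_times plus_assoc closed)

lemma le_zero_iff: "x \<in> carrier A \<Longrightarrow> x \<sqsubseteq> \<zero> \<longleftrightarrow> x = \<zero>"
  using le_antisym[OF _ zero_le, of x] le_refl[OF zero_closed] zero_closed by auto

abbreviation join (infixl "\<squnion>" 65) where "x \<squnion> y \<equiv> mvjoin A x y"
abbreviation meet (infixl "\<sqinter>" 70) where "x \<sqinter> y \<equiv> mvmeet A x y"

lemma join_closed: "\<lbrakk>x \<in> carrier A; y \<in> carrier A\<rbrakk> \<Longrightarrow> x \<squnion> y \<in> carrier A"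
  by (simp add: mvjoin_def closed)

lemma meet_closed: "\<lbrakk>x \<in> carrier A; y \<in> carrier A\<rbrakk> \<Longrightarrow> x \<sqinter> y \<in> carrier A"
  by (simp add: mvmeet_def closed)

lemma join_eq: "\<lbrakk>x \<in> carrier A; y \<in> carrier A\<rbrakk> \<Longrightarrow> x \<squnion> y = neg (neg x \<oplus> y) \<oplus> y"
  by (simp add: mvjoin_def times_eq neg_neg closed)

lemma join_comm: "\<lbrakk>x \<in> carrier A; y \<in> carrier A\<rbrakk> \<Longrightarrow> x \<squnion> y = y \<squnion> x"
  using lukasiewicz by (simp add: join_eq)

lemma join_upper2: "\<lbrakk>x \<in> carrier A; y \<in> carrier A\<rbrakk> \<Longrightarrow> y \<sqsubseteq> x \<squnion> y"
  unfolding mvjoin_def using le_plus plus_comm by (simp add: closed)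

lemma join_upper1: "\<lbrakk>x \<in> carrier A; y \<in> carrier A\<rbrakk> \<Longrightarrow> x \<sqsubseteq> x \<squnion> y"
  using join_upper2[of y x] join_comm by simp

lemma join_least:
  assumes "x \<sqsubseteq> z" "y \<sqsubseteq> z" "x \<in> carrier A" "y \<in> carrier A" "z \<in> carrier A"
  shows "x \<squnion> y \<sqsubseteq> z"
proof -
  have "z = z \<squnion> y"
    using assms join_comm[of z y] by (simp add: join_eq[of y z] le_def neg_one zero_plus)
  moreover have "x \<squnion> y \<sqsubseteq> z \<squnion> y"
    unfolding mvjoin_def by (intro plus_mono times_mono) (use assms closed in auto)
  ultimately show ?thesis by simp
qed

lemma meet_eq: "\<lbrakk>x \<in> carrier A; y \<in> carrier A\<rbrakk> \<Longrightarrow> x \<sqinter> y = neg (neg x \<squnion> neg y)"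
  by (simp add: mvmeet_def join_eq times_eq neg_neg closed)

lemma meet_comm: "\<lbrakk>x \<in> carrier A; y \<in> carrier A\<rbrakk> \<Longrightarrow> x \<sqinter> y = y \<sqinter> x"
  using join_comm by (simp add: meet_eq closed)

lemma meet_lower2: "\<lbrakk>x \<in> carrier A; y \<in> carrier A\<rbrakk> \<Longrightarrow> x \<sqinter> y \<sqsubseteq> y"
  unfolding mvmeet_def by (rule times_le) (auto simp: closed)

lemma meet_lower1: "\<lbrakk>x \<in> carrier A; y \<in> carrier A\<rbrakk> \<Longrightarrow> x \<sqinter> y \<sqsubseteq> x"
  using meet_lower2[of y x] meet_comm by simp

text \<open>Since \<open>\<odot>\<close> distributes over joins by residuation, the left-hand side is a join of products,
  and each of them other than \<open>z \<odot> w\<close> has \<open>x\<close> as a factor, so lies below \<open>x\<close>.\<close>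

lemma join_times_join_le:
  assumes x: "x \<in> carrier A" and z: "z \<in> carrier A" and w: "w \<in> carrier A"
  shows "(x \<squnion> z) \<odot> (x \<squnion> w) \<sqsubseteq> x \<squnion> (z \<odot> w)"
proof -
  define T where "T = x \<squnion> (z \<odot> w)"
  have T: "T \<in> carrier A" "x \<sqsubseteq> T" "z \<odot> w \<sqsubseteq> T"
    unfolding T_def using assms by (auto simp: join_closed closed join_upper1 join_upper2)
  have xw: "x \<squnion> w \<in> carrier A" using assms join_closed by blast
  have le': "x \<sqsubseteq> u \<oplus> T" if "u \<in> carrier A" for u
    using le_trans[OF T(2), of "u \<oplus> T"] le_plus[of T u] plus_comm[of T u] T x that closed by simp
  have "w \<sqsubseteq> neg z \<oplus> T" using residuation[of w z T] T assms times_comm[of w z] by simp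
  then have "x \<squnion> w \<sqsubseteq> neg z \<oplus> T"
    using le'[of "neg z"] assms T by (intro join_least) (auto simp: closed)
  then have "z \<sqsubseteq> neg (x \<squnion> w) \<oplus> T"
    using residuation T xw z times_comm[of z "x \<squnion> w"] by metis
  then have "x \<squnion> z \<sqsubseteq> neg (x \<squnion> w) \<oplus> T"
    using le'[of "neg (x \<squnion> w)"] assms T xw by (intro join_least) (auto simp: closed)
  then show ?thesis
    using residuation[of "x \<squnion> z" "x \<squnion> w" T] T assms xw join_closed unfolding T_def by simp
qed

text \<open>The truncated differences of two elements are disjoint. Rewriting the meet by associativity and
  commutativity of \<open>\<sqinter>\<close> bounds it by \<open>neg x \<odot> (x \<sqinter> y)\<close>, hence by
  \<open>neg x \<odot> x\<close>.\<close>

lemma differences_disjoint: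
  assumes x: "x \<in> carrier A" and y: "y \<in> carrier A"
  shows "(y \<odot> neg x) \<sqinter> (x \<odot> neg y) = \<zero>"
proof -
  define t where "t = y \<odot> neg x"
  define z where "z = neg x \<oplus> t"
  have c: "t \<in> carrier A" "z \<in> carrier A" "neg x \<in> carrier A" "neg y \<in> carrier A" "neg z \<in> carrier A"
    unfolding t_def z_def using x y closed by auto
  have "t \<sqinter> (x \<odot> neg y) = (t \<oplus> (neg x \<oplus> y)) \<odot> (x \<odot> neg y)"
    using x y c by (simp add: mvmeet_def neg_times neg_neg)
  also have "t \<oplus> (neg x \<oplus> y) = z \<oplus> neg (neg y)"
    using x y c by (simp add: z_def plus_left_comm plus_assoc neg_neg)
  also have "(z \<oplus> neg (neg y)) \<odot> (x \<odot> neg y) = x \<odot> (z \<sqinter> neg y)"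
    using x y c by (simp add: mvmeet_def times_left_comm closed)
  also have "z \<sqinter> neg y = (neg y \<oplus> neg z) \<odot> z"
    using meet_comm[OF c(2) c(4)] by (simp add: mvmeet_def)
  also have "x \<odot> ((neg y \<oplus> neg z) \<odot> z) = (z \<odot> x) \<odot> (neg y \<oplus> neg z)"
    using x y c by (simp add: times_comm times_assoc times_left_comm closed)
  also have "z \<odot> x = t \<sqinter> x"
    using x c by (simp add: mvmeet_def z_def plus_comm)
  finally have eq: "t \<sqinter> (x \<odot> neg y) = (t \<sqinter> x) \<odot> (neg y \<oplus> neg z)" .
  have "neg z \<sqsubseteq> x"
  proof -
    have "neg z = neg t \<odot> x" using x c by (simp add: z_def neg_plus neg_neg times_comm closed)
    then show ?thesis using times_le[of "neg t" x] x c closed by simp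
  qed
  then have "neg y \<oplus> neg z \<sqsubseteq> neg y \<oplus> x"
    using plus_mono[of "neg z" x "neg y"] x c by (simp add: plus_comm)
  then have "(t \<sqinter> x) \<odot> (neg y \<oplus> neg z) \<sqsubseteq> t \<odot> (neg y \<oplus> x)"
    using x y c by (intro times_mono2 meet_lower1) (auto simp: closed meet_closed)
  also have "t \<odot> (neg y \<oplus> x) = neg x \<odot> (x \<sqinter> y)"
    using x y c by (simp add: t_def mvmeet_def times_comm times_assoc times_left_comm plus_comm closed)
  finally have 1: "t \<sqinter> (x \<odot> neg y) \<sqsubseteq> neg x \<odot> (x \<sqinter> y)" using eq by simp
  have "(x \<sqinter> y) \<odot> neg x \<sqsubseteq> x \<odot> neg x"
    using x y c by (intro times_mono meet_lower1) (auto simp: meet_closed)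
  then have "neg x \<odot> (x \<sqinter> y) \<sqsubseteq> \<zero>"
    using x y c by (simp add: times_neg_self times_comm[of "neg x"] meet_closed)
  then have "neg x \<odot> (x \<sqinter> y) = \<zero>"
    using le_zero_iff x y c by (simp add: closed meet_closed)
  then show ?thesis using 1 le_zero_iff x y c by (simp add: t_def closed meet_closed)
qed

lemma prelinearity:
  assumes x: "x \<in> carrier A" and y: "y \<in> carrier A"
  shows "(neg x \<oplus> y) \<squnion> (neg y \<oplus> x) = \<one>"
proof -
  have "neg ((x \<odot> neg y) \<sqinter> (y \<odot> neg x)) = \<one>"
    using differences_disjoint[OF y x] by (simp add: neg_zero)
  then show ?thesis
    using x y by (simp add: meet_eq closed neg_times neg_neg join_closed)
qed

text \<open>An idempotent \<open>p\<close> satisfies \<open>neg p \<sqinter> p = \<zero>\<close>, hence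
  \<open>neg p \<squnion> p = \<one>\<close>, which unfolds to \<open>neg p \<sqsubseteq> neg p \<odot> neg p\<close>.\<close>

lemma idempotent_neg:
  assumes p: "p \<in> carrier A" and "p \<odot> p = p"
  shows "neg p \<odot> neg p = neg p"
proof -
  have "neg p \<sqinter> p = neg (p \<odot> p) \<odot> p"
    using p by (simp add: mvmeet_def neg_times closed)
  then have "neg p \<sqinter> p = \<zero>"
    using assms times_neg_self by (simp add: times_comm closed)
  then have "neg p \<squnion> p = \<one>"
    using p meet_eq[of "neg p" p] meet_eq[of p "neg p"] join_comm[of "neg p" p]
      neg_neg[of "p \<squnion> neg p"] neg_zero by (simp add: neg_neg closed join_closed)
  then have "neg p \<sqsubseteq> neg p \<odot> neg p"
    using p by (simp add: le_def mvjoin_def neg_neg plus_comm closed)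
  then show ?thesis
    using le_antisym[OF times_le[of "neg p" "neg p"]] p closed by simp
qed

lemma mult_closed: "x \<in> carrier A \<Longrightarrow> mvmult A k x \<in> carrier A"
  by (induction k) (auto simp: closed)

lemma pow_closed: "x \<in> carrier A \<Longrightarrow> mvpow A x k \<in> carrier A"
  by (induction k) (auto simp: closed)

lemma neg_pow: "x \<in> carrier A \<Longrightarrow> neg (mvpow A x k) = mvmult A k (neg x)"
  by (induction k) (auto simp: neg_one neg_times pow_closed)

end

section \<open>Maximal filters\<close>

context mv_algebra
begin

definition mv_filter :: "'a set \<Rightarrow> bool" where
  "mv_filter F \<longleftrightarrow> F \<subseteq> carrier A \<and> \<one> \<in> F \<and> \<zero> \<notin> F \<and>
     (\<forall>x\<in>F. \<forall>y\<in>F. x \<odot> y \<in> F) \<and> (\<forall>x\<in>F. \<forall>y\<in>carrier A. x \<sqsubseteq> y \<longrightarrow> y \<in> F)"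

definition maximal_filter :: "'a set \<Rightarrow> bool" where
  "maximal_filter F \<longleftrightarrow> mv_filter F \<and> (\<forall>G. mv_filter G \<and> F \<subseteq> G \<longrightarrow> G = F)"

lemma mv_filterD:
  assumes "mv_filter F"
  shows "F \<subseteq> carrier A" "\<one> \<in> F" "\<zero> \<notin> F" "\<lbrakk>x \<in> F; y \<in> F\<rbrakk> \<Longrightarrow> x \<odot> y \<in> F"
    "\<lbrakk>x \<in> F; x \<sqsubseteq> y; y \<in> carrier A\<rbrakk> \<Longrightarrow> y \<in> F"
  using assms unfolding mv_filter_def by auto

lemma filter_in_maximal_filter:
  assumes F: "mv_filter F"
  obtains M where "maximal_filter M" "F \<subseteq> M"
proof -
  let ?S = "{G. mv_filter G \<and> F \<subseteq> G}"
  have "\<exists>M\<in>?S. \<forall>X\<in>?S. M \<subseteq> X \<longrightarrow> X = M"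
  proof (rule subset_Zorn_nonempty)
    show "?S \<noteq> {}" using F by auto
  next
    fix \<C> assume ne: "\<C> \<noteq> {}" and chain: "subset.chain ?S \<C>"
    then have sub: "G \<in> \<C> \<Longrightarrow> mv_filter G \<and> F \<subseteq> G" for G
      unfolding subset.chain_def by auto
    have tot: "G \<in> \<C> \<Longrightarrow> H \<in> \<C> \<Longrightarrow> G \<subseteq> H \<or> H \<subseteq> G" for G H
      using chain unfolding subset.chain_def by blast
    have "mv_filter (\<Union>\<C>)"
      unfolding mv_filter_def
    proof (intro conjI ballI impI)
      show "\<Union>\<C> \<subseteq> carrier A" using sub mv_filterD(1) by blast
      show "\<one> \<in> \<Union>\<C>" using sub mv_filterD(2) ne by blast
      show "\<zero> \<notin> \<Union>\<C>" using sub mv_filterD(3) by blast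
    next
      fix x y assume "x \<in> \<Union>\<C>" "y \<in> \<Union>\<C>"
      then obtain G H where GH: "G \<in> \<C>" "H \<in> \<C>" "x \<in> G" "y \<in> H" by auto
      then obtain K where "K \<in> \<C>" "x \<in> K" "y \<in> K" using tot[of G H] by auto
      then show "x \<odot> y \<in> \<Union>\<C>" using sub mv_filterD(4) by blast
    next
      fix x y assume "x \<in> \<Union>\<C>" "y \<in> carrier A" "x \<sqsubseteq> y"
      then show "y \<in> \<Union>\<C>" using sub mv_filterD(5) by blast
    qed
    then show "\<Union>\<C> \<in> ?S" using sub ne by blast
  qed
  then show ?thesis using that unfolding maximal_filter_def by (auto dest: order_trans)
qed

text \<open>If \<open>x\<close> is outside \<open>M\<close>, the elements whose join with \<open>x\<close> lies in \<open>M\<close> form a proper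
  filter containing \<open>M\<close>, closed under products by \<open>join_times_join_le\<close>. It equals \<open>M\<close> by
  maximality, and \<open>y\<close> belongs to it.\<close>

lemma maximal_filter_prime:
  assumes M: "maximal_filter M"
    and x: "x \<in> carrier A" and y: "y \<in> carrier A" and xy: "x \<squnion> y \<in> M"
  shows "x \<in> M \<or> y \<in> M"
proof (rule ccontr)
  assume "\<not> (x \<in> M \<or> y \<in> M)"
  then have n: "x \<notin> M" "y \<notin> M" by auto
  have F: "mv_filter M" using M maximal_filter_def by blast
  note FD = mv_filterD[OF F]
  let ?G = "{z \<in> carrier A. x \<squnion> z \<in> M}"
  have "mv_filter ?G"
    unfolding mv_filter_def
  proof (intro conjI ballI impI)
    have "x \<squnion> \<one> = \<one>"
      using x le_antisym[OF le_one join_upper2, of "x \<squnion> \<one>"]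
      by (simp add: mvjoin_def plus_one closed)
    then show "\<one> \<in> ?G" using FD(2) closed by simp
    have "x \<squnion> \<zero> = x" using x by (simp add: mvjoin_def neg_zero times_one plus_zero)
    then show "\<zero> \<notin> ?G" using n by simp
  next
    fix z w assume z: "z \<in> ?G" and w: "w \<in> ?G"
    then have "(x \<squnion> z) \<odot> (x \<squnion> w) \<in> M" using FD(4) by auto
    then have "x \<squnion> (z \<odot> w) \<in> M"
      by (rule FD(5)[OF _ join_times_join_le]) (use x z w in \<open>auto simp: closed join_closed\<close>)
    then show "z \<odot> w \<in> ?G" using z w closed by simp
  next
    fix z w assume z: "z \<in> ?G" and w: "w \<in> carrier A" and zw: "z \<sqsubseteq> w"
    have "x \<squnion> z \<sqsubseteq> x \<squnion> w"
      using x z w zw le_trans[OF zw join_upper2[OF x w]]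
      by (intro join_least join_upper1) (auto simp: join_closed)
    then have "x \<squnion> w \<in> M" using FD(5)[of "x \<squnion> z"] z x w join_closed by simp
    then show "w \<in> ?G" using w by simp
  qed auto
  moreover have "M \<subseteq> ?G"
  proof
    fix z assume z: "z \<in> M"
    then have "z \<in> carrier A" using FD(1) by auto
    then show "z \<in> ?G" using FD(5)[OF z join_upper2[OF x]] x join_closed by simp
  qed
  ultimately have "?G = M" using M maximal_filter_def by blast
  then show False using xy y n by blast
qed

text \<open>Otherwise \<open>M\<close> and \<open>p\<close> would generate a proper filter: by residuation
  \<open>f \<odot> p = \<zero>\<close> with \<open>f\<close> in \<open>M\<close> puts \<open>neg p\<close> into \<open>M\<close>.\<close>

lemma maximal_filter_idempotent:
  assumes M: "maximal_filter M"
    and p: "p \<in> carrier A" and pp: "p \<odot> p = p" and n: "p \<notin> M"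
  shows "neg p \<in> M"
proof (rule ccontr)
  assume np: "neg p \<notin> M"
  have F: "mv_filter M" using M maximal_filter_def by blast
  note FD = mv_filterD[OF F]
  let ?G = "{z \<in> carrier A. \<exists>f\<in>M. f \<odot> p \<sqsubseteq> z}"
  have "mv_filter ?G"
    unfolding mv_filter_def
  proof (intro conjI ballI impI)
    show "\<one> \<in> ?G" using FD(2) p le_one[of "\<one> \<odot> p"] by (auto simp: closed)
    show "\<zero> \<notin> ?G"
    proof
      assume "\<zero> \<in> ?G"
      then obtain f where f: "f \<in> M" "f \<odot> p \<sqsubseteq> \<zero>" by auto
      then have fc: "f \<in> carrier A" using FD(1) by auto
      have "f \<sqsubseteq> neg p"
        using residuation[of f p \<zero>] f fc p by (simp add: closed plus_zero)
      then show False using FD(5)[OF f(1)] np p closed by simp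
    qed
  next
    fix z w assume "z \<in> ?G" and "w \<in> ?G"
    then obtain f g where fg: "f \<in> M" "g \<in> M" "f \<odot> p \<sqsubseteq> z" "g \<odot> p \<sqsubseteq> w"
      and zw: "z \<in> carrier A" "w \<in> carrier A" by auto
    then have c: "f \<in> carrier A" "g \<in> carrier A" using FD(1) by auto
    have "(f \<odot> p) \<odot> (g \<odot> p) \<sqsubseteq> z \<odot> w"
      by (rule times_mono2) (use fg c p zw closed in auto)
    moreover have "(f \<odot> p) \<odot> (g \<odot> p) = (f \<odot> g) \<odot> (p \<odot> p)"
      using c p closed by (simp add: times_assoc times_left_comm)
    ultimately show "z \<odot> w \<in> ?G" using pp FD(4)[OF fg(1,2)] zw times_closed by auto
  next
    fix z w assume "z \<in> ?G" and w: "w \<in> carrier A" and "z \<sqsubseteq> w"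
    then obtain f where f: "f \<in> M" "f \<odot> p \<sqsubseteq> z" "z \<in> carrier A" by auto
    then have "f \<odot> p \<in> carrier A" using FD(1) p times_closed by auto
    then have "f \<odot> p \<sqsubseteq> w" using le_trans[OF f(2) \<open>z \<sqsubseteq> w\<close>] f(3) w by simp
    then show "w \<in> ?G" using f(1) w by auto
  qed auto
  moreover have "M \<subseteq> ?G"
  proof
    fix z assume z: "z \<in> M"
    then have "z \<in> carrier A" using FD(1) by auto
    then show "z \<in> ?G" using z times_le[of p z] times_comm[of p z] p by auto
  qed
  ultimately have "?G = M" using M maximal_filter_def by blast
  moreover have "p \<in> ?G" using FD(2) p by (auto simp: one_times le_refl intro: bexI[of _ \<one>])
  ultimately show False using n by blast
qed

text \<open>Finite products indexed by lists; repetitions matter because \<open>\<odot>\<close> is not idempotent.\<close>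

primrec mvprod :: "'a list \<Rightarrow> 'a" where
  "mvprod [] = \<one>"
| "mvprod (x # xs) = x \<odot> mvprod xs"

lemma mvprod_closed: "set xs \<subseteq> carrier A \<Longrightarrow> mvprod xs \<in> carrier A"
  by (induction xs) (auto simp: closed)

lemma mvprod_append:
  "\<lbrakk>set xs \<subseteq> carrier A; set ys \<subseteq> carrier A\<rbrakk> \<Longrightarrow> mvprod (xs @ ys) = mvprod xs \<odot> mvprod ys"
  by (induction xs) (auto simp: one_times times_assoc mvprod_closed)

text \<open>The hypothesis says that the filter generated by \<open>D\<close> is proper.\<close>

lemma maximal_filter_containing:
  assumes D: "D \<subseteq> carrier A" and fip: "\<And>xs. set xs \<subseteq> D \<Longrightarrow> mvprod xs \<noteq> \<zero>"
  obtains M where "maximal_filter M" "D \<subseteq> M"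
proof -
  let ?F = "{z \<in> carrier A. \<exists>xs. set xs \<subseteq> D \<and> mvprod xs \<sqsubseteq> z}"
  have cl: "mvprod xs \<in> carrier A" if "set xs \<subseteq> D" for xs
    using that D by (intro mvprod_closed) auto
  have "mv_filter ?F"
    unfolding mv_filter_def
  proof (intro conjI ballI impI)
    show "\<one> \<in> ?F" using le_refl closed by (auto intro: exI[of _ "[]"])
    show "\<zero> \<notin> ?F" using fip cl le_zero_iff by blast
  next
    fix z w assume "z \<in> ?F" "w \<in> ?F"
    then obtain xs ys where h: "set xs \<subseteq> D" "mvprod xs \<sqsubseteq> z" "set ys \<subseteq> D" "mvprod ys \<sqsubseteq> w"
      "z \<in> carrier A" "w \<in> carrier A" by auto
    then have "mvprod (xs @ ys) \<sqsubseteq> z \<odot> w"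
      using D by (subst mvprod_append) (auto intro!: times_mono2 cl)
    then show "z \<odot> w \<in> ?F" using h closed by (auto intro!: exI[of _ "xs @ ys"])
  next
    fix z w assume "z \<in> ?F" and w: "w \<in> carrier A" and "z \<sqsubseteq> w"
    then obtain xs where "set xs \<subseteq> D" "mvprod xs \<sqsubseteq> z" "z \<in> carrier A" by auto
    then show "w \<in> ?F" using le_trans[OF _ \<open>z \<sqsubseteq> w\<close> cl] w by auto
  qed auto
  then obtain M where M: "maximal_filter M" "?F \<subseteq> M" using filter_in_maximal_filter by blast
  have "d \<in> ?F" if "d \<in> D" for d
    using that D by (auto intro!: exI[of _ "[d]"] simp: times_one le_refl)
  then show ?thesis using that M by blast
qed

end

text \<open>Reasoning in the quotient by a filter without forming it: \<open>x \<preceq> y\<close> is the order of the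
  quotient, expressed on representatives.\<close>

locale mv_filter_congruence = mv_algebra A for A :: "('a, 'b) mv_scheme" (structure) +
  fixes F :: "'a set"
  assumes filt: "mv_filter F"
begin

lemmas FD = mv_filterD[OF filt]

definition le_mod :: "'a \<Rightarrow> 'a \<Rightarrow> bool" (infix "\<preceq>" 50)
  where "x \<preceq> y \<longleftrightarrow> neg x \<oplus> y \<in> F"

lemma le_mod_of_le: "x \<sqsubseteq> y \<Longrightarrow> x \<preceq> y"
  using FD(2) by (simp add: le_def le_mod_def)

lemma le_mod_trans:
  assumes xy: "x \<preceq> y" and yz: "y \<preceq> z" and c: "x \<in> carrier A" "y \<in> carrier A" "z \<in> carrier A"
  shows "x \<preceq> z"
proof -
  have i: "neg x \<oplus> y \<in> carrier A" "neg y \<oplus> z \<in> carrier A" "neg x \<oplus> z \<in> carrier A"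
    using c closed by auto
  have "((neg x \<oplus> y) \<odot> x) \<odot> (neg y \<oplus> z) \<sqsubseteq> y \<odot> (neg y \<oplus> z)"
    using c i residuation[of "neg x \<oplus> y" x y] by (intro times_mono) (auto simp: le_refl closed)
  moreover have "y \<odot> (neg y \<oplus> z) \<sqsubseteq> z"
    using c i residuation[of "neg y \<oplus> z" y z] by (simp add: le_refl times_comm)
  ultimately have "((neg x \<oplus> y) \<odot> x) \<odot> (neg y \<oplus> z) \<sqsubseteq> z"
    by (rule le_trans) (use c i closed in auto)
  moreover have "((neg x \<oplus> y) \<odot> x) \<odot> (neg y \<oplus> z) = ((neg x \<oplus> y) \<odot> (neg y \<oplus> z)) \<odot> x"
    using c i by (simp add: times_assoc times_comm times_left_comm closed)
  ultimately have "(neg x \<oplus> y) \<odot> (neg y \<oplus> z) \<sqsubseteq> neg x \<oplus> z"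
    using residuation[of "(neg x \<oplus> y) \<odot> (neg y \<oplus> z)" x z] c i closed by simp
  then show ?thesis
    using FD(5)[OF FD(4)[OF xy[unfolded le_mod_def] yz[unfolded le_mod_def]]] i(3)
    unfolding le_mod_def by simp
qed

lemma le_mod_plus:
  assumes xy: "x \<preceq> y" and c: "x \<in> carrier A" "y \<in> carrier A" "z \<in> carrier A"
  shows "x \<oplus> z \<preceq> y \<oplus> z"
proof -
  have "neg x \<oplus> y \<sqsubseteq> neg (x \<oplus> z) \<oplus> (y \<oplus> z)"
  proof -
    have "neg (x \<oplus> z) \<oplus> (y \<oplus> z) = (neg x \<odot> neg z \<oplus> z) \<oplus> y"
      using c by (simp add: neg_plus plus_assoc plus_comm plus_left_comm closed)
    also have "neg x \<odot> neg z \<oplus> z = neg x \<squnion> z" using c by (simp add: mvjoin_def)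
    finally show ?thesis
      using plus_mono[OF join_upper1[of "neg x" z], of y] c closed join_closed by simp
  qed
  then show ?thesis using FD(5)[OF xy[unfolded le_mod_def]] c unfolding le_mod_def by (simp add: closed)
qed

lemma le_mod_plus2:
  assumes "x \<preceq> y" "z \<preceq> w" "x \<in> carrier A" "y \<in> carrier A" "z \<in> carrier A" "w \<in> carrier A"
  shows "x \<oplus> z \<preceq> y \<oplus> w"
proof (rule le_mod_trans[of _ "y \<oplus> z"])
  show "x \<oplus> z \<preceq> y \<oplus> z" using assms by (intro le_mod_plus)
  show "y \<oplus> z \<preceq> y \<oplus> w"
    using assms le_mod_plus[of z w y] by (simp add: plus_comm)
qed (use assms closed in auto)

lemma le_mod_neg:
  "\<lbrakk>x \<preceq> y; x \<in> carrier A; y \<in> carrier A\<rbrakk> \<Longrightarrow> neg y \<preceq> neg x"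
  by (simp add: le_mod_def neg_neg plus_comm closed)

lemma le_mod_mult:
  "\<lbrakk>x \<preceq> y; x \<in> carrier A; y \<in> carrier A\<rbrakk> \<Longrightarrow> mvmult A k x \<preceq> mvmult A k y"
  by (induction k) (auto intro: le_mod_plus2 simp: le_mod_of_le le_refl closed mult_closed)

lemma one_le_mod_iff: "x \<in> carrier A \<Longrightarrow> \<one> \<preceq> x \<longleftrightarrow> x \<in> F"
  by (simp add: le_mod_def neg_one zero_plus)

end

section \<open>Algebras with evaluations into the finite chain\<close>

lemma nbar_zero: "0 \<in> nbar n"
  unfolding nbar_def by (auto intro: exI[of _ 0])

lemma nbar_one: "n \<ge> 2 \<Longrightarrow> 1 \<in> nbar n"
  unfolding nbar_def by (auto intro!: exI[of _ "n - 1"])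

lemma nbar_neg: "n \<ge> 2 \<Longrightarrow> x \<in> nbar n \<Longrightarrow> 1 - x \<in> nbar n"
  unfolding nbar_def
proof clarify
  fix i assume "n \<ge> 2" "i \<le> n - 1"
  then have "1 - real i / real (n - 1) = real (n - 1 - i) / real (n - 1)"
    by (simp add: of_nat_diff field_simps)
  then show "\<exists>j. 1 - real i / real (n - 1) = real j / real (n - 1) \<and> j \<le> n - 1"
    using diff_le_self by blast
qed

lemma nbar_plus:
  assumes n: "n \<ge> 2" and x: "x \<in> nbar n" and y: "y \<in> nbar n"
  shows "min 1 (x + y) \<in> nbar n"
proof -
  obtain i j where ij: "x = real i / real (n - 1)" "y = real j / real (n - 1)"
    using x y unfolding nbar_def by auto
  have N: "real (n - 1) > 0" using n by simp
  have xy: "x + y = real (i + j) / real (n - 1)" using ij by (simp add: add_divide_distrib)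
  show ?thesis
  proof (cases "i + j \<le> n - 1")
    case True
    then have "x + y \<le> 1" using xy N by (simp add: divide_le_eq)
    then have "min 1 (x + y) = real (i + j) / real (n - 1)" using xy by simp
    then show ?thesis using True unfolding nbar_def by blast
  next
    case False
    then have "real (n - 1) \<le> real (i + j)" by linarith
    then have "x + y \<ge> 1" using xy N by (simp add: le_divide_eq)
    then show ?thesis using nbar_one[OF n] by (simp add: min_def)
  qed
qed

lemma nbar_times: "n \<ge> 2 \<Longrightarrow> x \<in> nbar n \<Longrightarrow> y \<in> nbar n \<Longrightarrow> max 0 (x + y - 1) \<in> nbar n"
proof -
  assume h: "n \<ge> 2" "x \<in> nbar n" "y \<in> nbar n"
  have "max 0 (x + y - 1) = 1 - min 1 ((1 - x) + (1 - y))" by (auto simp: max_def min_def)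
  then show ?thesis using nbar_neg[OF h(1) nbar_plus[OF h(1) nbar_neg[OF h(1,2)] nbar_neg[OF h(1,3)]]] by simp
qed

lemma nbar_gap: "x \<in> nbar n \<Longrightarrow> x \<noteq> 1 \<Longrightarrow> n \<ge> 2 \<Longrightarrow> real (n - 1) * (1 - x) \<ge> 1"
proof -
  assume h: "x \<in> nbar n" "x \<noteq> 1" "n \<ge> 2"
  then obtain i where i: "x = real i / real (n - 1)" "i \<le> n - 1" unfolding nbar_def by auto
  then have "i < n - 1" using h by (cases "i = n - 1") auto
  then have "real i + 1 \<le> real (n - 1)" by linarith
  moreover have "real (n - 1) * (1 - x) = real (n - 1) - real i"
    using i h by (simp add: field_simps)
  ultimately show ?thesis by linarith
qed

lemma nbar_gap_zero: "x \<in> nbar n \<Longrightarrow> x \<noteq> 0 \<Longrightarrow> n \<ge> 2 \<Longrightarrow> real (n - 1) * x \<ge> 1"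
proof -
  assume h: "x \<in> nbar n" "x \<noteq> 0" "n \<ge> 2"
  then obtain i where i: "x = real i / real (n - 1)" unfolding nbar_def by auto
  moreover from i have "i \<noteq> 0" using h by auto
  ultimately show ?thesis using h by simp
qed

lemma finite_nbar: "finite (nbar n)"
proof -
  have "nbar n = (\<lambda>i. real i / real (n - 1)) ` {..n - 1}" unfolding nbar_def by auto
  then show ?thesis by simp
qed

text \<open>The biresiduum of \<open>a\<close> and \<open>r\<close> has the value one exactly where \<open>a\<close> has the value
  \<open>r\<close>; the power sends every smaller value to zero.\<close>

definition level :: "nat \<Rightarrow> 'a lnc \<Rightarrow> 'a \<Rightarrow> real \<Rightarrow> 'a" where
  "level n A a r =
     mvpow A (mvtimes A (mvimp A a (cst A r)) (mvimp A (cst A r) a)) (n - 1)"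

text \<open>A family of maps into \<open>nbar n\<close>, indexed by \<open>P\<close>, that respects the operations and
  constants. Homomorphisms into the chain and points of a space both arise in this way; the
  index type is kept separate from functions on the carrier so that the points may live in an
  arbitrary type.\<close>

locale nbar_evaluation =
  fixes n :: nat and A :: "'a lnc" (structure) and P :: "'p set" and e :: "'p \<Rightarrow> 'a \<Rightarrow> real"
  assumes n2: "n \<ge> 2"
    and closed_plus: "\<lbrakk>a \<in> carrier A; b \<in> carrier A\<rbrakk> \<Longrightarrow> a \<oplus> b \<in> carrier A"
    and closed_times: "\<lbrakk>a \<in> carrier A; b \<in> carrier A\<rbrakk> \<Longrightarrow> a \<odot> b \<in> carrier A"
    and closed_neg: "a \<in> carrier A \<Longrightarrow> neg a \<in> carrier A"
    and closed_zero: "\<zero> \<in> carrier A"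
    and closed_one: "\<one> \<in> carrier A"
    and closed_cst: "r \<in> nbar n \<Longrightarrow> cst A r \<in> carrier A"
    and e_nbar: "\<lbrakk>p \<in> P; a \<in> carrier A\<rbrakk> \<Longrightarrow> e p a \<in> nbar n"
    and e_plus: "\<lbrakk>p \<in> P; a \<in> carrier A; b \<in> carrier A\<rbrakk> \<Longrightarrow> e p (a \<oplus> b) = min 1 (e p a + e p b)"
    and e_times: "\<lbrakk>p \<in> P; a \<in> carrier A; b \<in> carrier A\<rbrakk> \<Longrightarrow> e p (a \<odot> b) = max 0 (e p a + e p b - 1)"
    and e_neg: "\<lbrakk>p \<in> P; a \<in> carrier A\<rbrakk> \<Longrightarrow> e p (neg a) = 1 - e p a"
    and e_zero: "p \<in> P \<Longrightarrow> e p \<zero> = 0"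
    and e_one: "p \<in> P \<Longrightarrow> e p \<one> = 1"
    and e_cst: "\<lbrakk>p \<in> P; r \<in> nbar n\<rbrakk> \<Longrightarrow> e p (cst A r) = r"
begin

lemmas closures = closed_plus closed_times closed_neg closed_zero closed_one closed_cst
lemmas e_simps = e_plus e_times e_neg e_zero e_one e_cst

lemma e_bounds: "\<lbrakk>p \<in> P; a \<in> carrier A\<rbrakk> \<Longrightarrow> 0 \<le> e p a \<and> e p a \<le> 1"
  using e_nbar nbar_bounds by blast

lemma closed_join: "\<lbrakk>a \<in> carrier A; b \<in> carrier A\<rbrakk> \<Longrightarrow> mvjoin A a b \<in> carrier A"
  by (simp add: mvjoin_def closures)

lemma closed_meet: "\<lbrakk>a \<in> carrier A; b \<in> carrier A\<rbrakk> \<Longrightarrow> mvmeet A a b \<in> carrier A"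
  by (simp add: mvmeet_def closures)

lemma closed_imp: "\<lbrakk>a \<in> carrier A; b \<in> carrier A\<rbrakk> \<Longrightarrow> mvimp A a b \<in> carrier A"
  by (simp add: mvimp_def closures)

lemma closed_mult: "a \<in> carrier A \<Longrightarrow> mvmult A k a \<in> carrier A"
  by (induction k) (simp_all add: closures)

lemma closed_pow: "a \<in> carrier A \<Longrightarrow> mvpow A a k \<in> carrier A"
  by (induction k) (simp_all add: closures)

lemma closed_level: "a \<in> carrier A \<Longrightarrow> r \<in> nbar n \<Longrightarrow> level n A a r \<in> carrier A"
  by (simp add: level_def closed_pow closed_imp closures)

lemma e_join:
  "\<lbrakk>p \<in> P; a \<in> carrier A; b \<in> carrier A\<rbrakk> \<Longrightarrow> e p (mvjoin A a b) = max (e p a) (e p b)"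
  using e_bounds[of p a] e_bounds[of p b] by (auto simp: mvjoin_def closures e_simps)

lemma e_meet:
  "\<lbrakk>p \<in> P; a \<in> carrier A; b \<in> carrier A\<rbrakk> \<Longrightarrow> e p (mvmeet A a b) = min (e p a) (e p b)"
  using e_bounds[of p a] e_bounds[of p b] by (auto simp: mvmeet_def closures e_simps)

lemma e_imp:
  "\<lbrakk>p \<in> P; a \<in> carrier A; b \<in> carrier A\<rbrakk> \<Longrightarrow> e p (mvimp A a b) = min 1 (1 - e p a + e p b)"
  by (simp add: mvimp_def closures e_simps)

lemma e_mult: "\<lbrakk>p \<in> P; a \<in> carrier A\<rbrakk> \<Longrightarrow> e p (mvmult A k a) = min 1 (real k * e p a)"
proof (induction k)
  case (Suc k)
  then show ?case using e_bounds[of p a]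
    by (auto simp: closed_mult e_simps algebra_simps min_def)
qed (simp add: e_simps)

lemma e_pow: "\<lbrakk>p \<in> P; a \<in> carrier A\<rbrakk> \<Longrightarrow> e p (mvpow A a k) = max 0 (1 - real k * (1 - e p a))"
proof (induction k)
  case (Suc k)
  then show ?case using e_bounds[of p a]
    by (auto simp: closed_pow e_simps algebra_simps max_def)
qed (simp add: e_simps)

lemma e_pow_top:
  assumes "p \<in> P" "a \<in> carrier A"
  shows "e p (mvpow A a (n - 1)) = (if e p a = 1 then 1 else 0)"
  using nbar_gap[OF e_nbar[OF assms] _ n2] assms by (auto simp: e_pow)

lemma e_level:
  assumes "p \<in> P" "a \<in> carrier A" "r \<in> nbar n"
  shows "e p (level n A a r) = (if e p a = r then 1 else 0)"
proof -
  have "e p (mvtimes A (mvimp A a (cst A r)) (mvimp A (cst A r) a)) = 1 - \<bar>e p a - r\<bar>"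
    using assms e_bounds[OF assms(1,2)] nbar_bounds[OF assms(3)]
    by (auto simp: e_simps e_imp closed_imp closures)
  then show ?thesis
    unfolding level_def by (subst e_pow_top) (use assms in \<open>auto simp: closures closed_imp\<close>)
qed

end

locale separating_evaluation = nbar_evaluation +
  assumes nonempty: "P \<noteq> {}"
    and separated: "\<lbrakk>a \<in> carrier A; b \<in> carrier A; \<And>p. p \<in> P \<Longrightarrow> e p a = e p b\<rbrakk> \<Longrightarrow> a = b"
begin

text \<open>The two inequalities give \<open>j x \<ge> 1\<close> and \<open>j x \<le> 1\<close>. So \<open>x\<close> would be
  \<open>1/j\<close>, which lies in \<open>nbar n\<close> only if \<open>j\<close> divides \<open>n - 1\<close>.\<close>

lemma nondivisor_levels:
  assumes j: "1 < j" "\<not> j dvd n - 1" and x: "x \<in> nbar n"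
    and *: "real j * x \<ge> 1" "x + min 1 (real (j - 1) * x) \<le> 1"
  shows False
proof -
  obtain i where i: "x = real i / real (n - 1)" using x unfolding nbar_def by auto
  have N: "real (n - 1) > 0" using n2 by simp
  have pos: "x > 0" using *(1) j nbar_bounds[OF x] by (cases "x = 0") auto
  then have "real (j - 1) * x \<le> 1 - x" using *(2) by (auto simp: min_def split: if_splits)
  then have "real j * x \<le> 1" using j by (simp add: of_nat_diff algebra_simps)
  then have "real j * x = 1" using * by simp
  then have "real (j * i) = real (n - 1)" using i N by (simp add: field_simps)
  then have "j * i = n - 1" using of_nat_eq_iff by blast
  then show False using j by (metis dvd_triv_left)
qed

text \<open>Apart from closure and the injectivity of the constants, all axioms are identities between
  terms, so separation reduces them to real arithmetic in the chain.\<close>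

theorem lnc_algebra: "lnc_algebra n A"
proof (unfold_locales)
  fix x j assume j: "4 \<le> n" "1 < j" "j < n - 1" "\<not> j dvd n - 1" and x: "x \<in> carrier A"
  show "mvpow A (mvmult A j x \<odot> (neg x \<oplus> neg (mvmult A (j - 1) x))) (n - 1) = \<zero>"
  proof (rule separated)
    fix p assume p: "p \<in> P"
    let ?y = "mvmult A j x \<odot> (neg x \<oplus> neg (mvmult A (j - 1) x))"
    have y: "?y \<in> carrier A" using x by (simp add: closures closed_mult)
    have "e p ?y = max 0 (min 1 (real j * e p x) + min 1 (1 - e p x + (1 - min 1 (real (j - 1) * e p x))) - 1)"
      using p x by (simp add: closures closed_mult e_simps e_mult)
    moreover have "u \<ge> 1 \<and> t + min 1 v \<le> 1"
      if "max 0 (min 1 u + min 1 (1 - t + (1 - min 1 v)) - 1) = 1" for t u v :: real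
      using that by (auto simp: min_def max_def split: if_splits)
    ultimately have "e p ?y \<noteq> 1"
      using nondivisor_levels[OF j(2,4) e_nbar[OF p x]] by metis
    then show "e p (mvpow A ?y (n - 1)) = e p \<zero>"
      using p y by (simp only: e_pow_top e_zero) simp
  qed (use x in \<open>simp_all add: closures closed_mult closed_pow\<close>)
  show "mvmult A (n - 1) (mvpow A x j \<oplus> (neg x \<odot> neg (mvpow A x (j - 1)))) = \<one>"
  proof (rule separated)
    fix p assume p: "p \<in> P"
    let ?y = "mvpow A x j \<oplus> (neg x \<odot> neg (mvpow A x (j - 1)))"
    have y: "?y \<in> carrier A" using x by (simp add: closures closed_pow)
    have "e p ?y = min 1 (max 0 (1 - real j * (1 - e p x)) +
        max 0 (1 - e p x + (1 - max 0 (1 - real (j - 1) * (1 - e p x))) - 1))"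
      using p x by (simp add: closures closed_pow e_simps e_pow)
    moreover have "u \<ge> 1 \<and> t + min 1 v \<le> 1"
      if "min 1 (max 0 (1 - u) + max 0 (t + (1 - max 0 (1 - v)) - 1)) = 0" for t u v :: real
      using that by (auto simp: min_def max_def split: if_splits)
    ultimately have "e p ?y \<noteq> 0"
      using nondivisor_levels[OF j(2,4) nbar_neg[OF n2 e_nbar[OF p x]]] by metis
    then have "real (n - 1) * e p ?y \<ge> 1"
      using nbar_gap_zero[OF e_nbar[OF p y] _ n2] by blast
    then show "e p (mvmult A (n - 1) ?y) = e p \<one>"
      using p y by (simp only: e_mult e_one)
  qed (use x in \<open>simp_all add: closures closed_mult closed_pow\<close>)
next
  fix x assume x: "x \<in> carrier A"
  show "mvmult A (n - 1) x \<oplus> x = mvmult A (n - 1) x"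
  proof (rule separated)
    fix p assume p: "p \<in> P"
    have "e p (mvmult A (n - 1) x) = (if e p x = 0 then 0 else 1)"
      using nbar_gap_zero[OF e_nbar[OF p x] _ n2] e_mult[OF p x, of "n - 1"] by simp
    then show "e p (mvmult A (n - 1) x \<oplus> x) = e p (mvmult A (n - 1) x)"
      using p x e_bounds[OF p x] by (simp add: closed_mult e_plus)
  qed (use x in \<open>simp_all add: closures closed_mult\<close>)
  show "mvpow A x (n - 1) \<odot> x = mvpow A x (n - 1)"
  proof (rule separated)
    fix p assume p: "p \<in> P"
    show "e p (mvpow A x (n - 1) \<odot> x) = e p (mvpow A x (n - 1))"
      using p x e_bounds[OF p x] e_pow_top[OF p x] by (simp add: closed_pow e_times)
  qed (use x in \<open>simp_all add: closures closed_pow\<close>)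
next
  obtain p where p: "p \<in> P" using nonempty by auto
  show "inj_on (cst A) (nbar n)"
    by (rule inj_onI) (metis e_cst p)
next
  fix r s assume rs: "r \<in> nbar n" "s \<in> nbar n"
  note nb = nbar_plus[OF n2] nbar_times[OF n2] nbar_neg[OF n2]
  have m: "min r s \<in> nbar n" "max r s \<in> nbar n" using rs by (auto simp: min_def max_def)
  have i: "min 1 (1 - (r - s)) \<in> nbar n" using nb(1)[OF nb(3)[OF rs(1)] rs(2)]
    by (simp only: diff_diff_eq2 diff_add_eq)
  show "cst A (min r s) = mvmeet A (cst A r) (cst A s)"
    by (rule separated) (use rs m in \<open>auto simp: closures closed_meet e_meet e_cst\<close>)
  show "cst A (max r s) = mvjoin A (cst A r) (cst A s)"
    by (rule separated) (use rs m in \<open>auto simp: closures closed_join e_join e_cst\<close>)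
  show "cst A (max 0 (r + s - 1)) = cst A r \<odot> cst A s"
    by (rule separated) (use rs nb in \<open>auto simp: closures e_simps\<close>)
  show "cst A (min 1 (r + s)) = cst A r \<oplus> cst A s"
    by (rule separated) (use rs nb in \<open>auto simp: closures e_simps\<close>)
  show "cst A (min 1 (1 - (r - s))) = mvimp A (cst A r) (cst A s)"
    by (rule separated) (use rs i in \<open>auto simp: closures closed_imp e_imp e_cst algebra_simps\<close>)
next
  fix r assume "r \<in> nbar n"
  then show "cst A (1 - r) = neg (cst A r)"
    by (intro separated) (use nbar_neg[OF n2] in \<open>auto simp: closures e_simps\<close>)
next
  fix x y assume xy: "x \<in> carrier A" "y \<in> carrier A"
  show "neg (neg x \<oplus> y) \<oplus> y = neg (neg y \<oplus> x) \<oplus> x"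
  proof (rule separated)
    fix p assume p: "p \<in> P"
    show "e p (neg (neg x \<oplus> y) \<oplus> y) = e p (neg (neg y \<oplus> x) \<oplus> x)"
      using p xy e_bounds[OF p xy(1)] e_bounds[OF p xy(2)]
      by (simp add: closures e_simps min_def)
  qed (use xy in \<open>simp_all add: closures\<close>)
  show "x \<odot> y = neg (neg x \<oplus> neg y)"
    by (rule separated) (use xy in \<open>auto simp: closures e_simps min_def max_def\<close>)
  show "x \<oplus> y = y \<oplus> x"
    by (rule separated) (use xy in \<open>auto simp: closures e_simps add.commute\<close>)
next
  fix x y z assume xyz: "x \<in> carrier A" "y \<in> carrier A" "z \<in> carrier A"
  show "x \<oplus> y \<oplus> z = x \<oplus> (y \<oplus> z)"
  proof (rule separated)
    fix p assume p: "p \<in> P"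
    show "e p (x \<oplus> y \<oplus> z) = e p (x \<oplus> (y \<oplus> z))"
      using p xyz e_bounds[OF p xyz(1)] e_bounds[OF p xyz(2)] e_bounds[OF p xyz(3)]
      by (simp add: closures e_simps min_def)
  qed (use xyz in \<open>simp_all add: closures\<close>)
next
  fix x assume x: "x \<in> carrier A"
  show "x \<oplus> \<zero> = x"
    by (rule separated) (use x e_bounds in \<open>auto simp: closures e_simps\<close>)
  show "x \<oplus> \<one> = \<one>"
    by (rule separated) (use x e_bounds in \<open>auto simp: closures e_simps\<close>)
  show "neg (neg x) = x"
    by (rule separated) (use x in \<open>auto simp: closures e_simps\<close>)
next
  show "neg \<zero> = \<one>"
    by (rule separated) (auto simp: closures e_simps)
  show "cst A 0 = \<zero>"
    by (rule separated) (auto simp: closures e_simps nbar_zero)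
  show "cst A 1 = \<one>"
    by (rule separated) (auto simp: closures e_simps nbar_one[OF n2])
qed (auto simp: closures n2)

end

lemma nbar_alg_lnc:
  assumes n: "n \<ge> 2"
  shows "lnc_algebra n (nbar_alg n)"
proof -
  interpret separating_evaluation n "nbar_alg n" "{()}" "\<lambda>_ x. x"
    by unfold_locales (use n nbar_plus[OF n] nbar_times[OF n] nbar_neg[OF n] nbar_zero nbar_one[OF n]
        in \<open>auto simp: nbar_alg_def\<close>)
  show ?thesis by (rule lnc_algebra)
qed

text \<open>The remaining operations are terms in \<open>\<oplus>\<close> and \<open>neg\<close>.\<close>

lemma lnc_homI:
  assumes A: "mv_algebra A" and B: "mv_algebra B"
    and f: "f \<in> carrier A \<rightarrow>\<^sub>E carrier B"
    and plus: "\<And>x y. \<lbrakk>x \<in> carrier A; y \<in> carrier A\<rbrakk> \<Longrightarrow> f (mvplus A x y) = mvplus B (f x) (f y)"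
    and neg: "\<And>x. x \<in> carrier A \<Longrightarrow> f (mvneg A x) = mvneg B (f x)"
    and cst: "\<And>r. r \<in> nbar n \<Longrightarrow> f (cst A r) = cst B r"
  shows "f \<in> lnc_hom n A B"
proof -
  interpret A: mv_algebra A by fact
  interpret B: mv_algebra B by fact
  have fB: "f x \<in> carrier B" if "x \<in> carrier A" for x using f that by auto
  have times: "f (mvtimes A x y) = mvtimes B (f x) (f y)" if "x \<in> carrier A" "y \<in> carrier A" for x y
    using that fB by (simp add: A.times_eq B.times_eq plus neg A.closed)
  show ?thesis
    unfolding lnc_hom_def using f cst
    by (auto simp: plus neg times mvmeet_def mvjoin_def mvimp_def A.closed)
qed

lemma hom_evaluation:
  fixes A :: "'a lnc"
  assumes "lnc_algebra n A"
  shows "nbar_evaluation n A (lnc_hom n A (nbar_alg n)) (\<lambda>h. h)"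
proof -
  interpret lnc_algebra n A by fact
  have c0: "h \<zero>\<^bsub>A\<^esub> = 0" and c1: "h \<one>\<^bsub>A\<^esub> = 1" if "h \<in> lnc_hom n A (nbar_alg n)" for h
    using that nbar_zero[of n] nbar_one[OF n_ge_2] cst_zero cst_one
    unfolding lnc_hom_def nbar_alg_def by force+
  show ?thesis
    by unfold_locales (use n_ge_2 c0 c1 in \<open>auto simp: closed cst_closed lnc_hom_def nbar_alg_def PiE_iff\<close>)
qed

section \<open>Homomorphisms into the finite chain\<close>

context lnc_algebra
begin

text \<open>The constants in increasing order; \<open>step 1\<close> generates them additively.\<close>

definition step :: "nat \<Rightarrow> 'a" where "step i = cst A (real i / real (n - 1))"

lemma step_nbar: "i \<le> n - 1 \<Longrightarrow> real i / real (n - 1) \<in> nbar n"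
  unfolding nbar_def by blast

lemma step_closed: "i \<le> n - 1 \<Longrightarrow> step i \<in> carrier A"
  unfolding step_def by (intro cst_closed step_nbar)

lemma step_zero: "step 0 = \<zero>"
  using cst_zero by (simp add: step_def)

lemma step_top: "step (n - 1) = \<one>"
  using cst_one n_ge_2 by (simp add: step_def)

lemma step_Suc:
  assumes "i < n - 1"
  shows "step i \<oplus> step 1 = step (Suc i)"
proof -
  have N: "real (n - 1) > 0" using n_ge_2 by simp
  have "real i / real (n - 1) + real 1 / real (n - 1) = real (Suc i) / real (n - 1)"
    by (simp add: add_divide_distrib)
  moreover have "real (Suc i) / real (n - 1) \<le> 1"
    using assms N by (subst divide_le_eq_1_pos) linarith+
  ultimately have "min 1 (real i / real (n - 1) + real 1 / real (n - 1)) = real (Suc i) / real (n - 1)"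
    by (simp only: min_absorb2)
  then show ?thesis
    using cst_plus[OF step_nbar[of i] step_nbar[of 1]] assms by (simp add: step_def)
qed

lemma step_mult: "k \<le> n - 1 \<Longrightarrow> mvmult A k (step 1) = step k"
proof (induction k)
  case 0
  then show ?case by (simp add: step_zero)
next
  case (Suc k)
  then have "mvmult A (Suc k) (step 1) = step k \<oplus> step 1" by simp
  also have "\<dots> = step (Suc k)" by (rule step_Suc) (use Suc.prems in simp)
  finally show ?case .
qed

lemma step_neg: "neg (step 1) = step (n - 2)"
proof -
  have "1 - real 1 / real (n - 1) = real (n - 2) / real (n - 1)"
    using n_ge_2 by (simp add: of_nat_diff field_simps)
  then show ?thesis using cst_neg[OF step_nbar[of 1]] n_ge_2 by (simp add: step_def)
qed

lemma pow_cst: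
  assumes t: "t \<in> nbar n"
  shows "mvpow A (cst A t) k = cst A (max 0 (1 - real k * (1 - t))) \<and>
    max 0 (1 - real k * (1 - t)) \<in> nbar n"
proof (induction k)
  case 0
  then show ?case using cst_one nbar_one[OF n_ge_2] by simp
next
  case (Suc k)
  let ?r = "max 0 (1 - real k * (1 - t))"
  have "max 0 (?r + t - 1) = max 0 (1 - real (Suc k) * (1 - t))"
    using nbar_bounds[OF t] by (auto simp: algebra_simps max_def)
  then show ?case
    using Suc cst_times[of ?r t] nbar_times[OF n_ge_2, of ?r t] t by simp
qed

lemma pow_idempotent: "x \<in> carrier A \<Longrightarrow> mvpow A x (n - 1) \<odot> mvpow A x (n - 1) = mvpow A x (n - 1)"
proof -
  assume x: "x \<in> carrier A"
  have "mvpow A x (n - 1) \<odot> mvpow A x k = mvpow A x (n - 1)" for k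
  proof (induction k)
    case 0
    then show ?case using x by (simp add: times_one pow_closed)
  next
    case (Suc k)
    then show ?case
      using x pow_stable[OF x] by (simp add: times_assoc[symmetric] pow_closed)
  qed
  then show ?thesis .
qed

lemma pow_le: "x \<in> carrier A \<Longrightarrow> mvpow A x (n - 1) \<sqsubseteq> x"
  using times_le[of "mvpow A x (n - 1)" x] pow_stable[of x] by (simp add: pow_closed)

end

text \<open>The quotient by a maximal filter is the chain \<open>nbar n\<close> itself: its order is total, and every
  class contains exactly one constant.\<close>

locale lnc_maximal_filter = lnc_algebra n A + mv_filter_congruence A F
  for n and A :: "'a lnc" (structure) and F +
  assumes maximal: "maximal_filter F"
begin

lemma total:
  assumes "x \<in> carrier A" "y \<in> carrier A"
  shows "x \<preceq> y \<or> y \<preceq> x"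
  using maximal_filter_prime[OF maximal, of "neg x \<oplus> y" "neg y \<oplus> x"] prelinearity[of x y] FD(2) assms
  by (auto simp: le_mod_def closed)

text \<open>The power \<open>x^(n - 1)\<close> is an idempotent below \<open>x\<close>, so it is outside the filter and its
  negation is inside.\<close>

lemma mult_neg_in_filter:
  assumes x: "x \<in> carrier A" and n: "x \<notin> F"
  shows "mvmult A (n - 1) (neg x) \<in> F"
proof -
  have "mvpow A x (n - 1) \<notin> F" using FD(5)[OF _ pow_le[OF x] x] n by blast
  then have "neg (mvpow A x (n - 1)) \<in> F"
    using maximal_filter_idempotent[OF maximal pow_closed pow_idempotent] x by blast
  then show ?thesis using neg_pow[OF x] by simp
qed

text \<open>Let \<open>d\<close> be the truncated difference of \<open>a\<close> and \<open>step i\<close>. Since \<open>a\<close> is not below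
  \<open>step i\<close>, the multiple \<open>(n - 1) d\<close> is one modulo the filter, that is,
  \<open>neg d \<preceq> (n - 2) d\<close>. From \<open>d \<preceq> step 1\<close> one gets
  \<open>(n - 2) d \<preceq> neg (step 1)\<close>, so \<open>step 1 \<preceq> d\<close>. Adding \<open>step i\<close> gives the
  claim.\<close>

lemma step_covers:
  assumes a: "a \<in> carrier A" and i: "i < n - 1"
    and ia: "step i \<preceq> a" and aS: "a \<preceq> step (Suc i)" and ai: "\<not> (a \<preceq> step i)"
  shows "step (Suc i) \<preceq> a"
proof -
  define d where "d = a \<odot> neg (step i)"
  have c: "step i \<in> carrier A" "step 1 \<in> carrier A" "step (Suc i) \<in> carrier A" "step (n - 2) \<in> carrier A"
    using i by (auto intro!: step_closed)
  have d: "d \<in> carrier A" using a c closed unfolding d_def by blast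
  have N: "n - 1 = Suc (n - 2)" using i by simp
  have nd: "neg d = neg a \<oplus> step i" using a c by (simp add: d_def neg_times neg_neg closed)
  have "mvmult A (n - 1) (neg (neg a \<oplus> step i)) \<in> F"
    using mult_neg_in_filter[of "neg a \<oplus> step i"] ai a c unfolding le_mod_def by (simp add: closed)
  then have "mvmult A (Suc (n - 2)) d \<in> F"
    using nd neg_neg[OF d] N by simp
  then have 1: "neg d \<preceq> mvmult A (n - 2) d"
    using d by (simp add: le_mod_def neg_neg plus_comm mult_closed)
  have "neg d \<oplus> step 1 = neg a \<oplus> step (Suc i)"
    unfolding nd step_Suc[OF i, symmetric] using a c by (simp add: plus_assoc closed)
  then have "d \<preceq> step 1" using aS by (simp add: le_mod_def)
  then have "mvmult A (n - 2) d \<preceq> mvmult A (n - 2) (step 1)"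
    using d c by (intro le_mod_mult) auto
  then have "mvmult A (n - 2) d \<preceq> neg (step 1)"
    using step_mult[of "n - 2"] step_neg by simp
  then have "neg d \<preceq> neg (step 1)"
    by (rule le_mod_trans[OF 1]) (use d c in \<open>auto simp: closed mult_closed\<close>)
  then have "step 1 \<preceq> d"
    using le_mod_neg[of "neg d" "neg (step 1)"] d c by (simp add: neg_neg closed)
  then have "step 1 \<oplus> step i \<preceq> d \<oplus> step i"
    using d c by (intro le_mod_plus)
  then have 2: "step (Suc i) \<preceq> d \<oplus> step i"
    using step_Suc[OF i] plus_comm[OF c(1,2)] by simp
  have "d \<oplus> step i = a \<squnion> step i" by (simp add: d_def mvjoin_def)
  also have "\<dots> = neg (neg (step i) \<oplus> a) \<oplus> a"
    using a c join_comm[of a "step i"] join_eq[of "step i" a] by simp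
  finally have j: "d \<oplus> step i = neg (neg (step i) \<oplus> a) \<oplus> a" .
  have "\<one> \<preceq> neg (step i) \<oplus> a"
    using ia a c one_le_mod_iff[of "neg (step i) \<oplus> a"] by (simp add: le_mod_def closed)
  then have "neg (neg (step i) \<oplus> a) \<preceq> \<zero>"
    using le_mod_neg[of \<one> "neg (step i) \<oplus> a"] a c by (simp add: closed neg_one)
  then have "neg (neg (step i) \<oplus> a) \<oplus> a \<preceq> \<zero> \<oplus> a"
    using a c by (intro le_mod_plus) (auto simp: closed)
  then have "d \<oplus> step i \<preceq> a" using j zero_plus[OF a] by simp
  then show ?thesis using le_mod_trans[OF 2] a c d by (simp add: closed)
qed

text \<open>Take the largest constant below \<open>a\<close>; by \<open>step_covers\<close> nothing lies strictly between
  it and its successor.\<close>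

lemma value_exists:
  assumes a: "a \<in> carrier A"
  shows "\<exists>r\<in>nbar n. a \<preceq> cst A r \<and> cst A r \<preceq> a"
proof -
  let ?I = "{i. i \<le> n - 1 \<and> step i \<preceq> a}"
  have fin: "finite ?I" by simp
  have "0 \<in> ?I" using le_mod_of_le[OF zero_le[OF a]] step_zero by simp
  then have ne: "?I \<noteq> {}" by blast
  define i where "i = Max ?I"
  have i: "i \<le> n - 1" "step i \<preceq> a" using Max_in[OF fin ne] unfolding i_def by auto
  have "a \<preceq> step i"
  proof (cases "i = n - 1")
    case True
    then show ?thesis using le_mod_of_le[OF le_one[OF a]] step_top by simp
  next
    case False
    then have lt: "i < n - 1" using i by simp
    have nS: "\<not> (step (Suc i) \<preceq> a)"
    proof
      assume "step (Suc i) \<preceq> a"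
      then have "Suc i \<in> ?I" using lt by simp
      then have "Suc i \<le> i" using Max_ge[OF fin] unfolding i_def by blast
      then show False by simp
    qed
    then have "a \<preceq> step (Suc i)" using total[OF a step_closed[of "Suc i"]] lt by auto
    then show ?thesis using step_covers[OF a lt i(2)] nS by blast
  qed
  then show ?thesis using i step_nbar unfolding step_def by blast
qed

text \<open>A residuum of distinct constants that belongs to the filter is a constant below one, and its
  power with exponent \<open>n - 1\<close> is zero.\<close>

lemma value_unique:
  assumes r: "r \<in> nbar n" and s: "s \<in> nbar n" and le: "cst A r \<preceq> cst A s"
  shows "r \<le> s"
proof (rule ccontr)
  assume "\<not> r \<le> s"
  define t where "t = min 1 (1 - (r - s))"
  have t: "t \<in> nbar n"
    using nbar_plus[OF n_ge_2 nbar_neg[OF n_ge_2 r] s] unfolding t_def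
    by (simp only: diff_diff_eq2 diff_add_eq)
  have t1: "t \<noteq> 1" using \<open>\<not> r \<le> s\<close> unfolding t_def by simp
  have tM: "cst A t \<in> F" using le cst_imp[OF r s] unfolding le_mod_def t_def mvimp_def by simp
  have "mvpow A (cst A t) k \<in> F" for k
    by (induction k) (use FD(2,4) tM in auto)
  moreover have "mvpow A (cst A t) (n - 1) = \<zero>"
    using pow_cst[OF t, of "n - 1"] nbar_gap[OF t t1 n_ge_2] cst_zero
    by (simp only: max_absorb1 diff_le_0_iff_le)
  ultimately show False using FD(3) by metis
qed

definition quotient_value :: "'a \<Rightarrow> real" where
  "quotient_value = (\<lambda>a\<in>carrier A. THE r. r \<in> nbar n \<and> a \<preceq> cst A r \<and> cst A r \<preceq> a)"

lemma quotient_value_eqI: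
  assumes a: "a \<in> carrier A" and r: "r \<in> nbar n" "a \<preceq> cst A r" "cst A r \<preceq> a"
  shows "quotient_value a = r"
proof -
  have "(THE r. r \<in> nbar n \<and> a \<preceq> cst A r \<and> cst A r \<preceq> a) = r"
  proof (rule the_equality)
    fix s assume s: "s \<in> nbar n \<and> a \<preceq> cst A s \<and> cst A s \<preceq> a"
    have "cst A s \<preceq> cst A r" "cst A r \<preceq> cst A s"
      using le_mod_trans[of "cst A s" a "cst A r"] le_mod_trans[of "cst A r" a "cst A s"]
        s r a cst_closed by auto
    then show "s = r" using value_unique s r by (meson order_antisym)
  qed (use r in auto)
  then show ?thesis using a by (simp add: quotient_value_def)
qed

lemma quotient_value:
  assumes a: "a \<in> carrier A"
  shows "quotient_value a \<in> nbar n" "a \<preceq> cst A (quotient_value a)"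
    "cst A (quotient_value a) \<preceq> a"
  using value_exists[OF a] quotient_value_eqI[OF a] by auto

lemma quotient_value_hom: "quotient_value \<in> lnc_hom n A (nbar_alg n)"
proof (rule lnc_homI)
  show "mv_algebra A" by (rule mv_algebra_axioms)
  show "mv_algebra (nbar_alg n)"
    using nbar_alg_lnc[OF n_ge_2] by (simp add: lnc_algebra_def mv_n_algebra_def)
  show "quotient_value \<in> carrier A \<rightarrow>\<^sub>E carrier (nbar_alg n)"
    using quotient_value(1) by (auto simp: nbar_alg_def quotient_value_def)
next
  fix x y assume xy: "x \<in> carrier A" "y \<in> carrier A"
  note x = quotient_value[OF xy(1)] and y = quotient_value[OF xy(2)]
  have "quotient_value (x \<oplus> y) = min 1 (quotient_value x + quotient_value y)"
    using x y xy by (intro quotient_value_eqI) (auto simp: cst_plus cst_closed closed nbar_plus n_ge_2 intro!: le_mod_plus2)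
  then show "quotient_value (x \<oplus> y) = mvplus (nbar_alg n) (quotient_value x) (quotient_value y)"
    by (simp add: nbar_alg_def)
next
  fix x assume xc: "x \<in> carrier A"
  note x = quotient_value[OF xc]
  have "quotient_value (neg x) = 1 - quotient_value x"
    using x xc by (intro quotient_value_eqI) (auto simp: cst_neg cst_closed closed nbar_neg n_ge_2 intro!: le_mod_neg)
  then show "quotient_value (neg x) = mvneg (nbar_alg n) (quotient_value x)"
    by (simp add: nbar_alg_def)
next
  fix r assume r: "r \<in> nbar n"
  then show "quotient_value (cst A r) = cst (nbar_alg n) r"
    by (subst quotient_value_eqI[of _ r]) (auto simp: cst_closed nbar_alg_def intro!: le_mod_of_le le_refl)
qed

lemma quotient_value_one: "a \<in> F \<Longrightarrow> quotient_value a = 1"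
proof (rule quotient_value_eqI)
  assume a: "a \<in> F"
  then show c: "a \<in> carrier A" using FD(1) by auto
  show "1 \<in> nbar n" using nbar_one n_ge_2 by blast
  show "a \<preceq> cst A 1" using le_mod_of_le[OF le_one[OF c]] cst_one by simp
  show "cst A 1 \<preceq> a" using one_le_mod_iff[OF c] a cst_one by simp
qed

end

text \<open>The quotient by a maximal filter containing \<open>D\<close> is the chain, and members of the filter have
  the value one in it.\<close>

lemma hom_one_on:
  fixes B :: "'c lnc"
  assumes B: "lnc_algebra n B" and D: "D \<subseteq> carrier B"
    and fip: "\<And>xs. set xs \<subseteq> D \<Longrightarrow> mv_algebra.mvprod B xs \<noteq> mvzero B"
  obtains h where "h \<in> lnc_hom n B (nbar_alg n)" "\<And>d. d \<in> D \<Longrightarrow> h d = 1"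
proof -
  interpret B: lnc_algebra n B by fact
  obtain M where M: "B.maximal_filter M" and DM: "D \<subseteq> M"
    using B.maximal_filter_containing[OF D fip] by blast
  interpret lnc_maximal_filter n B M
    by unfold_locales (use M B.maximal_filter_def in blast)+
  show ?thesis using that quotient_value_hom quotient_value_one DM by blast
qed

text \<open>If \<open>x\<close> is not below \<open>y\<close>, the residuum \<open>i\<close> of \<open>x\<close> and \<open>y\<close> differs from one, and
  so does the idempotent \<open>i^(n - 1)\<close>. Its negation \<open>u\<close> is then a nonzero idempotent, and
  a homomorphism sending \<open>u\<close> to one cannot send \<open>i\<close> to one.\<close>

lemma homs_separate:
  fixes B :: "'c lnc"
  assumes B: "lnc_algebra n B" and ab: "a \<in> carrier B" "b \<in> carrier B"
    and eq: "\<And>h. h \<in> lnc_hom n B (nbar_alg n) \<Longrightarrow> h a = h b"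
  shows "a = b"
proof -
  interpret B: lnc_algebra n B by fact
  interpret ev: nbar_evaluation n B "lnc_hom n B (nbar_alg n)" "\<lambda>h. h" by (rule hom_evaluation[OF B])
  have le: "B.le x y"
    if xy: "x \<in> carrier B" "y \<in> carrier B" and eq: "\<And>h. h \<in> lnc_hom n B (nbar_alg n) \<Longrightarrow> h x = h y" for x y
  proof (rule ccontr)
    assume n: "\<not> B.le x y"
    define i where "i = mvimp B x y"
    define u where "u = mvneg B (mvpow B i (n - 1))"
    have i: "i \<in> carrier B" unfolding i_def by (rule ev.closed_imp[OF xy])
    have i1: "i \<noteq> mvone B" using n unfolding i_def mvimp_def B.le_def by simp
    have p: "mvpow B i (n - 1) \<in> carrier B" by (rule B.pow_closed[OF i])
    have u: "u \<in> carrier B" "mvtimes B u u = u"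
      unfolding u_def using B.idempotent_neg[OF p B.pow_idempotent[OF i]] p B.closed by auto
    have "u \<noteq> mvzero B"
    proof
      assume "u = mvzero B"
      then have "mvpow B i (n - 1) = mvone B" unfolding u_def using B.neg_neg[OF p] B.neg_zero by metis
      then have "B.le (mvone B) i" using B.pow_le[OF i] by simp
      then show False using B.le_antisym[OF B.le_one[OF i]] i i1 B.one_closed by blast
    qed
    moreover have "B.mvprod xs = mvone B \<or> B.mvprod xs = u" if "set xs \<subseteq> {u}" for xs
      using that
    proof (induction xs)
      case (Cons x xs)
      then have x: "x = u" and "B.mvprod xs = mvone B \<or> B.mvprod xs = u" by auto
      then show ?case using B.times_one[OF u(1)] u(2) by (metis B.mvprod.simps(2))
    qed simp
    moreover have "mvone B \<noteq> mvzero B"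
      using B.cst_inj B.cst_one B.cst_zero nbar_one[OF B.n_ge_2] nbar_zero[of n]
      by (metis inj_onD zero_neq_one)
    ultimately obtain h where h: "h \<in> lnc_hom n B (nbar_alg n)" "h u = 1"
      using hom_one_on[OF B, of "{u}"] u(1) by (metis bot.extremum insertI1 insert_subset)
    have "h i = 1" using ev.e_imp[OF h(1) xy] eq[OF h(1)] unfolding i_def by simp
    then have "h u = 0"
      unfolding u_def using ev.e_neg[OF h(1) p] ev.e_pow_top[OF h(1) i] by simp
    then show False using h by simp
  qed
  show ?thesis by (rule B.le_antisym[OF le[OF ab eq] le[OF ab(2,1) eq[symmetric]] ab])
qed

section \<open>Fuzzy topologies as suprema of a base\<close>

lemma fsup_extensional: "fsup X F \<in> extensional X"
  by (simp add: fsup_def)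

lemma fsup_upper:
  assumes F: "F \<subseteq> X \<rightarrow>\<^sub>E nbar n" and x: "x \<in> X" and U: "U \<in> F"
  shows "U x \<le> fsup X F x"
proof -
  have "insert 0 ((\<lambda>U. U x) ` F) \<subseteq> nbar n" using F x nbar_zero[of n] by auto
  then have "finite (insert 0 ((\<lambda>U. U x) ` F))" using finite_nbar finite_subset by metis
  then show ?thesis
    unfolding fsup_def using x U by (simp add: cSup_eq_Max del: Sup_insert finite_insert)
qed

text \<open>Suprema are maxima because the chain is finite. Openness and covers can therefore be checked
  one point at a time.\<close>

lemma fsup_attained:
  assumes F: "F \<subseteq> X \<rightarrow>\<^sub>E nbar n" and x: "x \<in> X"
  shows "fsup X F x = 0 \<or> (\<exists>U\<in>F. U x = fsup X F x)"
proof -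
  let ?S = "insert 0 ((\<lambda>U. U x) ` F)"
  have "?S \<subseteq> nbar n" using F x nbar_zero[of n] by auto
  then have fin: "finite ?S" using finite_nbar finite_subset by metis
  have "Sup ?S = Max ?S" by (rule cSup_eq_Max[OF fin]) simp
  moreover have "Max ?S \<in> ?S" by (rule Max_in[OF fin]) simp
  ultimately have "fsup X F x \<in> ?S" using x by (simp add: fsup_def)
  then show ?thesis by auto
qed

lemma fsup_nbar:
  assumes F: "F \<subseteq> X \<rightarrow>\<^sub>E nbar n"
  shows "fsup X F \<in> X \<rightarrow>\<^sub>E nbar n"
proof (rule PiE_I)
  fix x assume x: "x \<in> X"
  from fsup_attained[OF F x] show "fsup X F x \<in> nbar n"
  proof
    assume "\<exists>U\<in>F. U x = fsup X F x"
    then obtain U where "U \<in> F" "U x = fsup X F x" by blast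
    then show ?thesis using PiE_mem[of U X "\<lambda>_. nbar n" x] F x by auto
  qed (simp add: nbar_zero)
qed (simp add: fsup_def)

lemma fsup_nonneg: "F \<subseteq> X \<rightarrow>\<^sub>E nbar n \<Longrightarrow> x \<in> X \<Longrightarrow> 0 \<le> fsup X F x"
  using nbar_bounds[OF PiE_mem[OF fsup_nbar, of F X n x]] by simp

lemma fsup_eqI:
  assumes F: "F \<subseteq> X \<rightarrow>\<^sub>E nbar n" and V: "V \<in> X \<rightarrow>\<^sub>E nbar n"
    and upper: "\<And>U x. U \<in> F \<Longrightarrow> x \<in> X \<Longrightarrow> U x \<le> V x"
    and attained: "\<And>x. x \<in> X \<Longrightarrow> V x = 0 \<or> (\<exists>U\<in>F. U x = V x)"
  shows "fsup X F = V"
proof (rule extensionalityI[of _ X])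
  fix x assume x: "x \<in> X"
  have "fsup X F x \<le> V x"
    using fsup_attained[OF F x] upper[OF _ x] nbar_bounds[OF PiE_mem[OF V x]] by fastforce
  moreover have "V x \<le> fsup X F x"
    using attained[OF x] fsup_upper[OF F x] fsup_nonneg[OF F x] by fastforce
  ultimately show "fsup X F x = V x" by simp
qed (use V in \<open>auto simp: fsup_extensional PiE_iff\<close>)

text \<open>A supremum of members of \<open>B\<close> is a function that, at each point, is touched from below by a
  member of \<open>B\<close>. The zero function accounts for the empty supremum.\<close>

lemma sups_iff:
  assumes B: "B \<subseteq> X \<rightarrow>\<^sub>E nbar n" and zero: "(\<lambda>x\<in>X. 0) \<in> B"
  shows "V \<in> {fsup X F | F. F \<subseteq> B} \<longleftrightarrow>
    V \<in> X \<rightarrow>\<^sub>E nbar n \<and> (\<forall>x\<in>X. \<exists>U\<in>B. U x = V x \<and> (\<forall>y\<in>X. U y \<le> V y))"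
proof
  assume "V \<in> {fsup X F | F. F \<subseteq> B}"
  then obtain F where FB: "F \<subseteq> B" and V: "V = fsup X F" by auto
  have F: "F \<subseteq> X \<rightarrow>\<^sub>E nbar n" using FB B by auto
  have "\<exists>U\<in>B. U x = V x \<and> (\<forall>y\<in>X. U y \<le> V y)" if x: "x \<in> X" for x
    using fsup_attained[OF F x]
  proof
    assume "fsup X F x = 0"
    then show ?thesis
      using zero x V fsup_nonneg[OF F] by (intro bexI[of _ "\<lambda>x\<in>X. 0"]) auto
  next
    assume "\<exists>U\<in>F. U x = fsup X F x"
    then show ?thesis using V fsup_upper[OF F] FB by auto
  qed
  then show "V \<in> X \<rightarrow>\<^sub>E nbar n \<and> (\<forall>x\<in>X. \<exists>U\<in>B. U x = V x \<and> (\<forall>y\<in>X. U y \<le> V y))"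
    using fsup_nbar[OF F] V by auto
next
  assume r: "V \<in> X \<rightarrow>\<^sub>E nbar n \<and> (\<forall>x\<in>X. \<exists>U\<in>B. U x = V x \<and> (\<forall>y\<in>X. U y \<le> V y))"
  let ?F = "{U \<in> B. \<forall>y\<in>X. U y \<le> V y}"
  have "fsup X ?F = V" by (rule fsup_eqI[of _ _ n]) (use r B in auto)
  then show "V \<in> {fsup X F | F. F \<subseteq> B}" by (intro CollectI exI[of _ ?F]) auto
qed

lemma fuzzy_space_of_base:
  assumes ne: "X \<noteq> {}" and B: "B \<subseteq> X \<rightarrow>\<^sub>E nbar n"
    and const: "\<And>r. r \<in> nbar n \<Longrightarrow> (\<lambda>x\<in>X. r) \<in> B"
    and min: "\<And>U V. U \<in> B \<Longrightarrow> V \<in> B \<Longrightarrow> fmin X U V \<in> B"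
    and S: "points S = X" "opens S = {fsup X F | F. F \<subseteq> B}"
  shows "fuzzy_space n S"
proof -
  note iff = sups_iff[OF B const[OF nbar_zero]]
  have B_open: "V \<in> opens S" if "V \<in> B" for V
    unfolding S(2) iff using that B by auto
  have "fmin X U V \<in> opens S" if U: "U \<in> opens S" and V: "V \<in> opens S" for U V
    unfolding S(2) iff
  proof (intro conjI ballI)
    note U = U[unfolded S(2) iff] and V = V[unfolded S(2) iff]
    show "fmin X U V \<in> X \<rightarrow>\<^sub>E nbar n" using U V by (auto simp: fmin_def min_def PiE_iff)
    fix x assume x: "x \<in> X"
    obtain U' V' where "U' \<in> B" "U' x = U x" "\<forall>y\<in>X. U' y \<le> U y"
      and "V' \<in> B" "V' x = V x" "\<forall>y\<in>X. V' y \<le> V y" using U V x by metis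
    then show "\<exists>W\<in>B. W x = fmin X U V x \<and> (\<forall>y\<in>X. W y \<le> fmin X U V y)"
      using x by (intro bexI[OF _ min[of U' V']]) (auto simp: fmin_def min_le_iff_disj)
  qed
  moreover have "fsup X G \<in> opens S" if "G \<subseteq> opens S" for G
  proof -
    have GB: "V \<in> X \<rightarrow>\<^sub>E nbar n" "x \<in> X \<Longrightarrow> \<exists>U\<in>B. U x = V x \<and> (\<forall>y\<in>X. U y \<le> V y)"
      if "V \<in> G" for V x using that \<open>G \<subseteq> opens S\<close> unfolding S(2) using iff by blast+
    then have G: "G \<subseteq> X \<rightarrow>\<^sub>E nbar n" by blast
    show ?thesis
      unfolding S(2) iff
    proof (intro conjI ballI)
      show "fsup X G \<in> X \<rightarrow>\<^sub>E nbar n" by (rule fsup_nbar[OF G])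
      fix x assume x: "x \<in> X"
      from fsup_attained[OF G x]
      show "\<exists>U\<in>B. U x = fsup X G x \<and> (\<forall>y\<in>X. U y \<le> fsup X G y)"
      proof
        assume "fsup X G x = 0"
        then show ?thesis
          using const[OF nbar_zero] x fsup_nonneg[OF G] by (intro bexI[of _ "\<lambda>x\<in>X. 0"]) auto
      next
        assume "\<exists>V\<in>G. V x = fsup X G x"
        then obtain V where V: "V \<in> G" "V x = fsup X G x" by auto
        then obtain U where "U \<in> B" "U x = V x" "\<forall>y\<in>X. U y \<le> V y" using GB(2)[OF V(1) x] by auto
        then show ?thesis using V fsup_upper[OF G _ V(1)] by (auto intro: order_trans)
      qed
    qed
  qed
  moreover have "opens S \<subseteq> X \<rightarrow>\<^sub>E nbar n" unfolding S(2) using iff by blast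
  ultimately show ?thesis
    unfolding fuzzy_space_def S(1) using ne B_open const by simp
qed

lemma open_locally:
  assumes S: "fuzzy_space n S" and V: "V \<in> points S \<rightarrow>\<^sub>E nbar n"
    and loc: "\<And>x. x \<in> points S \<Longrightarrow> \<exists>U\<in>opens S. U x = V x \<and> (\<forall>y\<in>points S. U y \<le> V y)"
  shows "V \<in> opens S"
proof -
  let ?F = "{U \<in> opens S. \<forall>y\<in>points S. U y \<le> V y}"
  have "fsup (points S) ?F = V"
  proof (rule fsup_eqI[of _ _ n])
    fix x assume "x \<in> points S"
    then obtain U where "U \<in> opens S" "U x = V x" "\<forall>y\<in>points S. U y \<le> V y" using loc by blast
    then show "V x = 0 \<or> (\<exists>U\<in>?F. U x = V x)" by auto
  qed (use S V in \<open>auto simp: fuzzy_space_def\<close>)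
  moreover have "?F \<subseteq> opens S" by auto
  then have "fsup (points S) ?F \<in> opens S"
    using S unfolding fuzzy_space_def by simp
  ultimately show ?thesis by simp
qed

lemma Cont_iff:
  "f \<in> Cont n S \<longleftrightarrow> f \<in> points S \<rightarrow>\<^sub>E nbar n \<and>
     (\<forall>V\<in>nbar n \<rightarrow>\<^sub>E nbar n. (\<lambda>x\<in>points S. V (f x)) \<in> opens S)"
  by (simp add: Cont_def fcontinuous_def nbar_discrete_def compose_def)

lemma Cont_PiE: "f \<in> Cont n S \<Longrightarrow> f \<in> points S \<rightarrow>\<^sub>E nbar n"
  by (simp add: Cont_iff)

lemma Cont_mem: "f \<in> Cont n S \<Longrightarrow> x \<in> points S \<Longrightarrow> f x \<in> nbar n"
  by (auto simp: Cont_iff)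

lemma Cont_unary_open:
  assumes f: "f \<in> Cont n S" and V: "\<And>r. r \<in> nbar n \<Longrightarrow> V r \<in> nbar n"
  shows "(\<lambda>x\<in>points S. V (f x)) \<in> opens S"
proof -
  have "(\<lambda>x\<in>points S. restrict V (nbar n) (f x)) \<in> opens S"
    using f V by (auto simp: Cont_iff)
  moreover have "(\<lambda>x\<in>points S. restrict V (nbar n) (f x)) = (\<lambda>x\<in>points S. V (f x))"
    using Cont_mem[OF f] by (auto simp: restrict_def)
  ultimately show ?thesis by simp
qed

lemma Cont_open: "f \<in> Cont n S \<Longrightarrow> f \<in> opens S"
  using Cont_unary_open[of f n S "\<lambda>r. r"] Cont_PiE[of f n S] by (simp add: PiE_iff extensional_restrict)

text \<open>A function of \<open>f\<close> and \<open>g\<close> is locally constant: around \<open>x\<close> it has a fixed value on the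
  crisp open set where \<open>f\<close> and \<open>g\<close> keep the values they have at \<open>x\<close>. This set is open
  because the values of \<open>f\<close> and \<open>g\<close> are taken in a discrete space.\<close>

lemma Cont_pointwise:
  assumes n: "n \<ge> 2" and S: "fuzzy_space n S" and f: "f \<in> Cont n S" and g: "g \<in> Cont n S"
    and H: "\<And>r s. r \<in> nbar n \<Longrightarrow> s \<in> nbar n \<Longrightarrow> H r s \<in> nbar n"
  shows "(\<lambda>x\<in>points S. H (f x) (g x)) \<in> Cont n S"
  unfolding Cont_iff
proof (intro conjI ballI)
  show "(\<lambda>x\<in>points S. H (f x) (g x)) \<in> points S \<rightarrow>\<^sub>E nbar n"
    using H Cont_mem[OF f] Cont_mem[OF g] by auto
next
  fix V assume V: "V \<in> nbar n \<rightarrow>\<^sub>E nbar n"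
  let ?W = "\<lambda>x\<in>points S. V ((\<lambda>x\<in>points S. H (f x) (g x)) x)"
  show "?W \<in> opens S"
  proof (rule open_locally[OF S])
    show "?W \<in> points S \<rightarrow>\<^sub>E nbar n" using V H Cont_mem[OF f] Cont_mem[OF g] by auto
    fix x assume x: "x \<in> points S"
    define c where "c = V (H (f x) (g x))"
    have c: "c \<in> nbar n" unfolding c_def using V H Cont_mem[OF f x] Cont_mem[OF g x] by auto
    let ?u = "\<lambda>y\<in>points S. if f y = f x then c else 0"
    let ?v = "\<lambda>y\<in>points S. if g y = g x then c else 0"
    have "?u \<in> opens S" "?v \<in> opens S"
      using Cont_unary_open[OF f, of "\<lambda>r. if r = f x then c else 0"]
        Cont_unary_open[OF g, of "\<lambda>r. if r = g x then c else 0"] c nbar_zero by auto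
    then have "fmin (points S) ?u ?v \<in> opens S" using S unfolding fuzzy_space_def by blast
    moreover have "fmin (points S) ?u ?v x = ?W x" using x by (simp add: fmin_def c_def)
    moreover have "fmin (points S) ?u ?v y \<le> ?W y" if y: "y \<in> points S" for y
    proof -
      have "0 \<le> ?W y" using V H Cont_mem[OF f y] Cont_mem[OF g y] y nbar_bounds[of "V (H (f y) (g y))" n] by auto
      then show ?thesis using y nbar_bounds[OF c] by (auto simp: fmin_def c_def)
    qed
    ultimately show "\<exists>U\<in>opens S. U x = ?W x \<and> (\<forall>y\<in>points S. U y \<le> ?W y)" by blast
  qed
qed

lemma Cont_const:
  assumes S: "fuzzy_space n S" and r: "r \<in> nbar n"
  shows "(\<lambda>x\<in>points S. r) \<in> Cont n S"
proof -
  have "(\<lambda>x\<in>points S. V ((\<lambda>x\<in>points S. r) x)) = (\<lambda>x\<in>points S. V r)" for V :: "real \<Rightarrow> real"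
    by auto
  then show ?thesis using S r unfolding Cont_iff fuzzy_space_def by auto
qed

lemma fcontinuous_Cont:
  assumes \<phi>: "\<phi> \<in> fcontinuous T S" and f: "f \<in> Cont n S"
  shows "compose (points T) f \<phi> \<in> Cont n T"
  unfolding Cont_iff
proof (intro conjI ballI)
  show "compose (points T) f \<phi> \<in> points T \<rightarrow>\<^sub>E nbar n"
    using \<phi> Cont_mem[OF f] by (auto simp: fcontinuous_def compose_def)
  fix V assume "V \<in> nbar n \<rightarrow>\<^sub>E nbar n"
  then have "(\<lambda>x\<in>points S. V (f x)) \<in> opens S" using f unfolding Cont_iff by blast
  then have "compose (points T) (\<lambda>x\<in>points S. V (f x)) \<phi> \<in> opens T"
    using \<phi> by (auto simp: fcontinuous_def)
  moreover have "compose (points T) (\<lambda>x\<in>points S. V (f x)) \<phi> =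
      (\<lambda>x\<in>points T. V (compose (points T) f \<phi> x))"
    unfolding compose_def by (rule restrict_ext) (use \<phi> in \<open>auto simp: fcontinuous_def\<close>)
  ultimately show "(\<lambda>x\<in>points T. V (compose (points T) f \<phi> x)) \<in> opens T" by simp
qed

section \<open>Dual pairs of an algebra and a space\<close>

lemma fcompactD:
  assumes S: "fuzzy_space n S" and "fcompact S" and F: "F \<subseteq> opens S"
    and cover: "\<And>x. x \<in> points S \<Longrightarrow> \<exists>U\<in>F. U x = 1" and n: "n \<ge> 2"
  obtains G where "G \<subseteq> F" "finite G" "\<And>x. x \<in> points S \<Longrightarrow> \<exists>U\<in>G. U x = 1"
proof -
  have O: "opens S \<subseteq> points S \<rightarrow>\<^sub>E nbar n" using S unfolding fuzzy_space_def by blast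
  then have FX: "F \<subseteq> points S \<rightarrow>\<^sub>E nbar n" using F by blast
  have "fsup (points S) F = (\<lambda>x\<in>points S. 1)"
  proof (rule fsup_eqI[OF FX])
    show "(\<lambda>x\<in>points S. 1) \<in> points S \<rightarrow>\<^sub>E nbar n" using nbar_one[OF n] by auto
    show "U x \<le> (\<lambda>x\<in>points S. 1) x" if "U \<in> F" "x \<in> points S" for U x
      using that FX nbar_bounds[of "U x" n] by auto
  qed (use cover in auto)
  then obtain G where G: "G \<subseteq> F" "finite G" "fsup (points S) G = (\<lambda>x\<in>points S. 1)"
    using \<open>fcompact S\<close> F unfolding fcompact_def by blast
  have "\<exists>U\<in>G. U x = 1" if x: "x \<in> points S" for x
    using fsup_attained[of G "points S" n x] G FX x by auto
  then show ?thesis using that G by blast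
qed

context nbar_evaluation
begin

text \<open>The function on points induced by an element, in analogy with the Gelfand transform.\<close>

definition hat :: "'a \<Rightarrow> 'p \<Rightarrow> real" where "hat a = (\<lambda>p\<in>P. e p a)"

lemma hat_apply: "p \<in> P \<Longrightarrow> hat a p = e p a"
  by (simp add: hat_def)

lemma hat_PiE: "a \<in> carrier A \<Longrightarrow> hat a \<in> P \<rightarrow>\<^sub>E nbar n"
  using e_nbar by (auto simp: hat_def)

lemma hat_cst: "r \<in> nbar n \<Longrightarrow> hat (cst A r) = (\<lambda>p\<in>P. r)"
  using e_cst by (auto simp: hat_def restrict_def)

lemma hats_PiE: "hat ` carrier A \<subseteq> P \<rightarrow>\<^sub>E nbar n"
  using hat_PiE by auto

lemma const_hat: "r \<in> nbar n \<Longrightarrow> (\<lambda>p\<in>P. r) \<in> hat ` carrier A"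
  using hat_cst[of r] closed_cst[of r] by (metis imageI)

lemma sups_of_hats_iff:
  "V \<in> {fsup P F | F. F \<subseteq> hat ` carrier A} \<longleftrightarrow> V \<in> P \<rightarrow>\<^sub>E nbar n \<and>
     (\<forall>p\<in>P. \<exists>a\<in>carrier A. e p a = V p \<and> (\<forall>q\<in>P. e q a \<le> V q))"
  unfolding sups_iff[OF hats_PiE const_hat[OF nbar_zero]] by (auto simp: hat_apply)

lemma fmin_hat:
  assumes "a \<in> carrier A" "b \<in> carrier A"
  shows "fmin P (hat a) (hat b) = hat (mvmeet A a b)"
  unfolding fmin_def hat_def by (rule restrict_ext) (use assms in \<open>simp add: e_meet\<close>)

text \<open>The value zero occurs separately because the join of the empty set is zero.\<close>

lemma finite_join:
  assumes "finite D" "D \<subseteq> carrier A"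
  shows "\<exists>b\<in>carrier A. \<forall>p\<in>P. (\<forall>d\<in>D. e p d \<le> e p b) \<and> (e p b = 0 \<or> (\<exists>d\<in>D. e p b = e p d))"
  using assms
proof (induction D rule: finite_induct)
  case empty
  then show ?case using closed_zero e_zero by auto
next
  case (insert d D)
  then obtain b where b: "b \<in> carrier A"
    "\<And>p. p \<in> P \<Longrightarrow> (\<forall>d\<in>D. e p d \<le> e p b) \<and> (e p b = 0 \<or> (\<exists>d\<in>D. e p b = e p d))" by auto
  have d: "d \<in> carrier A" using insert by simp
  have "(\<forall>c\<in>insert d D. e p c \<le> e p (mvjoin A d b)) \<and>
      (e p (mvjoin A d b) = 0 \<or> (\<exists>c\<in>insert d D. e p (mvjoin A d b) = e p c))" if p: "p \<in> P" for p
    using b(2)[OF p] e_join[OF p d b(1)] e_bounds[OF p d] by (auto simp: max_def)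
  then show ?case using closed_join[OF d b(1)] by blast
qed

lemma point_hom:
  assumes p: "p \<in> P"
  shows "(\<lambda>a\<in>carrier A. e p a) \<in> lnc_hom n A (nbar_alg n)"
proof -
  have "e p (mvmeet A a b) = mvmeet (nbar_alg n) (e p a) (e p b)"
    "e p (mvjoin A a b) = mvjoin (nbar_alg n) (e p a) (e p b)"
    "e p (mvimp A a b) = mvimp (nbar_alg n) (e p a) (e p b)"
    if "a \<in> carrier A" "b \<in> carrier A" for a b
    using that p e_nbar by (auto simp: nbar_alg_derived e_meet e_join e_imp)
  then show ?thesis
    using p e_nbar unfolding lnc_hom_def
    by (auto simp: closures closed_meet closed_join closed_imp)
      (auto simp: nbar_alg_def e_simps)
qed

end

text \<open>The points of \<open>S\<close> are the homomorphisms on \<open>A\<close>, and the elements of \<open>A\<close> are the continuous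
  functions on \<open>S\<close>. Stating this through a pairing, rather than for a particular
  construction, covers function spaces as well as copies of them in other types.\<close>

locale dual_pair = separating_evaluation n A "points S" e
  for n and A :: "'a lnc" (structure) and S :: "'x fspace" and e +
  assumes boolean: "fuzzy_boolean_space n S"
    and points_separated: "\<lbrakk>x \<in> points S; y \<in> points S; \<And>a. a \<in> carrier A \<Longrightarrow> e x a = e y a\<rbrakk> \<Longrightarrow> x = y"
    and hom_is_point: "h \<in> lnc_hom n A (nbar_alg n) \<Longrightarrow> \<exists>x\<in>points S. \<forall>a\<in>carrier A. h a = e x a"
    and hat_Cont: "a \<in> carrier A \<Longrightarrow> hat a \<in> Cont n S"
    and Cont_is_hat: "f \<in> Cont n S \<Longrightarrow> \<exists>a\<in>carrier A. f = hat a"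
    and opens_eq: "opens S = {fsup (points S) F | F. F \<subseteq> hat ` carrier A}"

text \<open>Any copy of the spectrum of \<open>A\<close>, with points named by elements of an arbitrary type.\<close>

locale spectrum =
  fixes n and A :: "'a lnc" (structure) and S :: "'x fspace" and e
  assumes A: "lnc_algebra n A"
    and points_bij: "bij_betw (\<lambda>x. \<lambda>a\<in>carrier A. e x a) (points S) (lnc_hom n A (nbar_alg n))"
    and opens_sups: "opens S = {fsup (points S) F | F. F \<subseteq> (\<lambda>a. \<lambda>x\<in>points S. e x a) ` carrier A}"
begin

sublocale alg: lnc_algebra n A by (rule A)

sublocale homs: nbar_evaluation n A "lnc_hom n A (nbar_alg n)" "\<lambda>h. h"
  by (rule hom_evaluation[OF A])

lemma point: "x \<in> points S \<Longrightarrow> (\<lambda>a\<in>carrier A. e x a) \<in> lnc_hom n A (nbar_alg n)"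
  using points_bij by (auto simp: bij_betw_def)

lemma point_surj: "h \<in> lnc_hom n A (nbar_alg n) \<Longrightarrow> \<exists>x\<in>points S. \<forall>a\<in>carrier A. h a = e x a"
proof -
  assume "h \<in> lnc_hom n A (nbar_alg n)"
  then obtain x where "x \<in> points S" "h = (\<lambda>a\<in>carrier A. e x a)"
    using points_bij unfolding bij_betw_def by blast
  then show ?thesis by auto
qed

lemma point_inj:
  "\<lbrakk>x \<in> points S; y \<in> points S; \<And>a. a \<in> carrier A \<Longrightarrow> e x a = e y a\<rbrakk> \<Longrightarrow> x = y"
  by (rule inj_onD[OF bij_betw_imp_inj_on[OF points_bij]]) auto

lemma nbar_evaluation: "nbar_evaluation n A (points S) e"
proof unfold_locales
  fix x a b assume x: "x \<in> points S" and a: "a \<in> carrier A" and b: "b \<in> carrier A"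
  show "e x (a \<oplus> b) = min 1 (e x a + e x b)"
    using homs.e_plus[OF point[OF x] a b] a b by (simp add: homs.closures)
  show "e x (a \<odot> b) = max 0 (e x a + e x b - 1)"
    using homs.e_times[OF point[OF x] a b] a b by (simp add: homs.closures)
next
  fix x a assume x: "x \<in> points S" and a: "a \<in> carrier A"
  show "e x a \<in> nbar n" using homs.e_nbar[OF point[OF x] a] a by simp
  show "e x (neg a) = 1 - e x a"
    using homs.e_neg[OF point[OF x] a] a by (simp add: homs.closures)
next
  fix x assume x: "x \<in> points S"
  show "e x \<zero> = 0" using homs.e_zero[OF point[OF x]] by (simp add: homs.closures)
  show "e x \<one> = 1" using homs.e_one[OF point[OF x]] by (simp add: homs.closures)
  fix r assume r: "r \<in> nbar n"
  show "e x (cst A r) = r" using homs.e_cst[OF point[OF x] r] r by (simp add: homs.closures)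
qed (auto simp: homs.closures homs.n2)

sublocale separating_evaluation n A "points S" e
proof (rule separating_evaluation.intro[OF nbar_evaluation], unfold_locales)
  have zo: "\<zero> \<noteq> \<one>"
    using alg.cst_inj alg.cst_one alg.cst_zero nbar_one[OF homs.n2] nbar_zero[of n]
    by (metis inj_onD zero_neq_one)
  then obtain h where "h \<in> lnc_hom n A (nbar_alg n)"
    using homs_separate[OF A homs.closed_zero homs.closed_one] by blast
  then show "points S \<noteq> {}" using point_surj by blast
next
  fix a b assume ab: "a \<in> carrier A" "b \<in> carrier A" and eq: "\<And>x. x \<in> points S \<Longrightarrow> e x a = e x b"
  show "a = b"
  proof (rule homs_separate[OF A ab])
    fix h assume "h \<in> lnc_hom n A (nbar_alg n)"
    then obtain x where "x \<in> points S" "\<forall>a\<in>carrier A. h a = e x a" using point_surj by blast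
    then show "h a = h b" using ab eq by simp
  qed
qed

abbreviation (input) "X \<equiv> points S"

lemma opens_hats: "opens S = {fsup X F | F. F \<subseteq> hat ` carrier A}"
  using opens_sups unfolding hat_def .

lemma fuzzy_space: "fuzzy_space n S"
  by (rule fuzzy_space_of_base[OF nonempty hats_PiE const_hat _ refl opens_hats])
    (auto simp: fmin_hat closed_meet)

lemma open_iff_hats:
  "V \<in> opens S \<longleftrightarrow> V \<in> X \<rightarrow>\<^sub>E nbar n \<and>
     (\<forall>x\<in>X. \<exists>a\<in>carrier A. e x a = V x \<and> (\<forall>y\<in>X. e y a \<le> V y))"
  unfolding opens_hats sups_of_hats_iff ..

lemma hat_Cont: "a \<in> carrier A \<Longrightarrow> hat a \<in> Cont n S"
  unfolding Cont_iff
proof (intro conjI ballI)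
  assume a: "a \<in> carrier A"
  show "hat a \<in> X \<rightarrow>\<^sub>E nbar n" by (rule hat_PiE[OF a])
  fix V assume V: "V \<in> nbar n \<rightarrow>\<^sub>E nbar n"
  have VN: "V (e x a) \<in> nbar n" if "x \<in> X" for x using V e_nbar[OF that a] by auto
  show "(\<lambda>x\<in>X. V (hat a x)) \<in> opens S"
    unfolding open_iff_hats
  proof (intro conjI ballI)
    show "(\<lambda>x\<in>X. V (hat a x)) \<in> X \<rightarrow>\<^sub>E nbar n" using VN by (auto simp: hat_apply)
    fix x assume x: "x \<in> X"
    let ?r = "e x a"
    \<comment> \<open>the constant \<open>V ?r\<close> cut down to the set where \<open>a\<close> has the value \<open>?r\<close>\<close>
    let ?b = "cst A (V ?r) \<odot> level n A a ?r"
    have r: "?r \<in> nbar n" by (rule e_nbar[OF x a])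
    have eb: "e y ?b = (if e y a = ?r then V ?r else 0)" if y: "y \<in> X" for y
      using y a r VN[OF x] nbar_bounds[OF VN[OF x]]
      by (simp add: e_times closed_cst closed_level e_cst e_level)
    show "\<exists>b\<in>carrier A. e x b = (\<lambda>x\<in>X. V (hat a x)) x \<and> (\<forall>y\<in>X. e y b \<le> (\<lambda>x\<in>X. V (hat a x)) y)"
    proof (intro bexI[of _ ?b] conjI ballI)
      show "?b \<in> carrier A" using a r VN[OF x] by (simp add: closures closed_level)
      show "e x ?b = (\<lambda>x\<in>X. V (hat a x)) x" using x eb[OF x] by (simp add: hat_apply)
      fix y assume y: "y \<in> X"
      show "e y ?b \<le> (\<lambda>x\<in>X. V (hat a x)) y"
        using y eb[OF y] nbar_bounds[OF VN[OF y]] by (auto simp: hat_apply)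
    qed
  qed
qed

lemma zero_dimensional: "zero_dimensional n S"
  unfolding zero_dimensional_def open_basis_def
proof (intro conjI ballI)
  show "Cont n S \<subseteq> opens S" using Cont_open by blast
  show "fmin X U V \<in> Cont n S" if "U \<in> Cont n S" "V \<in> Cont n S" for U V
    unfolding fmin_def by (rule Cont_pointwise[OF n2 fuzzy_space that]) (auto simp: min_def)
  fix U assume "U \<in> opens S"
  then obtain F where "F \<subseteq> hat ` carrier A" "U = fsup X F" unfolding opens_hats by auto
  then show "\<exists>F\<subseteq>Cont n S. U = fsup X F" using hat_Cont by blast
qed

text \<open>The negation \<open>c a\<close> of the idempotent \<open>a^(n - 1)\<close> has the value one exactly where
  \<open>a\<close> differs from one. If no finite part of \<open>E\<close> covered the points, all finite products
  of elements \<open>c a\<close> would be nonzero, so some point would give each of them the value one;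
  that point would not be covered by \<open>E\<close>.\<close>

lemma finite_cover:
  assumes E: "E \<subseteq> carrier A" and cover: "\<And>x. x \<in> X \<Longrightarrow> \<exists>a\<in>E. e x a = 1"
  shows "\<exists>E0\<subseteq>E. finite E0 \<and> (\<forall>x\<in>X. \<exists>a\<in>E0. e x a = 1)"
proof (rule ccontr)
  assume no: "\<not> ?thesis"
  define c where "c a = neg (mvpow A a (n - 1))" for a
  have c: "c a \<in> carrier A" if "a \<in> carrier A" for a
    unfolding c_def using that by (simp only: closed_neg closed_pow)
  have ec: "e x (c a) = (if e x a = 1 then 0 else 1)" if "x \<in> X" "a \<in> carrier A" for x a
    unfolding c_def using that e_pow_top[OF that] e_neg[OF that(1) closed_pow[OF that(2)]] by simp
  have prod: "alg.mvprod xs \<noteq> \<zero>" if xs: "set xs \<subseteq> c ` E" for xs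
  proof -
    obtain E0 where E0: "E0 \<subseteq> E" "finite E0" "set xs = c ` E0"
      using finite_subset_image[OF finite_set xs] by auto
    then have "\<not> (\<forall>x\<in>X. \<exists>a\<in>E0. e x a = 1)" using no by simp
    then obtain x where x: "x \<in> X" "\<And>a. a \<in> E0 \<Longrightarrow> e x a \<noteq> 1" by auto
    have "set ys \<subseteq> c ` E0 \<Longrightarrow> e x (alg.mvprod ys) = 1 \<and> alg.mvprod ys \<in> carrier A" for ys
    proof (induction ys)
      case Nil
      then show ?case using e_one[OF x(1)] closed_one by simp
    next
      case (Cons y ys)
      then obtain a where "a \<in> E0" "y = c a" by auto
      then have "y \<in> carrier A" "e x y = 1" using c ec x E0 E by auto
      then show ?case using Cons e_times[OF x(1)] closed_times by simp
    qed
    then show ?thesis using E0(3) e_zero[OF x(1)] by force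
  qed
  have "c ` E \<subseteq> carrier A" using c E by auto
  then obtain h where h: "h \<in> lnc_hom n A (nbar_alg n)" "\<And>d. d \<in> c ` E \<Longrightarrow> h d = 1"
    using hom_one_on[OF A _ prod] by blast
  obtain x where x: "x \<in> X" "\<And>a. a \<in> carrier A \<Longrightarrow> h a = e x a" using point_surj[OF h(1)] by blast
  obtain a where a: "a \<in> E" "e x a = 1" using cover[OF x(1)] by blast
  then have "e x (c a) = 1" using h(2)[of "c a"] x(2)[of "c a"] c[of a] E by auto
  then show False using ec[OF x(1)] a E by auto
qed

lemma compact: "fcompact S"
  unfolding fcompact_def
proof (intro allI impI, elim conjE)
  fix F assume F: "F \<subseteq> opens S" and one: "fsup X F = (\<lambda>x\<in>X. 1)"
  have O: "opens S \<subseteq> X \<rightarrow>\<^sub>E nbar n" using fuzzy_space unfolding fuzzy_space_def by blast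
  then have FX: "F \<subseteq> X \<rightarrow>\<^sub>E nbar n" using F by blast
  define E where "E = {a \<in> carrier A. \<exists>U\<in>F. \<forall>y\<in>X. e y a \<le> U y}"
  have "\<exists>a\<in>E. e x a = 1" if x: "x \<in> X" for x
  proof -
    obtain U where U: "U \<in> F" "U x = 1" using fsup_attained[OF FX x] one x by auto
    then have "U \<in> opens S" using F by blast
    then obtain a where "a \<in> carrier A" "e x a = U x" "\<forall>y\<in>X. e y a \<le> U y"
      unfolding open_iff_hats using x by blast
    then show ?thesis using U unfolding E_def by auto
  qed
  then obtain E0 where E0: "E0 \<subseteq> E" "finite E0" "\<And>x. x \<in> X \<Longrightarrow> \<exists>a\<in>E0. e x a = 1"
    using finite_cover[of E] unfolding E_def by blast
  have "\<forall>a\<in>E0. \<exists>U\<in>F. \<forall>y\<in>X. e y a \<le> U y" using E0(1) unfolding E_def by blast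
  then obtain u where u: "\<And>a. a \<in> E0 \<Longrightarrow> u a \<in> F" "\<And>a y. a \<in> E0 \<Longrightarrow> y \<in> X \<Longrightarrow> e y a \<le> u a y"
    by metis
  have "fsup X (u ` E0) = (\<lambda>x\<in>X. 1)"
  proof (rule fsup_eqI)
    show "u ` E0 \<subseteq> X \<rightarrow>\<^sub>E nbar n" using u FX by blast
    show "(\<lambda>x\<in>X. 1) \<in> X \<rightarrow>\<^sub>E nbar n" using nbar_one[OF n2] by auto
    have le1: "u a x \<le> 1" if "a \<in> E0" "x \<in> X" for a x
      using nbar_bounds[of "u a x" n] u(1)[OF that(1)] FX that by auto
    then show "U x \<le> (\<lambda>x\<in>X. 1) x" if "U \<in> u ` E0" "x \<in> X" for U x using that by auto
    show "(\<lambda>x\<in>X. 1) x = (0::real) \<or> (\<exists>U\<in>u ` E0. U x = (\<lambda>x\<in>X. 1) x)" if x: "x \<in> X" for x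
    proof -
      obtain a where a: "a \<in> E0" "e x a = 1" using E0(3)[OF x] by blast
      then have "u a x = 1" using u(2)[OF a(1) x] le1[OF a(1) x] by simp
      then show ?thesis using a x by auto
    qed
  qed
  then show "\<exists>G\<subseteq>F. finite G \<and> fsup X G = (\<lambda>x\<in>X. 1)"
    using u(1) E0(2) by (intro exI[of _ "u ` E0"] conjI) auto
qed

lemma kolmogorov: "kolmogorov S"
  unfolding kolmogorov_def
proof (intro ballI impI)
  fix x y assume xy: "x \<in> X" "y \<in> X" "x \<noteq> y"
  then obtain a where a: "a \<in> carrier A" "e x a \<noteq> e y a" using point_inj[OF xy(1,2)] by auto
  then show "\<exists>U\<in>opens S. U x \<noteq> U y"
    using xy Cont_open[OF hat_Cont[OF a(1)]] by (auto simp: hat_apply intro!: bexI[of _ "hat a"])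
qed

text \<open>The element functions below \<open>f\<close> touch \<open>f\<close> at every point because \<open>f\<close> is open. The crisp sets
  where they touch are open, so finitely many of them cover the space, and the join of the
  corresponding elements touches \<open>f\<close> everywhere.\<close>

lemma Cont_is_hat:
  assumes f: "f \<in> Cont n S"
  shows "\<exists>a\<in>carrier A. f = hat a"
proof -
  define E where "E = {a \<in> carrier A. \<forall>y\<in>X. e y a \<le> f y}"
  define u where "u a = (\<lambda>y\<in>X. if hat a y = f y then 1 else 0 :: real)" for a
  have "u a \<in> Cont n S" if "a \<in> carrier A" for a
    unfolding u_def
    by (rule Cont_pointwise[OF n2 fuzzy_space hat_Cont[OF that] f, of "\<lambda>r s. if r = s then 1 else 0"])
      (auto simp: nbar_zero nbar_one[OF n2])
  then have "u ` E \<subseteq> opens S" using Cont_open unfolding E_def by blast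
  moreover have "\<exists>U\<in>u ` E. U x = 1" if x: "x \<in> X" for x
  proof -
    obtain a where "a \<in> carrier A" "e x a = f x" "\<forall>y\<in>X. e y a \<le> f y"
      using Cont_open[OF f] x unfolding open_iff_hats by blast
    then show ?thesis unfolding E_def u_def using x by (auto simp: hat_apply)
  qed
  ultimately obtain G where G: "G \<subseteq> u ` E" "finite G" "\<And>x. x \<in> X \<Longrightarrow> \<exists>U\<in>G. U x = 1"
    using fcompactD[OF fuzzy_space compact _ _ n2] by metis
  then obtain E0 where E0: "E0 \<subseteq> E" "finite E0" "G = u ` E0" by (meson finite_subset_image)
  then have "E0 \<subseteq> carrier A" unfolding E_def by blast
  then obtain b where b: "b \<in> carrier A"
    "\<And>x. x \<in> X \<Longrightarrow> (\<forall>a\<in>E0. e x a \<le> e x b) \<and> (e x b = 0 \<or> (\<exists>a\<in>E0. e x b = e x a))"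
    using finite_join[OF E0(2)] by blast
  have "f x = e x b" if x: "x \<in> X" for x
  proof -
    obtain a where a: "a \<in> E0" "u a x = 1" using G(3)[OF x] E0(3) by blast
    then have "e x a = f x" unfolding u_def using x by (auto simp: hat_apply split: if_splits)
    then have "f x \<le> e x b" using b(2)[OF x] a by auto
    moreover have "e x b \<le> f x"
      using b(2)[OF x] E0(1) x nbar_bounds[OF Cont_mem[OF f x]] unfolding E_def by auto
    ultimately show ?thesis by simp
  qed
  then have "f = hat b"
    using Cont_PiE[OF f] by (intro extensionalityI[of _ X]) (auto simp: hat_def PiE_iff)
  then show ?thesis using b by blast
qed

sublocale dual_pair n A S e
proof unfold_locales
  show "fuzzy_boolean_space n S"
    unfolding fuzzy_boolean_space_def
    using fuzzy_space zero_dimensional compact kolmogorov by blast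
qed (fact point_inj point_surj hat_Cont Cont_is_hat opens_hats)+

end

text \<open>Any copy of the algebra of continuous functions on a Boolean space.\<close>

locale function_algebra = separating_evaluation n A "points S" e
  for n and A :: "'a lnc" (structure) and S :: "'x fspace" and e +
  assumes boolean_space: "fuzzy_boolean_space n S"
    and hats_Cont: "hat ` carrier A = Cont n S"
begin

abbreviation (input) "X \<equiv> points S"

lemma space: "fuzzy_space n S" "zero_dimensional n S" "fcompact S" "kolmogorov S"
  using boolean_space unfolding fuzzy_boolean_space_def by auto

lemma hat_open: "a \<in> carrier A \<Longrightarrow> hat a \<in> opens S"
  using hats_Cont Cont_open by blast

lemma opens_hats: "opens S = {fsup X F | F. F \<subseteq> hat ` carrier A}"
proof (intro equalityI subsetI)
  fix U assume "U \<in> opens S"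
  then obtain F where "F \<subseteq> Cont n S" "U = fsup X F"
    using space(2) unfolding zero_dimensional_def open_basis_def by blast
  then show "U \<in> {fsup X F | F. F \<subseteq> hat ` carrier A}" unfolding hats_Cont by blast
next
  fix U assume "U \<in> {fsup X F | F. F \<subseteq> hat ` carrier A}"
  then obtain F where "F \<subseteq> hat ` carrier A" "U = fsup X F" by blast
  then have "F \<subseteq> opens S" using hat_open by blast
  then show "U \<in> opens S" using \<open>U = fsup X F\<close> space(1) unfolding fuzzy_space_def by blast
qed

lemma points_separated:
  assumes x: "x \<in> X" and y: "y \<in> X" and eq: "\<And>a. a \<in> carrier A \<Longrightarrow> e x a = e y a"
  shows "x = y"
proof (rule ccontr)
  assume "x \<noteq> y"
  then obtain U where U: "U \<in> opens S" "U x \<noteq> U y" using space(4) x y unfolding kolmogorov_def by blast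
  then obtain F where F: "F \<subseteq> hat ` carrier A" "U = fsup X F" unfolding opens_hats by blast
  have "f x = f y" if "f \<in> F" for f using F(1) that eq x y by (auto simp: hat_apply)
  then have "(\<lambda>f. f x) ` F = (\<lambda>f. f y) ` F" by (rule image_cong[OF refl])
  then show False using U(2) F(2) x y by (simp add: fsup_def)
qed

text \<open>For each \<open>a\<close>, the element \<open>c a\<close> is one exactly at the points whose value at \<open>a\<close>
  differs from that of \<open>h\<close>, and \<open>h\<close> sends it to zero. If \<open>h\<close> were not a point, these elements
  would cover the space; by compactness finitely many would have join one, yet \<open>h\<close> sends
  their join to zero.\<close>

lemma hom_is_point:
  assumes h: "h \<in> lnc_hom n A (nbar_alg n)"
  shows "\<exists>x\<in>X. \<forall>a\<in>carrier A. h a = e x a"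
proof (rule ccontr)
  assume no: "\<not> ?thesis"
  interpret homs: nbar_evaluation n A "lnc_hom n A (nbar_alg n)" "\<lambda>h. h"
    by (rule hom_evaluation[OF lnc_algebra])
  define c where "c a = neg (level n A a (h a))" for a
  have ha: "h a \<in> nbar n" if "a \<in> carrier A" for a by (rule homs.e_nbar[OF h that])
  have lev: "level n A a (h a) \<in> carrier A" if "a \<in> carrier A" for a
    by (rule closed_level[OF that ha[OF that]])
  have c: "c a \<in> carrier A" if "a \<in> carrier A" for a
    unfolding c_def by (rule closed_neg[OF lev[OF that]])
  have hc: "h (c a) = 0" if "a \<in> carrier A" for a
    unfolding c_def using homs.e_neg[OF h lev[OF that]] homs.e_level[OF h that ha[OF that]] by simp
  have ec: "e x (c a) = (if e x a = h a then 0 else 1)" if "x \<in> X" "a \<in> carrier A" for x a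
    unfolding c_def using e_neg[OF that(1) lev[OF that(2)]] e_level[OF that ha[OF that(2)]] by simp
  have "hat ` c ` carrier A \<subseteq> opens S" using hat_open c by blast
  moreover have "\<exists>U\<in>hat ` c ` carrier A. U x = 1" if x: "x \<in> X" for x
  proof -
    obtain a where a: "a \<in> carrier A" "h a \<noteq> e x a" using no x by blast
    then have "hat (c a) x = 1" using ec[OF x a(1)] x by (simp add: hat_apply)
    then show ?thesis using a by blast
  qed
  ultimately obtain G where G: "G \<subseteq> hat ` c ` carrier A" "finite G" "\<And>x. x \<in> X \<Longrightarrow> \<exists>U\<in>G. U x = 1"
    using fcompactD[OF space(1,3) _ _ n2] by metis
  then obtain D where D: "D \<subseteq> c ` carrier A" "finite D" "G = hat ` D" by (meson finite_subset_image)
  have DA: "D \<subseteq> carrier A" using D(1) c by blast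
  obtain b where b: "b \<in> carrier A" and b':
    "\<And>g. g \<in> lnc_hom n A (nbar_alg n) \<Longrightarrow> (\<forall>d\<in>D. g d \<le> g b) \<and> (g b = 0 \<or> (\<exists>d\<in>D. g b = g d))"
    using homs.finite_join[OF D(2) DA] by blast
  have "b = \<one>"
  proof (rule separated[OF b closed_one])
    fix x assume x: "x \<in> X"
    obtain d where d: "d \<in> D" "e x d = 1" using G(3)[OF x] D(3) x by (auto simp: hat_apply)
    have "(\<lambda>a\<in>carrier A. e x a) d \<le> (\<lambda>a\<in>carrier A. e x a) b"
      using b'[OF point_hom[OF x]] d(1) by blast
    then have "e x d \<le> e x b" using b d(1) DA by auto
    then show "e x b = e x \<one>" using d(2) e_bounds[OF x b] e_one[OF x] by simp
  qed
  moreover have "h b = 0" using b'[OF h] hc D(1) by auto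
  ultimately show False using homs.e_one[OF h] by simp
qed

sublocale dual_pair n A S e
proof unfold_locales
  show "hat a \<in> Cont n S" if "a \<in> carrier A" for a using that hats_Cont by blast
  show "\<exists>a\<in>carrier A. f = hat a" if "f \<in> Cont n S" for f using that hats_Cont by blast
qed (fact boolean_space points_separated hom_is_point opens_hats)+

end

section \<open>Transposed arrows\<close>

context dual_pair
begin

lemma open_iff:
  "V \<in> opens S \<longleftrightarrow> V \<in> points S \<rightarrow>\<^sub>E nbar n \<and>
     (\<forall>x\<in>points S. \<exists>a\<in>carrier A. e x a = V x \<and> (\<forall>y\<in>points S. e y a \<le> V y))"
  unfolding opens_eq sups_of_hats_iff ..

lemma points_bij_homs:
  "bij_betw (\<lambda>x. \<lambda>a\<in>carrier A. e x a) (points S) (lnc_hom n A (nbar_alg n))"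
  unfolding bij_betw_def
proof (intro conjI equalityI subsetI)
  show "inj_on (\<lambda>x. \<lambda>a\<in>carrier A. e x a) (points S)"
  proof (rule inj_onI)
    fix x y assume xy: "x \<in> points S" "y \<in> points S"
      and eq: "(\<lambda>a\<in>carrier A. e x a) = (\<lambda>a\<in>carrier A. e y a)"
    show "x = y"
      by (rule points_separated[OF xy]) (metis eq restrict_apply')
  qed
next
  fix h assume "h \<in> (\<lambda>x. \<lambda>a\<in>carrier A. e x a) ` points S"
  then show "h \<in> lnc_hom n A (nbar_alg n)" using point_hom by auto
next
  fix h assume h: "h \<in> lnc_hom n A (nbar_alg n)"
  obtain x where x: "x \<in> points S" "\<And>a. a \<in> carrier A \<Longrightarrow> h a = e x a"
    using hom_is_point[OF h] by auto
  have "h \<in> extensional (carrier A)" using h by (simp add: lnc_hom_def PiE_iff)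
  then have "h = (\<lambda>a\<in>carrier A. e x a)" by (intro extensionalityI[of _ "carrier A"]) (auto simp: x)
  then show "h \<in> (\<lambda>x. \<lambda>a\<in>carrier A. e x a) ` points S" using x(1) by auto
qed

lemma carrier_bij_Cont: "bij_betw hat (carrier A) (Cont n S)"
  unfolding bij_betw_def
proof (intro conjI equalityI subsetI)
  show "inj_on hat (carrier A)"
  proof (rule inj_onI)
    fix a b assume ab: "a \<in> carrier A" "b \<in> carrier A" and eq: "hat a = hat b"
    show "a = b" by (rule separated[OF ab]) (metis eq hat_apply)
  qed
qed (use hat_Cont Cont_is_hat in auto)

end

lemma lnc_hom_PiE: "f \<in> lnc_hom n A B \<Longrightarrow> f \<in> carrier A \<rightarrow>\<^sub>E carrier B"
  by (simp add: lnc_hom_def)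

lemma lnc_hom_mem: "f \<in> lnc_hom n A B \<Longrightarrow> a \<in> carrier A \<Longrightarrow> f a \<in> carrier B"
  using lnc_hom_PiE[of f n A B] by auto

lemma lnc_hom_compose:
  assumes A: "lnc_algebra n A" and f: "f \<in> lnc_hom n A B" and g: "g \<in> lnc_hom n B C"
  shows "compose (carrier A) g f \<in> lnc_hom n A C"
proof -
  interpret ev: nbar_evaluation n A "lnc_hom n A (nbar_alg n)" "\<lambda>h. h"
    by (rule hom_evaluation[OF A])
  show ?thesis
    using f g lnc_hom_mem[OF f] lnc_hom_mem[OF g]
    by (auto simp: lnc_hom_def compose_def ev.closures ev.closed_join ev.closed_meet ev.closed_imp)
qed

lemma lnc_hom_id:
  assumes A: "lnc_algebra n A"
  shows "(\<lambda>a\<in>carrier A. a) \<in> lnc_hom n A A"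
proof -
  interpret ev: nbar_evaluation n A "lnc_hom n A (nbar_alg n)" "\<lambda>h. h"
    by (rule hom_evaluation[OF A])
  show ?thesis
    by (auto simp: lnc_hom_def ev.closures ev.closed_join ev.closed_meet ev.closed_imp)
qed

lemma fcontinuous_mem: "f \<in> fcontinuous S T \<Longrightarrow> x \<in> points S \<Longrightarrow> f x \<in> points T"
  by (auto simp: fcontinuous_def)

lemma fcontinuous_compose:
  assumes f: "f \<in> fcontinuous S T" and g: "g \<in> fcontinuous T U"
  shows "compose (points S) g f \<in> fcontinuous S U"
proof -
  have "compose (points S) V (compose (points S) g f) \<in> opens S" if V: "V \<in> opens U" for V
  proof -
    have "compose (points S) (compose (points T) V g) f \<in> opens S"
      using f g V by (simp add: fcontinuous_def)
    moreover have "compose (points S) (compose (points T) V g) f = compose (points S) V (compose (points S) g f)"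
      by (rule extensionalityI[of _ "points S"]) (use fcontinuous_mem[OF f] in \<open>auto simp: compose_def\<close>)
    ultimately show ?thesis by simp
  qed
  then show ?thesis
    using fcontinuous_mem[OF f] fcontinuous_mem[OF g] by (auto simp: fcontinuous_def compose_def)
qed

lemma fcontinuous_id:
  assumes S: "fuzzy_space n S"
  shows "(\<lambda>x\<in>points S. x) \<in> fcontinuous S S"
proof -
  have "compose (points S) V (\<lambda>x\<in>points S. x) = V" if "V \<in> opens S" for V
    using that S by (intro extensionalityI[of _ "points S"]) (auto simp: compose_def fuzzy_space_def PiE_iff)
  then show ?thesis by (auto simp: fcontinuous_def)
qed

text \<open>Adjointness of \<open>f\<close> and \<open>\<phi>\<close> with respect to the pairings \<open>e\<close> and \<open>d\<close>.\<close>

definition transposed ::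
  "'a lnc \<Rightarrow> 'y fspace \<Rightarrow> ('x \<Rightarrow> 'a \<Rightarrow> real) \<Rightarrow> ('y \<Rightarrow> 'b \<Rightarrow> real) \<Rightarrow> ('a \<Rightarrow> 'b) \<Rightarrow> ('y \<Rightarrow> 'x) \<Rightarrow> bool"
  where "transposed A T e d f \<phi> \<longleftrightarrow> (\<forall>a\<in>carrier A. \<forall>t\<in>points T. e (\<phi> t) a = d t (f a))"

locale two_dual_pairs =
  X: dual_pair n A S e + Y: dual_pair n B T d for n A S e B T d
begin

text \<open>An open set of \<open>S\<close> is touched from below by functions of elements \<open>a\<close>; its preimage is
  touched by the functions of the elements \<open>f a\<close>.\<close>

lemma transposed_continuous:
  assumes f: "f \<in> carrier A \<rightarrow> carrier B" and \<phi>: "\<phi> \<in> points T \<rightarrow>\<^sub>E points S"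
    and tr: "transposed A T e d f \<phi>"
  shows "\<phi> \<in> fcontinuous T S"
proof -
  have "compose (points T) V \<phi> \<in> opens T" if V: "V \<in> opens S" for V
    unfolding Y.open_iff
  proof (intro conjI ballI)
    note V = V[unfolded X.open_iff]
    show "compose (points T) V \<phi> \<in> points T \<rightarrow>\<^sub>E nbar n"
      using V \<phi> by (auto simp: compose_def)
    fix t assume t: "t \<in> points T"
    then have "\<phi> t \<in> points S" using \<phi> by auto
    then obtain a where a: "a \<in> carrier A" "e (\<phi> t) a = V (\<phi> t)" "\<forall>y\<in>points S. e y a \<le> V y"
      using V by blast
    have "f a \<in> carrier B" using f a by auto
    moreover have "d s (f a) = e (\<phi> s) a" if "s \<in> points T" for s
      using tr a(1) that by (simp add: transposed_def)
    ultimately show "\<exists>b\<in>carrier B. d t b = compose (points T) V \<phi> t \<and>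
        (\<forall>s\<in>points T. d s b \<le> compose (points T) V \<phi> s)"
      using a t \<phi> by (intro bexI[of _ "f a"]) (auto simp: compose_def)
  qed
  then show ?thesis using \<phi> by (simp add: fcontinuous_def)
qed

text \<open>At a point \<open>t\<close> of \<open>T\<close>, the element \<open>f a\<close> has the value of \<open>a\<close> at \<open>\<phi> t\<close>. So \<open>f\<close>
  preserves whatever is computed pointwise.\<close>

lemma transposed_hom:
  assumes f: "f \<in> carrier A \<rightarrow>\<^sub>E carrier B" and \<phi>: "\<phi> \<in> points T \<rightarrow> points S"
    and tr: "transposed A T e d f \<phi>"
  shows "f \<in> lnc_hom n A B"
proof -
  have fB: "f a \<in> carrier B" if "a \<in> carrier A" for a using f that by auto
  have \<phi>S: "\<phi> t \<in> points S" if "t \<in> points T" for t using \<phi> that by auto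
  have tr': "d t (f a) = e (\<phi> t) a" if "t \<in> points T" "a \<in> carrier A" for t a
    using tr that by (simp add: transposed_def)
  show ?thesis
  proof (rule lnc_homI)
    show "mv_algebra A" "mv_algebra B"
      using X.lnc_algebra Y.lnc_algebra by (simp_all add: lnc_algebra_def mv_n_algebra_def)
    show "f \<in> carrier A \<rightarrow>\<^sub>E carrier B" by (rule f)
    show "f (mvplus A x y) = mvplus B (f x) (f y)" if "x \<in> carrier A" "y \<in> carrier A" for x y
      by (rule Y.separated)
        (use that in \<open>auto simp: fB \<phi>S tr' X.closures Y.closures X.e_simps Y.e_simps\<close>)
    show "f (mvneg A x) = mvneg B (f x)" if "x \<in> carrier A" for x
      by (rule Y.separated)
        (use that in \<open>auto simp: fB \<phi>S tr' X.closures Y.closures X.e_simps Y.e_simps\<close>)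
    show "f (cst A r) = cst B r" if "r \<in> nbar n" for r
      by (rule Y.separated)
        (use that in \<open>auto simp: fB \<phi>S tr' X.closures Y.closures X.e_simps Y.e_simps\<close>)
  qed
qed

lemma transposed_unique_map:
  assumes f: "transposed A T e d f \<phi>" "transposed A T e d f \<psi>"
    and \<phi>: "\<phi> \<in> points T \<rightarrow>\<^sub>E points S" and \<psi>: "\<psi> \<in> points T \<rightarrow>\<^sub>E points S"
  shows "\<phi> = \<psi>"
proof (rule extensionalityI[of _ "points T"])
  fix t assume t: "t \<in> points T"
  show "\<phi> t = \<psi> t"
    by (rule X.points_separated) (use t f \<phi> \<psi> in \<open>auto simp: transposed_def\<close>)
qed (use \<phi> \<psi> in \<open>auto simp: PiE_iff\<close>)

lemma transposed_unique_hom: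
  assumes \<phi>: "transposed A T e d f \<phi>" "transposed A T e d g \<phi>"
    and f: "f \<in> carrier A \<rightarrow>\<^sub>E carrier B" and g: "g \<in> carrier A \<rightarrow>\<^sub>E carrier B"
  shows "f = g"
proof (rule extensionalityI[of _ "carrier A"])
  fix a assume a: "a \<in> carrier A"
  show "f a = g a"
  proof (rule Y.separated)
    fix t assume "t \<in> points T"
    then show "d t (f a) = d t (g a)" using \<phi> a unfolding transposed_def by metis
  qed (use a f g in auto)
qed (use f g in \<open>auto simp: PiE_iff\<close>)

lemma ex1_transposed_map:
  assumes f: "f \<in> lnc_hom n A B"
  shows "\<exists>!\<phi>. \<phi> \<in> fcontinuous T S \<and> transposed A T e d f \<phi>"
proof -
  have "\<exists>x\<in>points S. \<forall>a\<in>carrier A. e x a = d t (f a)" if t: "t \<in> points T" for t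
  proof -
    have "compose (carrier A) (\<lambda>b\<in>carrier B. d t b) f \<in> lnc_hom n A (nbar_alg n)"
      by (rule lnc_hom_compose[OF X.lnc_algebra f Y.point_hom[OF t]])
    then obtain x where "x \<in> points S"
      "\<forall>a\<in>carrier A. compose (carrier A) (\<lambda>b\<in>carrier B. d t b) f a = e x a"
      using X.hom_is_point by blast
    then show ?thesis using lnc_hom_mem[OF f] by (auto simp: compose_def intro!: bexI[of _ x])
  qed
  then obtain \<psi> where \<psi>: "\<And>t. t \<in> points T \<Longrightarrow> \<psi> t \<in> points S \<and> (\<forall>a\<in>carrier A. e (\<psi> t) a = d t (f a))"
    by metis
  let ?\<phi> = "restrict \<psi> (points T)"
  have \<phi>: "?\<phi> \<in> points T \<rightarrow>\<^sub>E points S" and tr: "transposed A T e d f ?\<phi>"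
    using \<psi> by (auto simp: transposed_def)
  moreover have "?\<phi> \<in> fcontinuous T S"
    by (rule transposed_continuous[OF _ \<phi> tr]) (use lnc_hom_mem[OF f] in auto)
  ultimately show ?thesis
    using transposed_unique_map[of f] by (intro ex1I[of _ ?\<phi>]) (auto simp: fcontinuous_def)
qed

lemma ex1_transposed_hom:
  assumes \<phi>: "\<phi> \<in> fcontinuous T S"
  shows "\<exists>!f. f \<in> lnc_hom n A B \<and> transposed A T e d f \<phi>"
proof -
  have "\<exists>b\<in>carrier B. \<forall>t\<in>points T. e (\<phi> t) a = d t b" if a: "a \<in> carrier A" for a
  proof -
    obtain b where b: "b \<in> carrier B" "compose (points T) (X.hat a) \<phi> = Y.hat b"
      using Y.Cont_is_hat[OF fcontinuous_Cont[OF \<phi> X.hat_Cont[OF a]]] by blast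
    have "e (\<phi> t) a = d t b" if "t \<in> points T" for t
      using fun_cong[OF b(2), of t] that fcontinuous_mem[OF \<phi> that]
      by (simp add: compose_def X.hat_apply Y.hat_apply)
    then show ?thesis using b by blast
  qed
  then obtain g where g: "\<And>a. a \<in> carrier A \<Longrightarrow> g a \<in> carrier B \<and> (\<forall>t\<in>points T. e (\<phi> t) a = d t (g a))"
    by metis
  let ?f = "restrict g (carrier A)"
  have f: "?f \<in> carrier A \<rightarrow>\<^sub>E carrier B" and tr: "transposed A T e d ?f \<phi>"
    using g by (auto simp: transposed_def)
  moreover have "?f \<in> lnc_hom n A B"
    by (rule transposed_hom[OF f _ tr]) (use fcontinuous_mem[OF \<phi>] in auto)
  ultimately show ?thesis
    using transposed_unique_hom[of _ \<phi>] by (intro ex1I[of _ ?f]) (auto dest: lnc_hom_PiE)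
qed

end

lemma transposed_compose:
  assumes "transposed A T e d f \<phi>" "transposed B U d c g \<psi>"
    and "f \<in> carrier A \<rightarrow> carrier B" "\<psi> \<in> points U \<rightarrow> points T"
  shows "transposed A U e c (compose (carrier A) g f) (compose (points U) \<phi> \<psi>)"
  unfolding transposed_def
proof (intro ballI)
  fix a u assume a: "a \<in> carrier A" and u: "u \<in> points U"
  have "f a \<in> carrier B" "\<psi> u \<in> points T" using assms a u by auto
  then have "e (\<phi> (\<psi> u)) a = d (\<psi> u) (f a)" "d (\<psi> u) (f a) = c u (g (f a))"
    using assms a u unfolding transposed_def by blast+
  then show "e (compose (points U) \<phi> \<psi> u) a = c u (compose (carrier A) g f a)"
    using a u by (simp add: compose_def)
qed

lemma transposed_id: "transposed A S e e (\<lambda>a\<in>carrier A. a) (\<lambda>x\<in>points S. x)"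
  by (simp add: transposed_def)

text \<open>An arrow transposed to an identity is invertible, its inverse being the transpose in the other
  direction. Both units of the duality are of this kind.\<close>

lemma lnc_iso_of_transposed_id:
  assumes A: "dual_pair n A S e" and B: "dual_pair n B S d"
    and f: "f \<in> carrier A \<rightarrow>\<^sub>E carrier B"
    and tr: "transposed A S e d f (\<lambda>x\<in>points S. x)"
  shows "lnc_iso n A B f"
proof -
  interpret X: dual_pair n A S e by (rule A)
  interpret Y: dual_pair n B S d by (rule B)
  interpret XY: two_dual_pairs n A S e B S d ..
  interpret YX: two_dual_pairs n B S d A S e ..
  have "(\<lambda>x\<in>points S. x) \<in> fcontinuous S S"
    using X.boolean fcontinuous_id unfolding fuzzy_boolean_space_def by blast
  then obtain g where g: "g \<in> lnc_hom n B A" "transposed B S d e g (\<lambda>x\<in>points S. x)"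
    using YX.ex1_transposed_hom by blast
  have "f \<in> lnc_hom n A B" by (rule XY.transposed_hom[OF f _ tr]) auto
  moreover have "g (f a) = a" if a: "a \<in> carrier A" for a
  proof -
    have fa: "f a \<in> carrier B" using f a by auto
    show ?thesis
      by (rule X.separated) (use a fa tr g lnc_hom_mem[OF g(1) fa] in \<open>auto simp: transposed_def\<close>)
  qed
  moreover have "f (g b) = b" if b: "b \<in> carrier B" for b
    by (rule Y.separated)
      (use b f tr g lnc_hom_mem[OF g(1) b] in \<open>auto simp: transposed_def\<close>)
  ultimately show ?thesis using g(1) unfolding lnc_iso_def by blast
qed

lemma fhomeomorphism_of_transposed_id:
  assumes S: "dual_pair n A S e" and T: "dual_pair n A T d"
    and \<phi>: "\<phi> \<in> points T \<rightarrow>\<^sub>E points S"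
    and tr: "transposed A T e d (\<lambda>a\<in>carrier A. a) \<phi>"
  shows "fhomeomorphism T S \<phi>"
proof -
  interpret X: dual_pair n A S e by (rule S)
  interpret Y: dual_pair n A T d by (rule T)
  interpret XY: two_dual_pairs n A S e A T d ..
  interpret YX: two_dual_pairs n A T d A S e ..
  obtain \<psi> where \<psi>: "\<psi> \<in> fcontinuous S T" "transposed A S d e (\<lambda>a\<in>carrier A. a) \<psi>"
    using YX.ex1_transposed_map[OF lnc_hom_id[OF X.lnc_algebra]] by blast
  have "\<phi> \<in> fcontinuous T S" by (rule XY.transposed_continuous[OF _ \<phi> tr]) auto
  moreover have "\<psi> (\<phi> t) = t" if t: "t \<in> points T" for t
  proof -
    have \<phi>t: "\<phi> t \<in> points S" using \<phi> t by auto
    show ?thesis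
      by (rule Y.points_separated)
        (use t \<phi>t tr \<psi> fcontinuous_mem[OF \<psi>(1) \<phi>t] in \<open>auto simp: transposed_def\<close>)
  qed
  moreover have "\<phi> (\<psi> x) = x" if x: "x \<in> points S" for x
    by (rule X.points_separated)
      (use x \<phi> tr \<psi> fcontinuous_mem[OF \<psi>(1) x] in \<open>auto simp: transposed_def\<close>)
  ultimately show ?thesis using \<psi>(1) unfolding fhomeomorphism_def by blast
qed

section \<open>The duality\<close>

lemma compose_restrict_id: "f \<in> extensional X \<Longrightarrow> compose X f (\<lambda>x\<in>X. x) = f"
  by (rule extensionalityI[of _ X]) (auto simp: compose_def)

lemma Spec_spectrum: "lnc_algebra n A \<Longrightarrow> spectrum n A (Spec n A) (\<lambda>h. h)"
proof -
  assume A: "lnc_algebra n A"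
  have "bij_betw (\<lambda>h. h) (lnc_hom n A (nbar_alg n)) (lnc_hom n A (nbar_alg n))"
    by (simp add: bij_betw_def)
  moreover have "(\<lambda>a\<in>carrier A. h a) = h" if "h \<in> lnc_hom n A (nbar_alg n)" for h
    using lnc_hom_PiE[OF that] by (simp add: PiE_iff extensional_restrict)
  ultimately have "bij_betw (\<lambda>h. \<lambda>a\<in>carrier A. h a) (lnc_hom n A (nbar_alg n)) (lnc_hom n A (nbar_alg n))"
    by (subst bij_betw_cong) auto
  then show ?thesis
    using A unfolding spectrum_def by (simp add: Spec_def Let_def)
qed

lemma Spec_dual_pair: "lnc_algebra n A \<Longrightarrow> dual_pair n A (Spec n A) (\<lambda>h. h)"
proof -
  assume "lnc_algebra n A"
  then interpret spectrum n A "Spec n A" "\<lambda>h. h" by (rule Spec_spectrum)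
  show ?thesis by (rule dual_pair_axioms)
qed

lemma Cont_alg_function_algebra:
  assumes n: "n \<ge> 2" and S: "fuzzy_boolean_space n S"
  shows "function_algebra n (Cont_alg n S) S (\<lambda>x f. f x)"
proof -
  have sp: "fuzzy_space n S" using S unfolding fuzzy_boolean_space_def by blast
  note pw = Cont_pointwise[OF n sp]
  have ev: "nbar_evaluation n (Cont_alg n S) (points S) (\<lambda>x f. f x)"
  proof unfold_locales
    fix f g assume fg: "f \<in> carrier (Cont_alg n S)" "g \<in> carrier (Cont_alg n S)"
    then have f: "f \<in> Cont n S" and g: "g \<in> Cont n S" by (auto simp: Cont_alg_def Let_def)
    show "mvplus (Cont_alg n S) f g \<in> carrier (Cont_alg n S)"
      using pw[OF f g, of "\<lambda>r s. min 1 (r + s)"] nbar_plus[OF n]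
      by (simp add: Cont_alg_def nbar_alg_def Let_def)
    show "mvtimes (Cont_alg n S) f g \<in> carrier (Cont_alg n S)"
      using pw[OF f g, of "\<lambda>r s. max 0 (r + s - 1)"] nbar_times[OF n]
      by (simp add: Cont_alg_def nbar_alg_def Let_def)
  next
    fix f assume fg: "f \<in> carrier (Cont_alg n S)"
    then have f: "f \<in> Cont n S" by (auto simp: Cont_alg_def Let_def)
    show "mvneg (Cont_alg n S) f \<in> carrier (Cont_alg n S)"
      using pw[OF f f, of "\<lambda>r s. 1 - r"] nbar_neg[OF n]
      by (simp add: Cont_alg_def nbar_alg_def Let_def)
  qed (use n Cont_const[OF sp] nbar_zero nbar_one[OF n] Cont_mem in
      \<open>auto simp: Cont_alg_def nbar_alg_def Let_def\<close>)
  then interpret nbar_evaluation n "Cont_alg n S" "points S" "\<lambda>x f. f x" .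
  have C: "carrier (Cont_alg n S) = Cont n S" by (simp add: Cont_alg_def Let_def)
  have "hat f = f" if "f \<in> Cont n S" for f
    using Cont_PiE[OF that] by (simp add: hat_def PiE_iff extensional_restrict)
  then have hats: "hat ` carrier (Cont_alg n S) = Cont n S" unfolding C by simp
  show ?thesis
  proof unfold_locales
    show "points S \<noteq> {}" using sp unfolding fuzzy_space_def by blast
    show "f = g" if "f \<in> carrier (Cont_alg n S)" "g \<in> carrier (Cont_alg n S)"
      "\<And>x. x \<in> points S \<Longrightarrow> f x = g x" for f g
      using that Cont_PiE[of f n S] Cont_PiE[of g n S] unfolding C
      by (intro extensionalityI[of _ "points S"]) (auto simp: PiE_iff)
  qed (fact S hats)+
qed

lemma Cont_alg_dual_pair:
  assumes "n \<ge> 2" and "fuzzy_boolean_space n S"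
  shows "dual_pair n (Cont_alg n S) S (\<lambda>x f. f x)"
proof -
  interpret function_algebra n "Cont_alg n S" S "\<lambda>x f. f x"
    by (rule Cont_alg_function_algebra[OF assms])
  show ?thesis by (rule dual_pair_axioms)
qed

text \<open>The spectrum is carried over to the type of points along an injection.\<close>

lemma dual_space_exists:
  assumes A: "lnc_algebra n A" and fits: "dual_fits_alg n TYPE('x) (A :: 'a lnc)"
  shows "\<exists>(S :: 'x fspace) e. dual_pair n A S e"
proof -
  let ?H = "lnc_hom n A (nbar_alg n)"
  obtain i :: "('a \<Rightarrow> real) \<Rightarrow> 'x" where i: "inj_on i ?H"
    using fits unfolding dual_fits_alg_def lepoll_def by blast
  define e where "e = inv_into ?H i"
  define S where "S = \<lparr>points = i ` ?H,
    opens = {fsup (i ` ?H) F | F. F \<subseteq> (\<lambda>a. \<lambda>x\<in>i ` ?H. e x a) ` carrier A}\<rparr>"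
  have "bij_betw e (i ` ?H) ?H"
    unfolding e_def by (rule bij_betw_inv_into) (use i in \<open>simp add: bij_betw_def\<close>)
  moreover have "(\<lambda>a\<in>carrier A. e x a) = e x" if "x \<in> i ` ?H" for x
  proof -
    have "e x \<in> ?H" using that unfolding e_def by (rule inv_into_into)
    then show ?thesis using lnc_hom_PiE by (metis PiE_restrict)
  qed
  ultimately have "bij_betw (\<lambda>x. \<lambda>a\<in>carrier A. e x a) (i ` ?H) ?H"
    by (subst bij_betw_cong) auto
  then interpret spectrum n A S e
    using A unfolding spectrum_def by (simp add: S_def)
  show ?thesis using dual_pair_axioms by blast
qed

text \<open>The algebra of continuous functions is carried over to the type of elements along an
  injection \<open>j\<close> with partial inverse \<open>k\<close>.\<close>

lemma dual_algebra_exists: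
  assumes n: "n \<ge> 2" and S: "fuzzy_boolean_space n S"
    and fits: "dual_fits_space n TYPE('a) (S :: 'x fspace)"
  shows "\<exists>(A :: 'a lnc) e. dual_pair n A S e"
proof -
  let ?C = "Cont n S" and ?N = "Cont_alg n S"
  interpret C: function_algebra n ?N S "\<lambda>x f. f x" by (rule Cont_alg_function_algebra[OF n S])
  have carr: "carrier ?N = ?C" by (simp add: Cont_alg_def Let_def)
  obtain j :: "('x \<Rightarrow> real) \<Rightarrow> 'a" where j: "inj_on j ?C"
    using fits unfolding dual_fits_space_def lepoll_def by blast
  define k where "k = inv_into ?C j"
  have kj: "k (j f) = f" if "f \<in> ?C" for f unfolding k_def using j that by simp
  have kC: "k a \<in> ?C" if "a \<in> j ` ?C" for a unfolding k_def using that by (rule inv_into_into)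
  have jk: "j (k a) = a" if "a \<in> j ` ?C" for a unfolding k_def using that by (rule f_inv_into_f)
  define A where "A = \<lparr>carrier = j ` ?C,
    mvplus = (\<lambda>a b. j (mvplus ?N (k a) (k b))), mvtimes = (\<lambda>a b. j (mvtimes ?N (k a) (k b))),
    mvneg = (\<lambda>a. j (mvneg ?N (k a))), mvzero = j (mvzero ?N), mvone = j (mvone ?N),
    cst = (\<lambda>r. j (cst ?N r))\<rparr>"
  note cl = C.closures[unfolded carr]
  interpret nbar_evaluation n A "points S" "\<lambda>x a. k a x"
    by unfold_locales
      (use n in \<open>auto simp: A_def kj kC cl Cont_mem C.e_simps[unfolded carr]\<close>)
  have hat: "hat a = k a" if "a \<in> carrier A" for a
    using Cont_PiE[OF kC] that by (simp add: hat_def A_def PiE_iff extensional_restrict)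
  interpret function_algebra n A S "\<lambda>x a. k a x"
  proof unfold_locales
    show "points S \<noteq> {}" by (rule C.nonempty)
    show "a = b" if ab: "a \<in> carrier A" "b \<in> carrier A"
      and eq: "\<And>x. x \<in> points S \<Longrightarrow> k a x = k b x" for a b
    proof -
      have "a \<in> j ` ?C" "b \<in> j ` ?C" using ab by (simp_all add: A_def)
      moreover from this have "k a = k b"
        using C.separated[of "k a" "k b"] kC eq carr by simp
      ultimately show ?thesis using jk by metis
    qed
    show "hat ` carrier A = ?C"
      using hat kj kC by (auto simp: A_def image_iff intro!: bexI)
  qed (fact S)
  show ?thesis using dual_pair_axioms by blast
qed

lemma dual_pair_fits_alg:
  assumes "dual_pair n (A :: 'a lnc) (S :: 'x fspace) e"
  shows "dual_fits_alg n TYPE('x) A"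
proof -
  interpret dual_pair n A S e by fact
  show ?thesis
    using bij_betw_inv_into[OF points_bij_homs] unfolding dual_fits_alg_def lepoll_def bij_betw_def
    by blast
qed

lemma dual_pair_fits_space:
  assumes "dual_pair n (A :: 'a lnc) (S :: 'x fspace) e"
  shows "dual_fits_space n TYPE('a) S"
proof -
  interpret dual_pair n A S e by fact
  show ?thesis
    using bij_betw_inv_into[OF carrier_bij_Cont] unfolding dual_fits_space_def lepoll_def bij_betw_def
    by blast
qed

lemma is_category_Lnc: "is_category (Lnc_cat n)"
  unfolding is_category_def Lnc_cat_def
proof (simp, intro conjI ballI allI impI)
  fix A :: "'a lnc" assume "lnc_algebra n A"
  then show "(\<lambda>x\<in>carrier A. x) \<in> lnc_hom n A A" by (rule lnc_hom_id)
next
  fix A B C :: "'a lnc" and f g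
  assume "lnc_algebra n A" "f \<in> lnc_hom n A B" "g \<in> lnc_hom n B C"
  then show "compose (carrier A) g f \<in> lnc_hom n A C" by (rule lnc_hom_compose)
next
  fix A B :: "'a lnc" and f assume f: "f \<in> lnc_hom n A B"
  show "compose (carrier A) f (\<lambda>x\<in>carrier A. x) = f"
    using lnc_hom_PiE[OF f] by (simp add: compose_restrict_id PiE_iff)
  show "compose (carrier A) (\<lambda>x\<in>carrier B. x) f = f"
    using lnc_hom_PiE[OF f] by (simp add: Id_compose[where B = "carrier B"] PiE_iff Pi_iff)
next
  fix A B C D :: "'a lnc" and f g h
  assume "f \<in> lnc_hom n A B"
  then show "compose (carrier A) h (compose (carrier A) g f) =
      compose (carrier A) (compose (carrier B) h g) f"
    by (intro compose_assoc) (auto dest: lnc_hom_mem)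
qed

lemma is_category_FBS: "is_category (FBS_cat n)"
  unfolding is_category_def FBS_cat_def
proof (simp, intro conjI ballI allI impI)
  fix S :: "'x fspace" assume "fuzzy_boolean_space n S"
  then show "(\<lambda>x\<in>points S. x) \<in> fcontinuous S S"
    using fcontinuous_id unfolding fuzzy_boolean_space_def by blast
next
  fix S T U :: "'x fspace" and f g
  assume "f \<in> fcontinuous S T" "g \<in> fcontinuous T U"
  then show "compose (points S) g f \<in> fcontinuous S U" by (rule fcontinuous_compose)
next
  fix S T :: "'x fspace" and f assume f: "f \<in> fcontinuous S T"
  then have "f \<in> points S \<rightarrow>\<^sub>E points T" by (simp add: fcontinuous_def)
  then show "compose (points S) f (\<lambda>x\<in>points S. x) = f"
    and "compose (points S) (\<lambda>x\<in>points T. x) f = f"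
    by (simp_all add: compose_restrict_id Id_compose[where B = "points T"] PiE_iff Pi_iff)
next
  fix S T U V :: "'x fspace" and f g h
  assume "f \<in> fcontinuous S T"
  then show "compose (points S) h (compose (points S) g f) =
      compose (points S) (compose (points T) h g) f"
    by (intro compose_assoc) (auto dest: fcontinuous_mem)
qed

lemma is_category_full_subcategory: "is_category C \<Longrightarrow> is_category (full_subcategory C P)"
  unfolding is_category_def full_subcategory_def by simp

lemma is_category_opposite: "is_category C \<Longrightarrow> is_category (opposite C)"
  unfolding is_category_def opposite_def by simp

text \<open>Dual pairs form the apex of the span. They reach every algebra and space whose dual fits into
  the other type, and no others, since the dual of an object in a pair is a copy of its partner.\<close>

lemma small_duality:
  assumes n: "n \<ge> 2"
  shows "dually_equivalent
    (full_subcategory (Lnc_cat n :: ('a lnc, 'a \<Rightarrow> 'a) category) (dual_fits_alg n TYPE('x)))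
    (full_subcategory (FBS_cat n :: ('x fspace, 'x \<Rightarrow> 'x) category) (dual_fits_space n TYPE('a)))"
  (is "dually_equivalent ?C ?D")
proof -
  let ?W = "{(A :: 'a lnc, S :: 'x fspace, e). dual_pair n A S e}"
  define R where "R = (\<lambda>(A :: 'a lnc, S :: 'x fspace, e) (B :: 'a lnc, T :: 'x fspace, d) f \<phi>.
    f \<in> lnc_hom n A B \<and> \<phi> \<in> fcontinuous T S \<and> transposed A T e d f \<phi>)"
  have C: "Obj ?C = {A. lnc_algebra n A \<and> dual_fits_alg n TYPE('x) A}"
    "Hom ?C = lnc_hom n" "Ident ?C = (\<lambda>A. \<lambda>x\<in>carrier A. x)"
    "Comp ?C = (\<lambda>A B C g f. compose (carrier A) g f)"
    by (auto simp: full_subcategory_def Lnc_cat_def)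
  have D: "Obj (opposite ?D) = {S. fuzzy_boolean_space n S \<and> dual_fits_space n TYPE('a) S}"
    "Hom (opposite ?D) = (\<lambda>S T. fcontinuous T S)" "Ident (opposite ?D) = (\<lambda>S. \<lambda>x\<in>points S. x)"
    "Comp (opposite ?D) = (\<lambda>S T U \<psi> \<phi>. compose (points U) \<phi> \<psi>)"
    by (auto simp: opposite_def full_subcategory_def FBS_cat_def)
  have alg: "lnc_algebra n A" and bool: "fuzzy_boolean_space n S"
    if "dual_pair n A S e" for A :: "'a lnc" and S :: "'x fspace" and e
  proof -
    interpret dual_pair n A S e by fact
    show "lnc_algebra n A" "fuzzy_boolean_space n S" by (rule lnc_algebra boolean)+
  qed
  have "equivalent_categories ?C (opposite ?D)"
  proof (rule equivalence_of_span[where W = ?W and p = fst and q = "\<lambda>w. fst (snd w)" and R = R])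
    show "is_category ?C" by (intro is_category_full_subcategory is_category_Lnc)
    show "is_category (opposite ?D)"
      by (intro is_category_opposite is_category_full_subcategory is_category_FBS)
    show "fst ` ?W = Obj ?C"
    proof (intro equalityI subsetI)
      fix A assume "A \<in> fst ` ?W"
      then obtain S :: "'x fspace" and e where "dual_pair n A S e" by auto
      then show "A \<in> Obj ?C" using alg dual_pair_fits_alg by (auto simp: C)
    next
      fix A assume "A \<in> Obj ?C"
      then obtain S :: "'x fspace" and e where "dual_pair n A S e"
        using dual_space_exists unfolding C by blast
      then show "A \<in> fst ` ?W" by force
    qed
    show "(\<lambda>w. fst (snd w)) ` ?W = Obj (opposite ?D)"
    proof (intro equalityI subsetI)
      fix S assume "S \<in> (\<lambda>w. fst (snd w)) ` ?W"
      then obtain A :: "'a lnc" and e where "dual_pair n A S e" by auto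
      then show "S \<in> Obj (opposite ?D)" using bool dual_pair_fits_space by (auto simp: D)
    next
      fix S assume "S \<in> Obj (opposite ?D)"
      then obtain A :: "'a lnc" and e where "dual_pair n A S e"
        using dual_algebra_exists[OF n] unfolding D by blast
      then show "S \<in> (\<lambda>w. fst (snd w)) ` ?W" by force
    qed
  next
    fix v w f \<phi> assume "R v w f \<phi>"
    then show "f \<in> Hom ?C (fst v) (fst w) \<and> \<phi> \<in> Hom (opposite ?D) (fst (snd v)) (fst (snd w))"
      by (cases v rule: prod_cases3, cases w rule: prod_cases3) (simp add: R_def C D)
  next
    fix v w f assume vw: "v \<in> ?W" "w \<in> ?W" and f: "f \<in> Hom ?C (fst v) (fst w)"
    obtain A S e B T d where eq: "v = (A, S, e)" "w = (B, T, d)" by (metis prod_cases3)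
    interpret two_dual_pairs n A S e B T d
      by (rule two_dual_pairs.intro) (use vw eq in auto)
    show "\<exists>!\<phi>. R v w f \<phi>"
      using ex1_transposed_map[of f] f unfolding R_def eq C by simp
  next
    fix v w \<phi> assume vw: "v \<in> ?W" "w \<in> ?W" and \<phi>: "\<phi> \<in> Hom (opposite ?D) (fst (snd v)) (fst (snd w))"
    obtain A S e B T d where eq: "v = (A, S, e)" "w = (B, T, d)" by (metis prod_cases3)
    interpret two_dual_pairs n A S e B T d
      by (rule two_dual_pairs.intro) (use vw eq in auto)
    show "\<exists>!f. R v w f \<phi>"
      using ex1_transposed_hom[of \<phi>] \<phi> unfolding R_def eq D by simp
  next
    fix w assume w: "w \<in> ?W"
    obtain A S e where eq: "w = (A, S, e)" by (metis prod_cases3)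
    have "dual_pair n A S e" using w eq by simp
    then show "R w w (Ident ?C (fst w)) (Ident (opposite ?D) (fst (snd w)))"
      using alg bool lnc_hom_id fcontinuous_id transposed_id
      unfolding R_def eq C D fuzzy_boolean_space_def by fastforce
  next
    fix u v w f \<phi> g \<psi>
    assume W: "u \<in> ?W" "v \<in> ?W" "w \<in> ?W" and R: "R u v f \<phi>" "R v w g \<psi>"
    obtain A S e B T d E U c where eq: "u = (A, S, e)" "v = (B, T, d)" "w = (E, U, c)"
      by (metis prod_cases3)
    have f: "f \<in> lnc_hom n A B" "\<phi> \<in> fcontinuous T S" "transposed A T e d f \<phi>"
      and g: "g \<in> lnc_hom n B E" "\<psi> \<in> fcontinuous U T" "transposed B U d c g \<psi>"
      using R unfolding R_def eq by auto
    have "lnc_algebra n A" using W(1) eq alg by auto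
    then have "compose (carrier A) g f \<in> lnc_hom n A E" using f g lnc_hom_compose by blast
    moreover have "compose (points U) \<phi> \<psi> \<in> fcontinuous U S" using f g fcontinuous_compose by blast
    moreover have "transposed A U e c (compose (carrier A) g f) (compose (points U) \<phi> \<psi>)"
      by (rule transposed_compose[OF f(3) g(3)])
        (auto intro: lnc_hom_mem[OF f(1)] fcontinuous_mem[OF g(2)])
    ultimately show "R u w (Comp ?C (fst u) (fst v) (fst w) g f)
        (Comp (opposite ?D) (fst (snd u)) (fst (snd v)) (fst (snd w)) \<psi> \<phi>)"
      unfolding R_def eq C D by simp
  qed
  then show ?thesis unfolding dually_equivalent_def .
qed

lemma Spec_map_transposed:
  assumes A: "lnc_algebra n A" and B: "lnc_algebra n B" and f: "f \<in> lnc_hom n A B"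
  shows "Spec_map n A B f \<in> fcontinuous (Spec n B) (Spec n A)"
    and "transposed A (Spec n B) (\<lambda>h. h) (\<lambda>h. h) f (Spec_map n A B f)"
proof -
  interpret two_dual_pairs n A "Spec n A" "\<lambda>h. h" B "Spec n B" "\<lambda>h. h"
    by (intro two_dual_pairs.intro Spec_dual_pair A B)
  have p: "points (Spec n A) = lnc_hom n A (nbar_alg n)" for A :: "'z lnc" by (simp add: Spec_def Let_def)
  have p': "points (Spec n B) = lnc_hom n B (nbar_alg n)" by (simp add: Spec_def Let_def)
  show tr: "transposed A (Spec n B) (\<lambda>h. h) (\<lambda>h. h) f (Spec_map n A B f)"
    by (simp add: transposed_def Spec_map_def p' compose_def)
  show "Spec_map n A B f \<in> fcontinuous (Spec n B) (Spec n A)"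
    by (rule transposed_continuous[OF _ _ tr])
      (use lnc_hom_mem[OF f] lnc_hom_compose[OF A f] in \<open>auto simp: p Spec_map_def\<close>)
qed

lemma Cont_map_transposed:
  assumes n: "n \<ge> 2" and S: "fuzzy_boolean_space n S" and T: "fuzzy_boolean_space n T"
    and \<phi>: "\<phi> \<in> fcontinuous S T"
  shows "Cont_map n S T \<phi> \<in> lnc_hom n (Cont_alg n T) (Cont_alg n S)"
    and "transposed (Cont_alg n T) S (\<lambda>x f. f x) (\<lambda>x f. f x) (Cont_map n S T \<phi>) \<phi>"
proof -
  interpret two_dual_pairs n "Cont_alg n T" T "\<lambda>x f. f x" "Cont_alg n S" S "\<lambda>x f. f x"
    by (intro two_dual_pairs.intro Cont_alg_dual_pair n S T)
  have c: "carrier (Cont_alg n S) = Cont n S" for S :: "'z fspace" by (simp add: Cont_alg_def Let_def)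
  show tr: "transposed (Cont_alg n T) S (\<lambda>x f. f x) (\<lambda>x f. f x) (Cont_map n S T \<phi>) \<phi>"
    by (simp add: transposed_def Cont_map_def c compose_def)
  show "Cont_map n S T \<phi> \<in> lnc_hom n (Cont_alg n T) (Cont_alg n S)"
    by (rule transposed_hom[OF _ _ tr])
      (use fcontinuous_mem[OF \<phi>] fcontinuous_Cont[OF \<phi>] in \<open>auto simp: c Cont_map_def\<close>)
qed

lemma hom_cont_duality_holds:
  assumes n: "n \<ge> 2"
  shows "hom_cont_duality n TYPE('a) TYPE('x)"
proof -
  have pS: "points (Spec n A) = lnc_hom n A (nbar_alg n)" for A :: "'z lnc"
    by (simp add: Spec_def Let_def)
  have cC: "carrier (Cont_alg n S) = Cont n S" for S :: "'z fspace"
    by (simp add: Cont_alg_def Let_def)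
  have Spec_boolean: "fuzzy_boolean_space n (Spec n A)" if "lnc_algebra n A" for A :: "'z lnc"
    using Spec_dual_pair[OF that] by (simp add: dual_pair_def dual_pair_axioms_def)
  have Cont_lnc: "lnc_algebra n (Cont_alg n S)" if "fuzzy_boolean_space n S" for S :: "'z fspace"
  proof -
    interpret dual_pair n "Cont_alg n S" S "\<lambda>x f. f x" by (rule Cont_alg_dual_pair[OF n that])
    show ?thesis by (rule lnc_algebra)
  qed
  have unit_Cont: "alg_unit n A a \<in> Cont n (Spec n A)" if "lnc_algebra n A" "a \<in> carrier A"
    for A :: "'a lnc" and a
  proof -
    interpret dual_pair n A "Spec n A" "\<lambda>h. h" by (rule Spec_dual_pair[OF that(1)])
    show ?thesis using hat_Cont[OF that(2)] that(2) unfolding hat_def by (simp add: alg_unit_def pS)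
  qed
  have unit_hom: "space_unit n S x \<in> lnc_hom n (Cont_alg n S) (nbar_alg n)"
    if "fuzzy_boolean_space n S" "x \<in> points S" for S :: "'x fspace" and x
  proof -
    interpret dual_pair n "Cont_alg n S" S "\<lambda>x f. f x" by (rule Cont_alg_dual_pair[OF n that(1)])
    show ?thesis using point_hom[OF that(2)] that(2) by (simp add: space_unit_def cC)
  qed
  have "is_functor (Lnc_cat n :: ('a lnc, 'a \<Rightarrow> 'a) category) (opposite (FBS_cat n)) (Spec n) (Spec_map n)"
    unfolding is_functor_def
  proof (intro conjI ballI)
    fix A :: "'a lnc" assume "A \<in> Obj (Lnc_cat n)"
    then have A: "lnc_algebra n A" by (simp add: Lnc_cat_def)
    show "Spec n A \<in> Obj (opposite (FBS_cat n))"
      using Spec_boolean[OF A] by (simp add: opposite_def FBS_cat_def)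
    have "compose (carrier A) h (\<lambda>x\<in>carrier A. x) = h" if "h \<in> lnc_hom n A (nbar_alg n)" for h
      using lnc_hom_PiE[OF that] by (simp add: compose_restrict_id PiE_iff)
    then show "Spec_map n A A (Ident (Lnc_cat n) A) = Ident (opposite (FBS_cat n)) (Spec n A)"
      by (auto simp: Spec_map_def Lnc_cat_def opposite_def FBS_cat_def pS intro!: restrict_ext)
  next
    fix A B :: "'a lnc" and f
    assume "A \<in> Obj (Lnc_cat n)" "B \<in> Obj (Lnc_cat n)" "f \<in> Hom (Lnc_cat n) A B"
    then show "Spec_map n A B f \<in> Hom (opposite (FBS_cat n)) (Spec n A) (Spec n B)"
      using Spec_map_transposed(1) by (auto simp: Lnc_cat_def opposite_def FBS_cat_def)
  next
    fix A B C :: "'a lnc" and f g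
    assume "A \<in> Obj (Lnc_cat n)" "B \<in> Obj (Lnc_cat n)" "C \<in> Obj (Lnc_cat n)"
      "f \<in> Hom (Lnc_cat n) A B" "g \<in> Hom (Lnc_cat n) B C"
    then have B: "lnc_algebra n B" and f: "f \<in> lnc_hom n A B" and g: "g \<in> lnc_hom n B C"
      by (auto simp: Lnc_cat_def)
    have "Spec_map n A C (compose (carrier A) g f) =
        compose (points (Spec n C)) (Spec_map n A B f) (Spec_map n B C g)"
      unfolding compose_def[of "points (Spec n C)"] unfolding Spec_map_def pS
    proof (rule restrict_ext)
      fix h assume h: "h \<in> lnc_hom n C (nbar_alg n)"
      have "compose (carrier A) h (compose (carrier A) g f) =
          compose (carrier A) (compose (carrier B) h g) f"
        by (rule compose_assoc) (use lnc_hom_mem[OF f] in auto)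
      then show "compose (carrier A) h (compose (carrier A) g f) =
          (\<lambda>h\<in>lnc_hom n B (nbar_alg n). compose (carrier A) h f)
            ((\<lambda>h\<in>lnc_hom n C (nbar_alg n). compose (carrier B) h g) h)"
        using h lnc_hom_compose[OF B g h] by simp
    qed
    then show "Spec_map n A C (Comp (Lnc_cat n) A B C g f) =
        Comp (opposite (FBS_cat n)) (Spec n A) (Spec n B) (Spec n C) (Spec_map n B C g) (Spec_map n A B f)"
      by (simp add: Lnc_cat_def opposite_def FBS_cat_def)
  qed
  moreover have "is_functor (opposite (FBS_cat n :: ('x fspace, 'x \<Rightarrow> 'x) category)) (Lnc_cat n)
       (Cont_alg n) (\<lambda>T S. Cont_map n S T)"
    unfolding is_functor_def
  proof (intro conjI ballI)
    fix S :: "'x fspace" assume "S \<in> Obj (opposite (FBS_cat n))"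
    then have S: "fuzzy_boolean_space n S" by (simp add: opposite_def FBS_cat_def)
    show "Cont_alg n S \<in> Obj (Lnc_cat n)" using Cont_lnc[OF S] by (simp add: Lnc_cat_def)
    have "compose (points S) g (\<lambda>x\<in>points S. x) = g" if "g \<in> Cont n S" for g
      using Cont_PiE[OF that] by (simp add: compose_restrict_id PiE_iff)
    then show "Cont_map n S S (Ident (opposite (FBS_cat n)) S) = Ident (Lnc_cat n) (Cont_alg n S)"
      by (auto simp: Cont_map_def Lnc_cat_def opposite_def FBS_cat_def cC intro!: restrict_ext)
  next
    fix T S :: "'x fspace" and \<phi>
    assume "T \<in> Obj (opposite (FBS_cat n))" "S \<in> Obj (opposite (FBS_cat n))"
      "\<phi> \<in> Hom (opposite (FBS_cat n)) T S"
    then show "Cont_map n S T \<phi> \<in> Hom (Lnc_cat n) (Cont_alg n T) (Cont_alg n S)"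
      using Cont_map_transposed(1)[OF n] by (auto simp: Lnc_cat_def opposite_def FBS_cat_def)
  next
    fix U T S :: "'x fspace" and \<psi> \<phi>
    assume "U \<in> Obj (opposite (FBS_cat n))" "T \<in> Obj (opposite (FBS_cat n))"
      "S \<in> Obj (opposite (FBS_cat n))"
      "\<psi> \<in> Hom (opposite (FBS_cat n)) U T" "\<phi> \<in> Hom (opposite (FBS_cat n)) T S"
    then have \<psi>: "\<psi> \<in> fcontinuous T U" and \<phi>: "\<phi> \<in> fcontinuous S T"
      by (auto simp: opposite_def FBS_cat_def)
    have "Cont_map n S U (compose (points S) \<psi> \<phi>) =
        compose (carrier (Cont_alg n U)) (Cont_map n S T \<phi>) (Cont_map n T U \<psi>)"
      unfolding compose_def[of "carrier (Cont_alg n U)"] unfolding Cont_map_def cC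
    proof (rule restrict_ext)
      fix g assume g: "g \<in> Cont n U"
      have "compose (points S) g (compose (points S) \<psi> \<phi>) =
          compose (points S) (compose (points T) g \<psi>) \<phi>"
        by (rule compose_assoc) (use fcontinuous_mem[OF \<phi>] in auto)
      then show "compose (points S) g (compose (points S) \<psi> \<phi>) =
          (\<lambda>g\<in>Cont n T. compose (points S) g \<phi>) ((\<lambda>g\<in>Cont n U. compose (points T) g \<psi>) g)"
        using g fcontinuous_Cont[OF \<psi> g] by simp
    qed
    then show "Cont_map n S U (Comp (opposite (FBS_cat n)) U T S \<phi> \<psi>) =
        Comp (Lnc_cat n) (Cont_alg n U) (Cont_alg n T) (Cont_alg n S) (Cont_map n S T \<phi>) (Cont_map n T U \<psi>)"
      by (simp add: Lnc_cat_def opposite_def FBS_cat_def)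
  qed
  moreover have "lnc_iso n A (Cont_alg n (Spec n A)) (alg_unit n A)" if A: "lnc_algebra n A" for A :: "'a lnc"
  proof (rule lnc_iso_of_transposed_id[OF Spec_dual_pair[OF A] Cont_alg_dual_pair[OF n Spec_boolean[OF A]]])
    show "alg_unit n A \<in> carrier A \<rightarrow>\<^sub>E carrier (Cont_alg n (Spec n A))"
      using unit_Cont[OF A] by (auto simp: cC alg_unit_def)
    show "transposed A (Spec n A) (\<lambda>h. h) (\<lambda>x f. f x) (alg_unit n A) (\<lambda>x\<in>points (Spec n A). x)"
      by (simp add: transposed_def alg_unit_def pS)
  qed
  moreover have "compose (carrier A) (alg_unit n B) f =
      compose (carrier A) (Cont_map n (Spec n B) (Spec n A) (Spec_map n A B f)) (alg_unit n A)"
    if f: "f \<in> lnc_hom n A B" and A: "lnc_algebra n A" and B: "lnc_algebra n B"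
    for A B :: "'a lnc" and f
    unfolding compose_def[of "carrier A"]
  proof (rule restrict_ext)
    fix a assume a: "a \<in> carrier A"
    have "alg_unit n B (f a) = compose (points (Spec n B)) (alg_unit n A a) (Spec_map n A B f)"
      unfolding compose_def[of "points (Spec n B)"] unfolding pS
      using a lnc_hom_mem[OF f a] lnc_hom_compose[OF A f, where C = "nbar_alg n"]
      by (auto simp: alg_unit_def Spec_map_def compose_def intro!: restrict_ext)
    then show "alg_unit n B (f a) =
        Cont_map n (Spec n B) (Spec n A) (Spec_map n A B f) (alg_unit n A a)"
      using unit_Cont[OF A a] by (simp add: Cont_map_def)
  qed
  moreover have "fhomeomorphism S (Spec n (Cont_alg n S)) (space_unit n S)"
    if S: "fuzzy_boolean_space n S" for S :: "'x fspace"
  proof (rule fhomeomorphism_of_transposed_id[OF Spec_dual_pair[OF Cont_lnc[OF S]] Cont_alg_dual_pair[OF n S]])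
    show "space_unit n S \<in> points S \<rightarrow>\<^sub>E points (Spec n (Cont_alg n S))"
      using unit_hom[OF S] by (auto simp: pS space_unit_def)
    show "transposed (Cont_alg n S) S (\<lambda>h. h) (\<lambda>x f. f x) (\<lambda>a\<in>carrier (Cont_alg n S). a) (space_unit n S)"
      by (simp add: transposed_def space_unit_def cC)
  qed
  moreover have "compose (points S) (space_unit n T) \<phi> =
      compose (points S) (Spec_map n (Cont_alg n T) (Cont_alg n S) (Cont_map n S T \<phi>)) (space_unit n S)"
    if \<phi>: "\<phi> \<in> fcontinuous S T" and S: "fuzzy_boolean_space n S" and T: "fuzzy_boolean_space n T"
    for S T :: "'x fspace" and \<phi>
    unfolding compose_def[of "points S" "space_unit n T"]
      compose_def[of "points S" "Spec_map n (Cont_alg n T) (Cont_alg n S) (Cont_map n S T \<phi>)"]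
  proof (rule restrict_ext)
    fix x assume x: "x \<in> points S"
    have "space_unit n T (\<phi> x) = compose (carrier (Cont_alg n T)) (space_unit n S x) (Cont_map n S T \<phi>)"
      unfolding compose_def[of "carrier (Cont_alg n T)"] unfolding cC
      using x fcontinuous_mem[OF \<phi> x] fcontinuous_Cont[OF \<phi>]
      by (auto simp: space_unit_def Cont_map_def compose_def intro!: restrict_ext)
    then show "space_unit n T (\<phi> x) =
        Spec_map n (Cont_alg n T) (Cont_alg n S) (Cont_map n S T \<phi>) (space_unit n S x)"
      using unit_hom[OF S x] by (simp add: Spec_map_def)
  qed
  ultimately show ?thesis unfolding hom_cont_duality_def by blast
qed

theorem theorem5p2p7:
  fixes n :: nat
  assumes "n \<ge> 2"
  shows "dually_equivalent
           (full_subcategory (Lnc_cat n :: ('a lnc, 'a \<Rightarrow> 'a) category) (dual_fits_alg n TYPE('x)))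
           (full_subcategory (FBS_cat n :: ('x fspace, 'x \<Rightarrow> 'x) category) (dual_fits_space n TYPE('a)))
         \<and> hom_cont_duality n TYPE('a) TYPE('x)"
  using small_duality[OF assms] hom_cont_duality_holds[OF assms] by blast

end
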